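(* Consider the regression model $Y_i=f_0(x_i)+\epsilon_i$, $1\le i\le n$, with $\epsilon_i$ i.i.d. $\mathcal N(0,1)$ and fixed design $\mathcal X=\{x_1,\dots,x_n\}\subset[0,1]^p$. Assume $f_0\in\mathcal H^\alpha_p\cap\mathcal C(\mathcal S_0)$ with $0<\alpha\le 1$ and $0<q_0=|\mathcal S_0|$ such that $q_0\|f_0\|_{\mathcal H^\alpha}\lesssim \log^{1/2}n$ and $\|f_0\|_\infty\lesssim\log^{1/2}n$. Moreover, assume that $\log p\lesssim n^{q_0/(2\alpha+q_0)}$ and that $\mathcal X$ is $(M,\mathcal S_0)$-regular. Endow the space $\mathcal F_{\mathcal T}$ of tree-structured step functions with the priors (T1)--(T5) described in the context. Then, with $\varepsilon_n=n^{-\alpha/(2\alpha+q_0)}\log^{1/2}n$, $$\Pi\left(f\in\mathcal F_{\mathcal T}:\ \|f_0-f\|_n>M_n\,\varepsilon_n\ \middle|\ Y^{(n)}\right)\to 0$$ for any $M_n\to\infty$, in $P_{f_0}^n$-probability, as $n,p\to\infty$.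
   Context: Notation. $Y^{(n)}=(Y_1,\dots,Y_n)'$; $P_{f_0}^n$ is its law under the regression function $f_0$; $\Pi(\cdot\mid Y^{(n)})$ is the posterior obtained from the prior $\Pi$ and the Gaussian likelihood ($Y_i\sim\mathcal N(f(x_i),1)$ independent). $\|f\|_n^2=\frac1n\sum_{i=1}^n f(x_i)^2$. $a\lesssim b$ means inequality up to a constant. For $x\in\mathbb R^p$, $x_{\mathcal S}$ is the subvector indexed by $\mathcal S\subseteq\{1,\dots,p\}$. Function classes. For $\alpha\in(0,1]$, $\mathcal H^\alpha_p$ is the set of $f:[0,1]^p\to\mathbb R$ with $\|f\|_{\mathcal H^\alpha}=\sup_{x,y\in[0,1]^p}|f(x)-f(y)|/\|x-y\|_2^\alpha<\infty$. $\mathcal C(\mathcal S)$ is the set of $f:[0,1]^p\to\mathbb R$ that are constant in the directions $\{1,\dots,p\}\setminus\mathcal S$. Tree partitions. For a cell $\Omega\subseteq[0,1]^p$ let $\mu(\Omega)=\frac1n\sum_{i=1}^n\mathbb I(x_i\in\Omega)$. A tree partition with $K$ cells is obtained from $[0,1]^p$ by $K-1$ successive splits; each split replaces a current cell $\Omega$ by $\{x\in\Omega:x_j\le\tau\}$ and $\{x\in\Omega:x_j>\tau\}$ for a coordinate $j$ and a threshold $\tau$ chosen among the observed values (of coordinate $j$) in $\mathcal X$. A partition $\{\Omega_k\}_{k=1}^K$ is valid if $\mu(\Omega_k)\ge\bar C^2/n$ for all $k$, for some constant $\bar C^2\in\mathbb N\setminus\{0\}$. $\mathcal V^K_{\mathcal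 S}$ is the family of valid tree partitions of $[0,1]^p$ obtained by splitting $K-1$ times at observed values in $\mathcal X$ along the coordinates in $\mathcal S$, each coordinate in $\mathcal S$ being used at least once. $\Delta(\mathcal V^K_{\mathcal S})$ is the number of distinct partitions of $\mathcal X$ that can be induced by members of $\mathcal V^K_{\mathcal S}$. $\mathcal F(\mathcal V^K_{\mathcal S})$ is the set of step functions $f_{\mathcal T,\beta}=\sum_{k=1}^K\beta_k\mathbb 1_{\Omega_k}$ with $\mathcal T=\{\Omega_k\}_{k=1}^K\in\mathcal V^K_{\mathcal S}$, $\beta\in\mathbb R^K$, and $\mathcal F_{\mathcal T}=\bigcup_{q=0}^\infty\bigcup_{K=1}^\infty\bigcup_{\mathcal S:|\mathcal S|=q}\mathcal F(\mathcal V^K_{\mathcal S})$. $k$-$d$ tree and regularity. The $k$-$d$ tree partition with respect to $\mathcal S$ with $K=2^{s|\mathcal S|}$ cells is obtained by cycling over the coordinates in $\mathcal S$ ($s$ rounds of splits on each); all cells at the same level are split along the same coordinate, each at a median of its data points along that coordinate, so that a cell with $m$ points passes $\lfloor m/2\rfloor$ and $\lceil m/2\rceil$ points to its two children. Let $\mathrm{diam}(\Omega;\mathcal S)=\max_{x,y\in\Omega\cap\mathcal X}\|x_{\mathcal S}-y_{\mathcal S}\|_2$. With $\widehat{\mathcal T}=\{\widehat\Omega_k\}_{k=1}^K\in\mathcal V^K_{\mathcal S}$ denoting the $k$-$d$ tree with $K=2^{s|\mathcal S|}$, the dataset $\mathcal X$ is $(M,\mathcal S)$-regular if $$\max_{1\le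 k\le K}\mathrm{diam}(\widehat\Omega_k;\mathcal S)<M\sum_{k=1}^K\mu(\widehat\Omega_k)\,\mathrm{diam}(\widehat\Omega_k;\mathcal S)$$ for some large enough constant $M>0$ and all $s\in\mathbb N\setminus\{0\}$. Prior. (T1) $\pi(q)\propto c^{-q}p^{-aq}$, $q=0,1,\dots,p$, for some $a,c>0$. (T2) Given $q$, $\pi(\mathcal S\mid q)=1/\binom pq$ for each subset $\mathcal S\subseteq\{1,\dots,p\}$ of size $q$. (T3) $\pi(K)=\lambda^K/((e^\lambda-1)K!)$, $K=1,2,\dots$, for some $\lambda>0$. (T4) Given $\mathcal S,K$, $\pi(\mathcal T\mid\mathcal S,K)=\mathbb 1(\mathcal T\in\mathcal V^K_{\mathcal S})/\Delta(\mathcal V^K_{\mathcal S})$. (T5) Given $K$, $\beta_1,\dots,\beta_K$ are i.i.d. $\mathcal N(0,1)$. *)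

theory Defs
  imports "HOL-Probability.Probability" "HOL-Library.Landau_Symbols"
begin

text \<open>
  The dimension \<open>p\<close> varies with the sample size, so a point of the unit cube of dimension \<open>p\<close> is
  an extensional function on the coordinate set \<open>{1..p}\<close>.
\<close>

type_synonym point = "nat \<Rightarrow> real"
type_synonym cell = "point set"
type_synonym partition = "cell set"

definition cube :: "nat \<Rightarrow> point set" where
  "cube p = (\<Pi>\<^sub>E j\<in>{1..p}. {0..1})"


text \<open>For \<open>y = z\<close> the quotients below are \<open>0 / 0 = 0\<close>, so the diagonal is harmless.\<close>

definition holder_quotients :: "nat \<Rightarrow> real \<Rightarrow> (point \<Rightarrow> real) \<Rightarrow> real set" where
  "holder_quotients p \<alpha> f =
     {\<bar>f y - f z\<bar> / L2_set (\<lambda>j. y j - z j) {1..p} powr \<alpha> | y z. y \<in> cube p \<and> z \<in> cube p}"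

definition holder_norm :: "nat \<Rightarrow> real \<Rightarrow> (point \<Rightarrow> real) \<Rightarrow> real" where
  "holder_norm p \<alpha> f = Sup (holder_quotients p \<alpha> f)"

definition holder_class :: "nat \<Rightarrow> real \<Rightarrow> (point \<Rightarrow> real) set" where
  "holder_class p \<alpha> = {f. bdd_above (holder_quotients p \<alpha> f)}"

definition constant_outside :: "nat \<Rightarrow> nat set \<Rightarrow> (point \<Rightarrow> real) set" where
  "constant_outside p S =
     {f. \<forall>y\<in>cube p. \<forall>z\<in>cube p. (\<forall>j\<in>S. y j = z j) \<longrightarrow> f y = f z}"

definition sup_norm :: "nat \<Rightarrow> (point \<Rightarrow> real) \<Rightarrow> real" where
  "sup_norm p f = (SUP z\<in>cube p. \<bar>f z\<bar>)"


definition lower_part :: "cell \<Rightarrow> nat \<Rightarrow> real \<Rightarrow> cell" where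
  "lower_part \<Omega> j \<tau> = {z \<in> \<Omega>. z j \<le> \<tau>}"

definition upper_part :: "cell \<Rightarrow> nat \<Rightarrow> real \<Rightarrow> cell" where
  "upper_part \<Omega> j \<tau> = {z \<in> \<Omega>. z j > \<tau>}"

text \<open>The design points are \<open>x 1, \<dots>, x n\<close>; repetitions are allowed and counted.\<close>

context
  fixes p n :: nat and x :: "nat \<Rightarrow> point"
begin

definition emp_norm :: "(point \<Rightarrow> real) \<Rightarrow> real" where
  "emp_norm f = sqrt ((\<Sum>i\<in>{1..n}. (f (x i))\<^sup>2) / real n)"

definition npoints :: "cell \<Rightarrow> nat" where
  "npoints \<Omega> = card {i\<in>{1..n}. x i \<in> \<Omega>}"

definition emp_measure :: "cell \<Rightarrow> real" where
  "emp_measure \<Omega> = real (npoints \<Omega>) / real n"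

definition observed_values :: "nat \<Rightarrow> real set" where
  "observed_values j = (\<lambda>i. x i j) ` {1..n}"

text \<open>
  \<open>tree_partition S K T\<close>: the partition \<open>T\<close> arises from the cube by \<open>K - 1\<close> successive splits, and
  \<open>S\<close> is exactly the set of the coordinates used. A split that creates an empty cell is permitted
  here (and may then merge cells of the set \<open>T\<close>), but an empty cell can never disappear
  again, so such partitions are not valid; a valid \<open>T\<close> has exactly \<open>K\<close> cells.
\<close>

inductive tree_partition :: "nat set \<Rightarrow> nat \<Rightarrow> partition \<Rightarrow> bool" where
  root: "tree_partition {} 1 {cube p}"
| split: "\<lbrakk>tree_partition S K T; \<Omega> \<in> T; j \<in> {1..p}; \<tau> \<in> observed_values j\<rbrakk> \<Longrightarrow>
    tree_partition (insert j S) (Suc K) ((T - {\<Omega>}) \<union> {lower_part \<Omega> j \<tau>, upper_part \<Omega> j \<tau>})"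

text \<open>The parameter \<open>C\<close> is the minimal number of design points in a cell.\<close>

definition valid_trees :: "nat \<Rightarrow> nat set \<Rightarrow> nat \<Rightarrow> partition set" where
  "valid_trees C S K =
     {T. tree_partition S K T \<and> (\<forall>\<Omega>\<in>T. emp_measure \<Omega> \<ge> real C / real n)}"

definition induced_partition :: "partition \<Rightarrow> point set set" where
  "induced_partition T = (\<lambda>\<Omega>. \<Omega> \<inter> x ` {1..n}) ` T"

definition partitioning_number :: "nat \<Rightarrow> nat set \<Rightarrow> nat \<Rightarrow> nat" where
  "partitioning_number C S K = card (induced_partition ` valid_trees C S K)"

text \<open>Step heights are indexed by the cells themselves.\<close>

definition step_fun :: "partition \<Rightarrow> (cell \<Rightarrow> real) \<Rightarrow> point \<Rightarrow> real" where
  "step_fun T \<beta> = (\<lambda>z\<in>cube p. \<Sum>\<Omega>\<in>T. \<beta> \<Omega> * indicator \<Omega> z)"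

definition step_funs :: "partition set \<Rightarrow> (point \<Rightarrow> real) set" where
  "step_funs V = {step_fun T \<beta> | T \<beta>. T \<in> V}"

definition tree_funs :: "nat \<Rightarrow> (point \<Rightarrow> real) set" where
  "tree_funs C =
     (\<Union>q. \<Union>K\<in>{1..}. \<Union>S\<in>{S. S \<subseteq> {1..p} \<and> card S = q}. step_funs (valid_trees C S K))"


definition median_split :: "cell \<Rightarrow> nat \<Rightarrow> real \<Rightarrow> bool" where
  "median_split \<Omega> j \<tau> \<longleftrightarrow>
     \<tau> \<in> observed_values j \<and>
     npoints \<Omega> \<le> 2 * npoints {z\<in>\<Omega>. z j \<le> \<tau>} \<and> npoints \<Omega> \<le> 2 * npoints {z\<in>\<Omega>. z j \<ge> \<tau>} \<and>
     {npoints (lower_part \<Omega> j \<tau>), npoints (upper_part \<Omega> j \<tau>)} =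
       {npoints \<Omega> div 2, (npoints \<Omega> + 1) div 2}"

text \<open>\<open>kd_along js T\<close>: level \<open>l\<close> of the tree splits all its cells along the \<open>l\<close>-th entry of \<open>js\<close>.\<close>

inductive kd_along :: "nat list \<Rightarrow> partition \<Rightarrow> bool" where
  root: "kd_along [] {cube p}"
| level: "\<lbrakk>kd_along js T; \<forall>\<Omega>\<in>T. median_split \<Omega> j (\<tau> \<Omega>)\<rbrakk> \<Longrightarrow>
    kd_along (js @ [j]) (\<Union>\<Omega>\<in>T. {lower_part \<Omega> j (\<tau> \<Omega>), upper_part \<Omega> j (\<tau> \<Omega>)})"

definition kd_tree :: "nat set \<Rightarrow> nat \<Rightarrow> partition \<Rightarrow> bool" where
  "kd_tree S s T \<longleftrightarrow>
     (\<exists>js. distinct js \<and> set js = S \<and> kd_along (concat (replicate s js)) T)"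

definition cell_diam :: "nat set \<Rightarrow> cell \<Rightarrow> real" where
  "cell_diam S \<Omega> =
     Max {L2_set (\<lambda>j. y j - z j) S | y z. y \<in> \<Omega> \<inter> x ` {1..n} \<and> z \<in> \<Omega> \<inter> x ` {1..n}}"

text \<open>
  A k-d tree with \<open>2 ^ (s * card S)\<close> cells, whose cell counts are all \<open>n\<close> divided by the number of
  cells, rounded down or up, can only be valid if \<open>C * 2 ^ (s * card S) \<le> n\<close>; regularity speaks
  about these \<open>s\<close>. (For larger \<open>s\<close> there is no valid tree, and eventually all diameters
  vanish, so the strict inequality could not hold.) The k-d tree is determined up to the order
  in which the coordinates are cycled and up to ties of the thresholds; one choice has to satisfy
  the inequality.
\<close>

definition regular_design :: "nat \<Rightarrow> real \<Rightarrow> nat set \<Rightarrow> bool" where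
  "regular_design C M S \<longleftrightarrow>
     (\<forall>s\<ge>1. C * 2 ^ (s * card S) \<le> n \<longrightarrow>
        (\<exists>T\<in>valid_trees C S (2 ^ (s * card S)). kd_tree S s T \<and>
           Max (cell_diam S ` T) < M * (\<Sum>\<Omega>\<in>T. emp_measure \<Omega> * cell_diam S \<Omega>)))"


abbreviation std_normal :: "real measure" where
  "std_normal \<equiv> density lborel std_normal_density"

definition prior_q :: "real \<Rightarrow> real \<Rightarrow> nat \<Rightarrow> real" where
  "prior_q a c q =
     c powr (- real q) * real p powr (- a * real q) /
       (\<Sum>r\<in>{0..p}. c powr (- real r) * real p powr (- a * real r))"

definition prior_S :: "nat set \<Rightarrow> real" where
  "prior_S S = 1 / real (p choose card S)"

definition prior_K :: "real \<Rightarrow> nat \<Rightarrow> real" where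
  "prior_K l K = l ^ K / ((exp l - 1) * fact K)"

text \<open>
  The partitioning number counts partitions of the design, and several tree partitions of the cube
  can induce the same one. The prior given \<open>S\<close> and \<open>K\<close> is uniform over the induced partitions: every
  class of tree partitions with the same trace on the design gets the mass
  \<open>1 / partitioning_number C S K\<close>. The distribution within a class is immaterial and left open. If
  no two valid trees share a trace, this says that \<open>\<pi> S K\<close> is the indicator of
  \<open>valid_trees C S K\<close> divided by the partitioning number.
\<close>

definition tree_prior :: "nat \<Rightarrow> (nat set \<Rightarrow> nat \<Rightarrow> partition \<Rightarrow> real) \<Rightarrow> bool" where
  "tree_prior C \<pi> \<longleftrightarrow>
     (\<forall>S K. (\<forall>T. \<pi> S K T \<ge> 0) \<and> (\<forall>T. T \<notin> valid_trees C S K \<longrightarrow> \<pi> S K T = 0) \<and>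
        (\<forall>P\<in>induced_partition ` valid_trees C S K.
           (\<Sum>T\<in>{T\<in>valid_trees C S K. induced_partition T = P}. \<pi> S K T)
             = 1 / real (partitioning_number C S K)))"

text \<open>
  Functions in \<open>tree_funs C\<close> carry the \<open>\<sigma>\<close>-algebra generated by the point evaluations.
\<close>

definition tree_fun_space :: "nat \<Rightarrow> (point \<Rightarrow> real) measure" where
  "tree_fun_space C = restrict_space (\<Pi>\<^sub>M z\<in>cube p. borel) (tree_funs C)"

definition tree_indices :: "nat \<Rightarrow> (nat set \<times> nat \<times> partition) set" where
  "tree_indices C = {(S, K, T). S \<subseteq> {1..p} \<and> K \<ge> 1 \<and> T \<in> valid_trees C S K}"

text \<open>
  Pairs \<open>(S, K)\<close> without valid tree partitions contribute no mass, so the total mass of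
  \<open>prior\<close> can be less than one. The posterior is normalised and hence does not change if \<open>prior\<close> is
  rescaled to a probability measure.
\<close>

definition prior ::
  "nat \<Rightarrow> real \<Rightarrow> real \<Rightarrow> real \<Rightarrow> (nat set \<Rightarrow> nat \<Rightarrow> partition \<Rightarrow> real) \<Rightarrow> (point \<Rightarrow> real) measure"
where
  "prior C a c l \<pi> =
     density (count_space (tree_indices C))
       (\<lambda>(S, K, T). ennreal (prior_q a c (card S) * prior_S S * prior_K l K * \<pi> S K T)) \<bind>
     (\<lambda>(S, K, T). distr (\<Pi>\<^sub>M \<Omega>\<in>T. std_normal) (tree_fun_space C) (step_fun T))"

definition likelihood :: "(nat \<Rightarrow> real) \<Rightarrow> (point \<Rightarrow> real) \<Rightarrow> real" where
  "likelihood y f = (\<Prod>i\<in>{1..n}. normal_density (f (x i)) 1 (y i))"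

definition data_law :: "(point \<Rightarrow> real) \<Rightarrow> (nat \<Rightarrow> real) measure" where
  "data_law f = (\<Pi>\<^sub>M i\<in>{1..n}. density lborel (normal_density (f (x i)) 1))"

definition posterior :: "(point \<Rightarrow> real) measure \<Rightarrow> (nat \<Rightarrow> real) \<Rightarrow> (point \<Rightarrow> real) measure" where
  "posterior Q y =
     density Q (\<lambda>f. ennreal (likelihood y f) / (\<integral>\<^sup>+ g. ennreal (likelihood y g) \<partial>Q))"

end

definition contraction_rate :: "real \<Rightarrow> nat \<Rightarrow> nat \<Rightarrow> real" where
  "contraction_rate \<alpha> q n = real n powr (- \<alpha> / (2 * \<alpha> + real q)) * sqrt (ln (real n))"

end

theory Submission
  imports Defs
begin

text \<open>
  Write \<open>R = n * rate\<^sup>2\<close>. For a fixed tree, the deviation of a step function from \<open>f0\<close> lies in a space of dimension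
  at most \<open>K + 1\<close>, so with \<open>Q\<close> the squared length of the projection of the noise to that space the log
  likelihood ratio is at most \<open>sqrt (Q * G) - G / 2\<close> and at least \<open>- sqrt (Q * G) - G / 2\<close>, where \<open>G = n * emp_norm\<^sup>2\<close> of
  the deviation. A chi-square tail bound and a count of the trees show that with high probability \<open>Q\<close> is bounded
  by a multiple of \<open>card S * ln p + K * ln n + R\<close> for all trees at once. This replaces tests and entropy bounds:
  where the complexity \<open>card S * ln p + K * ln n\<close> is \<open>O(R)\<close>, the likelihood ratio is at most
  \<open>exp (- G / 4)\<close> as soon as \<open>G\<close> is a large multiple of \<open>R\<close>, and on a box of heights around the values of
  \<open>f0\<close> on a k-d tree it is at least \<open>exp (- O(R))\<close>, which bounds the evidence from below. The likelihood ratio has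
  mean one, so trees of larger complexity contribute on average no more than their prior mass,
  which is exponentially small.
\<close>

section \<open>Tree partitions\<close>

text \<open>Trees of large complexity are controlled only through their prior mass, which must be
  smaller than the lower bound \<open>exp (- D * R)\<close> on the evidence. The critical factor is
  the prior on \<open>K\<close>: the mean of \<open>exp (d * K * ln n)\<close> grows like
  \<open>exp (l * n powr d)\<close>, so \<open>n powr d \<le> R\<close> is required. Since \<alpha>
  \<le> 1 and at least one coordinate is active, the exponent \<open>q / (2 * \<alpha> + q)\<close>
  is at least 1/3, and \<open>d = min (a / 2) (1 / 3)\<close> works for every active set; the bound
  \<open>a / 2\<close> is what the prior on the dimension can afford. The size of the active set may
  vary with the sample size, and \<open>card S0 * ln p\<close> must be \<open>O(R)\<close> although
  only \<open>ln p\<close> is assumed to be bounded. A k-d tree with at least one round in each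
  active coordinate has between \<open>2 ^ card S0\<close> and \<open>n\<close> cells, so
  \<open>card S0\<close> is \<open>O(ln n)\<close>, which the logarithm in the rate absorbs. The
  prior fixes only the mass of classes of trees with equal trace on the design. The evidence is
  therefore bounded below by a whole class, all of whose members fit \<open>f0\<close> equally well
  at the design points.\<close>

lemma lower_upper_disjoint: "lower_part \<Omega> j \<tau> \<inter> upper_part \<Omega> j \<tau> = {}"
  by (auto simp: lower_part_def upper_part_def)

lemma lower_upper_union: "lower_part \<Omega> j \<tau> \<union> upper_part \<Omega> j \<tau> = \<Omega>"
  by (auto simp: lower_part_def upper_part_def)

lemma cube_nonempty: "cube p \<noteq> {}"
proof -
  have "(\<lambda>j\<in>{1..p}. 0) \<in> cube p"
    by (auto simp: cube_def)
  then show ?thesis by blast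
qed

lemma tree_partition_finite: "tree_partition p n x S K T \<Longrightarrow> finite T \<and> finite S \<and> card T \<le> K \<and> card S < K"
proof (induction rule: tree_partition.induct)
  case root
  then show ?case by simp
next
  case (split S K T \<Omega> j \<tau>)
  have "card ((T - {\<Omega>}) \<union> {lower_part \<Omega> j \<tau>, upper_part \<Omega> j \<tau>})
      \<le> card (T - {\<Omega>}) + card {lower_part \<Omega> j \<tau>, upper_part \<Omega> j \<tau>}"
    by (rule card_Un_le)
  also have "\<dots> \<le> card (T - {\<Omega>}) + 2"
    by (simp add: card_insert_if)
  also have "\<dots> = Suc (card T)"
    using split by (metis One_nat_def Suc_1 add.right_neutral add_Suc_right card.remove)
  finally show ?case
    using split by (simp add: card_insert_if)
qed

lemma tree_partition_coords: "tree_partition p n x S K T \<Longrightarrow> S \<subseteq> {1..p} \<and> 1 \<le> K"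
  by (induction rule: tree_partition.induct) auto

text \<open>Absence of empty cells passes backwards through the splits: an empty cell is either kept
  or replaced by its own parts, which are empty again. So all splits behind \<open>T\<close> are
  proper, and each raises the number of cells by exactly one.\<close>

lemma tree_partition_on:
  assumes "tree_partition p n x S K T" "{} \<notin> T"
  shows "partition_on (cube p) T \<and> card T = K"
  using assms
proof (induction rule: tree_partition.induct)
  case root
  then show ?case using cube_nonempty by (auto simp: partition_on_def)
next
  case (split S K T \<Omega> j \<tau>)
  let ?L = "lower_part \<Omega> j \<tau>" and ?U = "upper_part \<Omega> j \<tau>"
  have ne: "?L \<noteq> {}" "?U \<noteq> {}" using split.prems by auto
  have LU: "?L \<subseteq> \<Omega>" "?U \<subseteq> \<Omega>" "?L \<inter> ?U = {}" "?L \<union> ?U = \<Omega>"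
    using lower_upper_union lower_upper_disjoint by blast+
  have "{} \<notin> T" using split.prems ne LU by auto
  then have IH: "partition_on (cube p) T" "card T = K" using split.IH by auto
  have fin: "finite T" using split.hyps tree_partition_finite by blast
  have dis: "\<Omega> \<inter> \<Omega>' = {}" if "\<Omega>' \<in> T - {\<Omega>}" for \<Omega>'
    using IH(1) that split.hyps(2) by (auto simp: partition_on_def disjoint_def)
  have LT: "?L \<notin> T - {\<Omega>}" "?U \<notin> T - {\<Omega>}" "?L \<noteq> ?U"
    using dis ne LU by blast+
  have "card ((T - {\<Omega>}) \<union> {?L, ?U}) = card (T - {\<Omega>}) + 2"
    using fin LT by (subst card_Un_disjoint) auto
  then have c: "card ((T - {\<Omega>}) \<union> {?L, ?U}) = Suc K"
    using IH fin split.hyps(2) by (metis One_nat_def Suc_1 add.right_neutral add_Suc_right card.remove)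
  have "partition_on (cube p) ((T - {\<Omega>}) \<union> {?L, ?U})"
    unfolding partition_on_def
  proof (intro conjI)
    have "\<Union> T = cube p" using IH(1) by (auto simp: partition_on_def)
    then show "\<Union> (T - {\<Omega>} \<union> {?L, ?U}) = cube p" using LU(4) split.hyps(2) by auto
    have "disjoint T" using IH(1) by (auto simp: partition_on_def)
    then show "disjoint (T - {\<Omega>} \<union> {?L, ?U})"
      using dis LU by (intro disjoint_union) (auto simp: disjoint_def)
  qed (use split.prems in auto)
  with c show ?case by auto
qed

text \<open>Undoing the last split may remove a coordinate, so the induction runs over all trees
  whose coordinates lie in \<open>S\<close>. A split is determined by a cell, a coordinate and the
  index of the design point that supplies the threshold, hence at most
  \<open>Suc K * card S * n\<close> choices per step.\<close>

lemma card_trees: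
  assumes "finite S"
  shows "finite {T. \<exists>S'\<subseteq>S. tree_partition p n x S' (Suc K) T} \<and>
   card {T. \<exists>S'\<subseteq>S. tree_partition p n x S' (Suc K) T} \<le> (Suc K * card S * n) ^ K"
proof (induction K)
  case 0
  have "{T. \<exists>S'\<subseteq>S. tree_partition p n x S' (Suc 0) T} \<subseteq> {{cube p}}"
  proof
    fix T assume "T \<in> {T. \<exists>S'\<subseteq>S. tree_partition p n x S' (Suc 0) T}"
    then obtain S' where "tree_partition p n x S' (Suc 0) T" by blast
    then show "T \<in> {{cube p}}"
    proof (cases rule: tree_partition.cases)
      case (split S'' T' \<Omega> j \<tau>)
      then show ?thesis using tree_partition_coords[of p n x S'' 0 T'] by simp
    qed simp
  qed
  note sub = this
  show ?case using finite_subset[OF sub] card_mono[OF _ sub] by simp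
next
  case (Suc K)
  let ?A = "{T. \<exists>S'\<subseteq>S. tree_partition p n x S' (Suc K) T}"
  let ?B = "{T. \<exists>S'\<subseteq>S. tree_partition p n x S' (Suc (Suc K)) T}"
  let ?F = "\<lambda>(T, \<Omega>, j, i). (T - {\<Omega>}) \<union> {lower_part \<Omega> j (x i j), upper_part \<Omega> j (x i j)}"
  let ?D = "SIGMA T:?A. T \<times> S \<times> {1..n}"
  have finA: "finite ?A" and cA: "card ?A \<le> (Suc K * card S * n) ^ K" using Suc by auto
  have sub: "?B \<subseteq> ?F ` ?D"
  proof
    fix T assume "T \<in> ?B"
    then obtain S' where S': "S' \<subseteq> S" "tree_partition p n x S' (Suc (Suc K)) T" by auto
    from S'(2) show "T \<in> ?F ` ?D"
    proof (cases rule: tree_partition.cases)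
      case (split S'' T' \<Omega> j \<tau>)
      then obtain i where "\<tau> = x i j" "i \<in> {1..n}" by (auto simp: observed_values_def)
      moreover have "T' \<in> ?A" using split S' by blast
      ultimately show ?thesis using split S' by (intro image_eqI[of _ _ "(T', \<Omega>, j, i)"]) auto
    qed simp
  qed
  have cT: "finite T \<and> card T \<le> Suc K" if "T \<in> ?A" for T
    using that tree_partition_finite by blast
  have finD: "finite ?D" using cT assms by (intro finite_SigmaI[OF finA] finite_cartesian_product) auto
  have "card ?D = (\<Sum>T\<in>?A. card (T \<times> S \<times> {1..n}))"
    using cT assms by (intro card_SigmaI[OF finA]) auto
  also have "\<dots> \<le> (\<Sum>T\<in>?A. Suc K * card S * n)"
    using cT by (intro sum_mono) (auto simp: card_cartesian_product intro!: mult_mono simp del: mult_Suc)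
  also have "\<dots> \<le> (Suc K * card S * n) ^ K * (Suc K * card S * n)"
    using cA by (simp del: mult_Suc)
  also have "\<dots> = (Suc K * card S * n) ^ Suc K" by simp
  also have "\<dots> \<le> (Suc (Suc K) * card S * n) ^ Suc K"
    by (intro power_mono mult_mono) auto
  finally have "card ?D \<le> (Suc (Suc K) * card S * n) ^ Suc K" .
  moreover have "card ?B \<le> card ?D"
    using sub finD by (meson card_image_le card_mono finite_imageI le_trans)
  ultimately show ?case using sub finD finite_surj by (meson le_trans)
qed

lemma valid_trees_nonempty_cells:
  assumes "T \<in> valid_trees p n x C S K" "0 < C" "0 < n" "\<Omega> \<in> T"
  shows "0 < npoints n x \<Omega>" "\<exists>i\<in>{1..n}. x i \<in> \<Omega>"
proof -
  have "real C / real n \<le> real (npoints n x \<Omega>) / real n"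
    using assms by (auto simp: valid_trees_def emp_measure_def)
  then have "real C \<le> real (npoints n x \<Omega>)" using assms by (simp add: divide_le_cancel)
  then show "0 < npoints n x \<Omega>" using assms by simp
  then show "\<exists>i\<in>{1..n}. x i \<in> \<Omega>" by (auto simp: npoints_def card_gt_0_iff)
qed

lemma valid_trees_partition:
  assumes "T \<in> valid_trees p n x C S K" "0 < C" "0 < n"
  shows "partition_on (cube p) T" "card T = K" "finite T" "K \<le> n" "card S < K" "finite S" "1 \<le> K"
proof -
  have t: "tree_partition p n x S K T" using assms by (auto simp: valid_trees_def)
  have "{} \<notin> T" using valid_trees_nonempty_cells[OF assms] by blast
  then show part: "partition_on (cube p) T" and cT: "card T = K" using tree_partition_on t by blast+
  show fin: "finite T" "card S < K" "finite S" "1 \<le> K"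
    using tree_partition_finite[OF t] tree_partition_coords[OF t] by auto
  \<comment> \<open>One design index per cell; the cells being disjoint, the choice is injective and
    yields \<open>K \<le> n\<close>.\<close>
  define g where "g \<Omega> = (SOME i. i \<in> {1..n} \<and> x i \<in> \<Omega>)" for \<Omega>
  have g: "g \<Omega> \<in> {1..n} \<and> x (g \<Omega>) \<in> \<Omega>" if "\<Omega> \<in> T" for \<Omega>
    unfolding g_def using valid_trees_nonempty_cells(2)[OF assms that] by (rule_tac someI_ex) blast
  have "inj_on g T"
  proof (rule inj_onI)
    fix A B assume "A \<in> T" "B \<in> T" "g A = g B"
    then have "x (g A) \<in> A \<inter> B" using g[of A] g[of B] by auto
    then show "A = B" using part \<open>A \<in> T\<close> \<open>B \<in> T\<close> by (auto simp: partition_on_def disjoint_def)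
  qed
  moreover have "g ` T \<subseteq> {1..n}" using g by blast
  ultimately show "K \<le> n" using card_inj_on_le[of g T "{1..n}"] cT by simp
qed

lemma finite_valid_trees: "finite S \<Longrightarrow> finite (valid_trees p n x C S K)"
proof (cases K)
  case 0
  then have "valid_trees p n x C S K = {}" using tree_partition_coords by (fastforce simp: valid_trees_def)
  then show ?thesis by simp
next
  case (Suc K')
  assume "finite S"
  then have "finite {T. \<exists>S'\<subseteq>S. tree_partition p n x S' K T}"
    using card_trees[of S p n x K'] Suc by simp
  then show ?thesis by (rule finite_subset[rotated]) (auto simp: valid_trees_def)
qed

text \<open>Validity bounds the numbers of cells and of coordinates by \<open>n\<close>, and there
  are at most \<open>n\<close> thresholds per coordinate. The logarithm of this crude count is
  \<open>3 * K * ln n\<close>, which is of the order of the complexity anyway.\<close>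

lemma card_valid_trees:
  assumes "0 < C" "0 < n"
  shows "card (valid_trees p n x C S K) \<le> n ^ (3 * K)"
proof (cases "valid_trees p n x C S K = {}")
  case False
  then obtain T where "T \<in> valid_trees p n x C S K" by auto
  note * = valid_trees_partition[OF this assms]
  obtain K' where K': "K = Suc K'" using * by (cases K) auto
  have "valid_trees p n x C S K \<subseteq> {T. \<exists>S'\<subseteq>S. tree_partition p n x S' (Suc K') T}"
    using K' by (auto simp: valid_trees_def)
  then have "card (valid_trees p n x C S K) \<le> (Suc K' * card S * n) ^ K'"
    using card_trees[OF *(6), of p n x K'] by (meson card_mono le_trans)
  also have "\<dots> \<le> (n * n * n) ^ K'"
    using * K' by (intro power_mono mult_mono) auto
  also have "\<dots> = n ^ (3 * K')" by (simp add: power_mult power3_eq_cube)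
  also have "\<dots> \<le> n ^ (3 * K)" using assms K' by (intro power_increasing) auto
  finally show ?thesis .
qed auto

text \<open>Every cell of a valid tree holds a design point, so \<open>K \<le> n\<close>: of the
  infinitely many values of \<open>K\<close> only finitely many carry trees.\<close>

lemma finite_tree_indices:
  assumes "0 < C" "0 < n"
  shows "finite (tree_indices p n x C)"
proof -
  have "tree_indices p n x C \<subseteq> (SIGMA S:Pow {1..p}. SIGMA K:{1..n}. valid_trees p n x C S K)"
    using valid_trees_partition(4)[OF _ assms] by (auto simp: tree_indices_def)
  moreover have "finite (SIGMA S:Pow {1..p}. SIGMA K:{1..n}. valid_trees p n x C S K)"
    by (intro finite_SigmaI finite_valid_trees) (auto intro: finite_subset)
  ultimately show ?thesis using finite_subset by blast
qed

section \<open>The prior\<close>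

abbreviation height_law :: "partition \<Rightarrow> (cell \<Rightarrow> real) measure" where
  "height_law T \<equiv> (\<Pi>\<^sub>M \<Omega>\<in>T. std_normal)"

lemma prob_space_std_normal: "prob_space std_normal"
  using prob_space_normal_density[of 1 0] by simp

lemma prob_space_height_law: "prob_space (height_law T)"
  by (intro prob_space_PiM prob_space_std_normal)

lemma measurable_height:
  "\<Omega> \<in> T \<Longrightarrow> (\<lambda>\<beta>. \<beta> \<Omega>) \<in> borel_measurable (height_law T)"
  by (rule measurable_compose[OF measurable_component_singleton[of \<Omega> T "\<lambda>_. std_normal"]]) auto

lemma step_fun_in_tree_funs:
  assumes "(S, K, T) \<in> tree_indices p n x C"
  shows "step_fun p T \<beta> \<in> tree_funs p n x C"
proof -
  have "S \<subseteq> {1..p}" "K \<in> {1..}" "step_fun p T \<beta> \<in> step_funs p (valid_trees p n x C S K)"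
    using assms by (auto simp: tree_indices_def step_funs_def)
  then show ?thesis unfolding tree_funs_def by blast
qed

lemma measurable_step_fun:
  assumes "(S, K, T) \<in> tree_indices p n x C"
  shows "step_fun p T \<in> measurable (height_law T) (tree_fun_space p n x C)"
proof -
  have "(\<lambda>\<beta>. \<lambda>z\<in>cube p. \<Sum>\<Omega>\<in>T. \<beta> \<Omega> * indicator \<Omega> z) \<in> measurable (height_law T) (\<Pi>\<^sub>M z\<in>cube p. borel)"
    by (intro measurable_restrict borel_measurable_sum borel_measurable_times measurable_height) auto
  then show ?thesis
    unfolding tree_fun_space_def using step_fun_in_tree_funs[OF assms]
    by (intro measurable_restrict_space2) (auto simp: step_fun_def[abs_def])
qed

lemma space_tree_fun_space: "space (tree_fun_space p n x C) = tree_funs p n x C"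
proof -
  have "tree_funs p n x C \<subseteq> space (\<Pi>\<^sub>M z\<in>cube p. borel :: real measure)"
    by (auto simp: tree_funs_def step_funs_def step_fun_def space_PiM)
  then show ?thesis by (auto simp: tree_fun_space_def space_restrict_space)
qed

lemma measurable_eval:
  "z \<in> cube p \<Longrightarrow> (\<lambda>f. f z) \<in> borel_measurable (tree_fun_space p n x C)"
  unfolding tree_fun_space_def
  by (rule measurable_restrict_space1) (rule measurable_component_singleton)

definition prior_weight ::
  "nat \<Rightarrow> real \<Rightarrow> real \<Rightarrow> real \<Rightarrow> (nat set \<Rightarrow> nat \<Rightarrow> partition \<Rightarrow> real) \<Rightarrow>
    nat set \<times> nat \<times> partition \<Rightarrow> real"
where
  "prior_weight p a c l \<pi> =
     (\<lambda>(S, K, T). prior_q p a c (card S) * prior_S p S * prior_K l K * \<pi> S K T)"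

lemma kernel_measurable:
  "(\<lambda>(S, K, T). distr (height_law T) (tree_fun_space p n x C) (step_fun p T)) \<in>
     measurable (count_space (tree_indices p n x C)) (subprob_algebra (tree_fun_space p n x C))"
proof -
  have "distr (height_law T) (tree_fun_space p n x C) (step_fun p T) \<in> space (subprob_algebra (tree_fun_space p n x C))"
    if "(S, K, T) \<in> tree_indices p n x C" for S K T
  proof -
    interpret prob_space "height_law T" by (rule prob_space_height_law)
    interpret D: prob_space "distr (height_law T) (tree_fun_space p n x C) (step_fun p T)"
      by (rule prob_space_distr[OF measurable_step_fun[OF that]])
    show ?thesis by (simp add: space_subprob_algebra D.subprob_space_axioms)
  qed
  then show ?thesis by auto
qed

lemma prior_eq:
  "prior p n x C a c l \<pi> =
     density (count_space (tree_indices p n x C)) (\<lambda>i. ennreal (prior_weight p a c l \<pi> i)) \<bind>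
     (\<lambda>(S, K, T). distr (height_law T) (tree_fun_space p n x C) (step_fun p T))"
  unfolding prior_def prior_weight_def by (simp add: case_prod_beta')

lemma sets_prior:
  assumes "tree_indices p n x C \<noteq> {}"
  shows "sets (prior p n x C a c l \<pi>) = sets (tree_fun_space p n x C)"
  unfolding prior_eq using assms
  by (intro sets_bind) auto

text \<open>The index set being finite, the prior is a finite mixture of laws of step functions with
  Gaussian heights. The evidence and the numerator of the posterior are evaluated through this
  sum.\<close>

lemma nn_integral_prior:
  assumes fin: "finite (tree_indices p n x C)"
    and h: "h \<in> borel_measurable (tree_fun_space p n x C)"
  shows "(\<integral>\<^sup>+ f. h f \<partial>prior p n x C a c l \<pi>) =
    (\<Sum>(S, K, T)\<in>tree_indices p n x C. ennreal (prior_weight p a c l \<pi> (S, K, T)) *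
       (\<integral>\<^sup>+ \<beta>. h (step_fun p T \<beta>) \<partial>height_law T))"
proof -
  let ?I = "tree_indices p n x C" and ?F = "tree_fun_space p n x C"
  let ?N = "\<lambda>(S :: nat set, K :: nat, T). distr (height_law T) ?F (step_fun p T)"
  have "(\<integral>\<^sup>+ f. h f \<partial>prior p n x C a c l \<pi>) =
    (\<integral>\<^sup>+ i. \<integral>\<^sup>+ f. h f \<partial>?N i \<partial>density (count_space ?I) (\<lambda>i. ennreal (prior_weight p a c l \<pi> i)))"
    unfolding prior_eq
    by (rule nn_integral_bind[OF h]) (use kernel_measurable[of p n x C] in simp)
  also have "\<dots> = (\<integral>\<^sup>+ i. ennreal (prior_weight p a c l \<pi> i) * (\<integral>\<^sup>+ f. h f \<partial>?N i) \<partial>count_space ?I)"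
    by (subst nn_integral_density) auto
  also have "\<dots> = (\<Sum>i\<in>?I. ennreal (prior_weight p a c l \<pi> i) * (\<integral>\<^sup>+ f. h f \<partial>?N i))"
    by (rule nn_integral_count_space_finite[OF fin])
  also have "\<dots> = (\<Sum>(S, K, T)\<in>?I. ennreal (prior_weight p a c l \<pi> (S, K, T)) *
       (\<integral>\<^sup>+ \<beta>. h (step_fun p T \<beta>) \<partial>height_law T))"
    using h by (intro sum.cong) (auto simp: nn_integral_distr[OF measurable_step_fun])
  finally show ?thesis .
qed

section \<open>Gaussian noise\<close>

text \<open>Completing the square: the tilt by \<open>exp (t * (y - \<mu>))\<close> moves the mean
  to \<open>\<mu> + t\<close> and leaves the factor \<open>exp (t\<^sup>2 / 2)\<close>.\<close>

lemma normal_moment_generating: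
  "(\<integral>\<^sup>+ y. ennreal (exp (t * (y - \<mu>))) \<partial>density lborel (normal_density \<mu> 1)) = ennreal (exp (t\<^sup>2 / 2))"
proof -
  have "(\<integral>\<^sup>+ y. ennreal (exp (t * (y - \<mu>))) \<partial>density lborel (normal_density \<mu> 1))
      = (\<integral>\<^sup>+ y. ennreal (normal_density \<mu> 1 y) * ennreal (exp (t * (y - \<mu>))) \<partial>lborel)"
    by (subst nn_integral_density) auto
  also have "\<dots> = (\<integral>\<^sup>+ y. ennreal (exp (t\<^sup>2 / 2)) * ennreal (normal_density (\<mu> + t) 1 y) \<partial>lborel)"
  proof (intro nn_integral_cong)
    fix y :: real
    have "normal_density \<mu> 1 y * exp (t * (y - \<mu>)) = exp (t\<^sup>2 / 2) * normal_density (\<mu> + t) 1 y"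
      unfolding normal_density_def
      by (simp add: mult_exp_exp[symmetric] exp_add[symmetric] power2_eq_square field_simps)
    then show "ennreal (normal_density \<mu> 1 y) * ennreal (exp (t * (y - \<mu>)))
        = ennreal (exp (t\<^sup>2 / 2)) * ennreal (normal_density (\<mu> + t) 1 y)"
      by (simp flip: ennreal_mult')
  qed
  also have "\<dots> = ennreal (exp (t\<^sup>2 / 2)) * emeasure (density lborel (normal_density (\<mu> + t) 1)) UNIV"
    by (subst nn_integral_cmult) (auto simp: emeasure_density)
  also have "\<dots> = ennreal (exp (t\<^sup>2 / 2))"
    using prob_space.emeasure_space_1[OF prob_space_normal_density[of 1 "\<mu> + t"]] by simp
  finally show ?thesis .
qed

text \<open>The factor \<open>exp (u\<^sup>2 / 4)\<close> halves the precision: up to the constant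
  \<open>sqrt 2\<close> the density becomes that of a normal law with variance 2.\<close>

lemma normal_square_generating:
  "(\<integral>\<^sup>+ u. ennreal (exp (u\<^sup>2 / 4)) \<partial>std_normal) = ennreal (sqrt 2)"
proof -
  have "(\<integral>\<^sup>+ u. ennreal (exp (u\<^sup>2 / 4)) \<partial>std_normal)
      = (\<integral>\<^sup>+ u. ennreal (std_normal_density u) * ennreal (exp (u\<^sup>2 / 4)) \<partial>lborel)"
    by (subst nn_integral_density) auto
  also have "\<dots> = (\<integral>\<^sup>+ u. ennreal (sqrt 2) * ennreal (normal_density 0 (sqrt 2) u) \<partial>lborel)"
  proof (intro nn_integral_cong)
    fix u :: real
    have "std_normal_density u * exp (u\<^sup>2 / 4) = sqrt 2 * normal_density 0 (sqrt 2) u"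
      unfolding normal_density_def
      by (simp add: exp_add[symmetric] real_sqrt_mult field_simps)
    then show "ennreal (std_normal_density u) * ennreal (exp (u\<^sup>2 / 4))
        = ennreal (sqrt 2) * ennreal (normal_density 0 (sqrt 2) u)"
      by (simp flip: ennreal_mult')
  qed
  also have "\<dots> = ennreal (sqrt 2) * emeasure (density lborel (normal_density 0 (sqrt 2))) UNIV"
    by (subst nn_integral_cmult) (auto simp: emeasure_density)
  also have "\<dots> = ennreal (sqrt 2)"
    using prob_space.emeasure_space_1[OF prob_space_normal_density[of "sqrt 2" 0]] by simp
  finally show ?thesis .
qed

lemma prob_space_data_law: "prob_space (data_law n x f)"
  unfolding data_law_def by (intro prob_space_PiM prob_space_normal_density) simp

lemma measurable_datum [measurable]:
  "i \<in> {1..n} \<Longrightarrow> (\<lambda>y. y i) \<in> borel_measurable (data_law n x f)"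
  unfolding data_law_def
  by (rule measurable_compose[OF measurable_component_singleton[of i]]) auto

lemma gaussian_linear_generating:
  "(\<integral>\<^sup>+ y. ennreal (exp (\<Sum>i\<in>{1..n}. t i * (y i - f (x i)))) \<partial>data_law n x f)
     = ennreal (exp ((\<Sum>i\<in>{1..n}. (t i)\<^sup>2) / 2))"
proof -
  interpret product_sigma_finite "\<lambda>i. density lborel (normal_density (f (x i)) 1)"
    by (intro product_sigma_finite.intro prob_space_imp_sigma_finite prob_space_normal_density) simp
  have "(\<integral>\<^sup>+ y. ennreal (exp (\<Sum>i\<in>{1..n}. t i * (y i - f (x i)))) \<partial>data_law n x f)
    = (\<integral>\<^sup>+ y. (\<Prod>i\<in>{1..n}. ennreal (exp (t i * (y i - f (x i))))) \<partial>data_law n x f)"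
    by (simp add: exp_sum prod_ennreal)
  also have "\<dots> = (\<Prod>i\<in>{1..n}. \<integral>\<^sup>+ y. ennreal (exp (t i * (y - f (x i)))) \<partial>density lborel (normal_density (f (x i)) 1))"
    unfolding data_law_def by (rule product_nn_integral_prod) auto
  also have "\<dots> = ennreal (exp ((\<Sum>i\<in>{1..n}. (t i)\<^sup>2) / 2))"
    by (simp add: normal_moment_generating prod_ennreal exp_sum[symmetric] sum_divide_distrib)
  finally show ?thesis .
qed

text \<open>
  The exponential of a square is a Gaussian mixture of exponentials of linear forms:
  \<open>exp (z\<^sup>2 / 4)\<close> is the mean of \<open>exp (z * u / sqrt 2)\<close> over a standard normal \<open>u\<close>.
\<close>

lemma chi_square_generating:
  fixes v :: "'a \<Rightarrow> nat \<Rightarrow> real"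
  assumes A: "finite A"
    and orth: "\<And>a b. a \<in> A \<Longrightarrow> b \<in> A \<Longrightarrow> a \<noteq> b \<Longrightarrow> (\<Sum>i\<in>{1..n}. v a i * v b i) = 0"
    and len: "\<And>a. a \<in> A \<Longrightarrow> (\<Sum>i\<in>{1..n}. (v a i)\<^sup>2) \<le> 1"
  shows "(\<integral>\<^sup>+ y. ennreal (exp ((\<Sum>a\<in>A. (\<Sum>i\<in>{1..n}. v a i * (y i - f (x i)))\<^sup>2) / 4)) \<partial>data_law n x f)
    \<le> ennreal (sqrt 2 ^ card A)"
proof -
  let ?U = "\<Pi>\<^sub>M a\<in>A. std_normal" and ?P = "data_law n x f"
  define Z where "Z a y = (\<Sum>i\<in>{1..n}. v a i * (y i - f (x i)))" for a and y :: "nat \<Rightarrow> real"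
  interpret U1: prob_space std_normal by (rule prob_space_std_normal)
  interpret U: product_sigma_finite "\<lambda>_ :: 'a. std_normal"
    by (intro product_sigma_finite.intro) (rule U1.sigma_finite_measure_axioms)
  interpret UP: prob_space ?U by (intro prob_space_PiM U1.prob_space_axioms)
  interpret P: prob_space ?P by (rule prob_space_data_law)
  interpret PU: pair_sigma_finite ?P ?U ..
  have mU [measurable]: "(\<lambda>u. u a) \<in> borel_measurable ?U" if "a \<in> A" for a
    using that by (intro measurable_compose[OF measurable_component_singleton[of a]]) auto
  have mZ [measurable]: "Z a \<in> borel_measurable ?P" for a
    unfolding Z_def[abs_def] by measurable
  have mix: "ennreal (exp (z\<^sup>2 / 4)) = (\<integral>\<^sup>+ u. ennreal (exp (z / sqrt 2 * u)) \<partial>std_normal)" for z :: real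
  proof -
    have "(\<integral>\<^sup>+ u. ennreal (exp (z / sqrt 2 * u)) \<partial>std_normal) = ennreal (exp ((z / sqrt 2)\<^sup>2 / 2))"
      using normal_moment_generating[where t = "z / sqrt 2" and \<mu> = 0] by (simp only: diff_0_right)
    moreover have "(z / sqrt 2)\<^sup>2 / 2 = z\<^sup>2 / 4" by (simp add: power_divide)
    ultimately show ?thesis by simp
  qed
  have "(\<integral>\<^sup>+ y. ennreal (exp ((\<Sum>a\<in>A. (Z a y)\<^sup>2) / 4)) \<partial>?P)
      = (\<integral>\<^sup>+ y. (\<Prod>a\<in>A. \<integral>\<^sup>+ u. ennreal (exp (Z a y / sqrt 2 * u)) \<partial>std_normal) \<partial>?P)"
    by (simp only: mix[symmetric]) (simp add: prod_ennreal exp_sum[symmetric] sum_divide_distrib A)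
  also have "\<dots> = (\<integral>\<^sup>+ y. \<integral>\<^sup>+ u. (\<Prod>a\<in>A. ennreal (exp (Z a y / sqrt 2 * u a))) \<partial>?U \<partial>?P)"
    by (intro nn_integral_cong U.product_nn_integral_prod[symmetric] A) auto
  \<comment> \<open>Exchanging the integrals leaves, for fixed \<open>u\<close>, the generating
    function of a linear form in the noise, to which orthogonality applies.\<close>
  also have "\<dots> = (\<integral>\<^sup>+ u. \<integral>\<^sup>+ y. (\<Prod>a\<in>A. ennreal (exp (Z a y / sqrt 2 * u a))) \<partial>?P \<partial>?U)"
  proof (rule PU.Fubini'[symmetric])
    show "(\<lambda>(y, u). \<Prod>a\<in>A. ennreal (exp (Z a y / sqrt 2 * u a))) \<in> borel_measurable (?P \<Otimes>\<^sub>M ?U)"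
      using A by measurable
  qed
  also have "\<dots> \<le> (\<integral>\<^sup>+ u. (\<Prod>a\<in>A. ennreal (exp ((u a)\<^sup>2 / 4))) \<partial>?U)"
  proof (rule nn_integral_mono)
    fix u :: "'a \<Rightarrow> real"
    \<comment> \<open>The coefficient vector of that linear form. Pythagoras bounds its squared
      length by the sum of \<open>(u a)\<^sup>2 / 2\<close>.\<close>
    define t where "t i = (\<Sum>a\<in>A. u a / sqrt 2 * v a i)" for i
    have "(\<Sum>a\<in>A. Z a y / sqrt 2 * u a) = (\<Sum>i\<in>{1..n}. t i * (y i - f (x i)))" for y
      unfolding Z_def t_def sum_distrib_right sum_divide_distrib
      by (subst sum.swap) (simp add: sum_distrib_right sum_distrib_left field_simps)
    then have "(\<integral>\<^sup>+ y. (\<Prod>a\<in>A. ennreal (exp (Z a y / sqrt 2 * u a))) \<partial>?P)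
      = (\<integral>\<^sup>+ y. ennreal (exp (\<Sum>i\<in>{1..n}. t i * (y i - f (x i)))) \<partial>?P)"
      by (simp add: prod_ennreal exp_sum[symmetric] A)
    also have "\<dots> = ennreal (exp ((\<Sum>i\<in>{1..n}. (t i)\<^sup>2) / 2))"
      by (rule gaussian_linear_generating)
    also have "(\<Sum>i\<in>{1..n}. (t i)\<^sup>2)
      = (\<Sum>a\<in>A. \<Sum>b\<in>A. u a / sqrt 2 * (u b / sqrt 2) * (\<Sum>i\<in>{1..n}. v a i * v b i))"
    proof -
      have "(t i)\<^sup>2 = (\<Sum>a\<in>A. \<Sum>b\<in>A. u a / sqrt 2 * (u b / sqrt 2) * (v a i * v b i))" for i
        unfolding t_def power2_eq_square sum_product by (simp add: ac_simps)
      then show ?thesis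
        by (simp only: sum_distrib_left) (subst sum.swap, rule sum.cong[OF refl], rule sum.swap)
    qed
    also have "\<dots> = (\<Sum>a\<in>A. (u a)\<^sup>2 / 2 * (\<Sum>i\<in>{1..n}. (v a i)\<^sup>2))"
    proof (rule sum.cong[OF refl])
      fix a assume a: "a \<in> A"
      have "(\<Sum>b\<in>A. u a / sqrt 2 * (u b / sqrt 2) * (\<Sum>i\<in>{1..n}. v a i * v b i))
        = (\<Sum>b\<in>A. if b = a then (u a)\<^sup>2 / 2 * (\<Sum>i\<in>{1..n}. (v a i)\<^sup>2) else 0)"
        using orth[OF a] by (intro sum.cong) (auto simp: power2_eq_square)
      then show "(\<Sum>b\<in>A. u a / sqrt 2 * (u b / sqrt 2) * (\<Sum>i\<in>{1..n}. v a i * v b i))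
        = (u a)\<^sup>2 / 2 * (\<Sum>i\<in>{1..n}. (v a i)\<^sup>2)"
        using A a by simp
    qed
    finally have *: "(\<integral>\<^sup>+ y. (\<Prod>a\<in>A. ennreal (exp (Z a y / sqrt 2 * u a))) \<partial>?P)
      = ennreal (exp ((\<Sum>a\<in>A. (u a)\<^sup>2 / 2 * (\<Sum>i\<in>{1..n}. (v a i)\<^sup>2)) / 2))" .
    have "(\<Sum>a\<in>A. (u a)\<^sup>2 / 2 * (\<Sum>i\<in>{1..n}. (v a i)\<^sup>2)) \<le> (\<Sum>a\<in>A. (u a)\<^sup>2 / 2)"
      using len by (intro sum_mono mult_left_le) auto
    then have "(\<Sum>a\<in>A. (u a)\<^sup>2 / 2 * (\<Sum>i\<in>{1..n}. (v a i)\<^sup>2)) / 2 \<le> (\<Sum>a\<in>A. (u a)\<^sup>2 / 4)"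
      by (simp add: sum_divide_distrib[symmetric])
    then have "ennreal (exp ((\<Sum>a\<in>A. (u a)\<^sup>2 / 2 * (\<Sum>i\<in>{1..n}. (v a i)\<^sup>2)) / 2))
        \<le> ennreal (exp (\<Sum>a\<in>A. (u a)\<^sup>2 / 4))"
      by (intro ennreal_leI) simp
    also have "\<dots> = (\<Prod>a\<in>A. ennreal (exp ((u a)\<^sup>2 / 4)))"
      by (simp add: prod_ennreal exp_sum A)
    finally show "(\<integral>\<^sup>+ y. (\<Prod>a\<in>A. ennreal (exp (Z a y / sqrt 2 * u a))) \<partial>?P) \<le> (\<Prod>a\<in>A. ennreal (exp ((u a)\<^sup>2 / 4)))"
      unfolding * .
  qed
  also have "\<dots> = (\<Prod>a\<in>A. \<integral>\<^sup>+ u. ennreal (exp (u\<^sup>2 / 4)) \<partial>std_normal)"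
    by (intro U.product_nn_integral_prod A) auto
  also have "\<dots> = ennreal (sqrt 2 ^ card A)"
    by (simp add: normal_square_generating ennreal_power)
  finally show ?thesis unfolding Z_def .
qed

section \<open>Likelihood ratios of step functions\<close>

text \<open>The \<open>G\<close> of the overview. It is left unnormalised, as the squared Euclidean
  length of the deviation on the design, to be compared with the noise energy.\<close>

definition squared_gap :: "nat \<Rightarrow> (nat \<Rightarrow> point) \<Rightarrow> (point \<Rightarrow> real) \<Rightarrow> (point \<Rightarrow> real) \<Rightarrow> real" where
  "squared_gap n x f0 f = (\<Sum>i\<in>{1..n}. (f (x i) - f0 (x i))\<^sup>2)"

definition likelihood_ratio ::
  "nat \<Rightarrow> (nat \<Rightarrow> point) \<Rightarrow> (point \<Rightarrow> real) \<Rightarrow> (nat \<Rightarrow> real) \<Rightarrow> (point \<Rightarrow> real) \<Rightarrow> real"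
where
  "likelihood_ratio n x f0 y f =
     exp ((\<Sum>i\<in>{1..n}. (f (x i) - f0 (x i)) * (y i - f0 (x i))) - squared_gap n x f0 f / 2)"

text \<open>The factor \<open>likelihood n x y f0\<close> does not depend on \<open>f\<close> and
  cancels in the posterior, so only the ratio to the truth has to be estimated.\<close>

lemma likelihood_eq_ratio: "likelihood n x y f = likelihood n x y f0 * likelihood_ratio n x f0 y f"
proof -
  have "normal_density (f (x i)) 1 (y i) = normal_density (f0 (x i)) 1 (y i) *
      exp ((f (x i) - f0 (x i)) * (y i - f0 (x i)) - (f (x i) - f0 (x i))\<^sup>2 / 2)" for i
    unfolding normal_density_def
    by (simp add: exp_add[symmetric] power2_eq_square field_simps)
  then show ?thesis
    unfolding likelihood_def likelihood_ratio_def squared_gap_def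
    by (simp add: prod.distrib exp_sum[symmetric] sum_subtractf sum_divide_distrib)
qed

lemma likelihood_pos: "0 < likelihood n x y f"
  unfolding likelihood_def by (intro prod_pos) (simp add: normal_density_pos)

text \<open>The linear form in the noise contributes \<open>exp (G / 2)\<close> on average, with
  \<open>G\<close> the squared gap, and the deterministic factor cancels this exactly.\<close>

lemma expectation_likelihood_ratio:
  "(\<integral>\<^sup>+ y. ennreal (likelihood_ratio n x f0 y f) \<partial>data_law n x f0) = 1"
proof -
  have "(\<integral>\<^sup>+ y. ennreal (likelihood_ratio n x f0 y f) \<partial>data_law n x f0)
    = (\<integral>\<^sup>+ y. ennreal (exp (\<Sum>i\<in>{1..n}. (f (x i) - f0 (x i)) * (y i - f0 (x i)))) *
        ennreal (exp (- squared_gap n x f0 f / 2)) \<partial>data_law n x f0)"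
  proof (intro nn_integral_cong)
    fix y
    have "exp (a - b / 2) = exp a * exp (- b / 2)" for a b :: real
      using exp_add[of a "- b / 2"] by simp
    then show "ennreal (likelihood_ratio n x f0 y f) = ennreal (exp (\<Sum>i\<in>{1..n}. (f (x i) - f0 (x i)) * (y i - f0 (x i)))) *
        ennreal (exp (- squared_gap n x f0 f / 2))"
      by (simp only: likelihood_ratio_def ennreal_mult' exp_ge_zero)
  qed
  also have "\<dots> = (\<integral>\<^sup>+ y. ennreal (exp (\<Sum>i\<in>{1..n}. (f (x i) - f0 (x i)) * (y i - f0 (x i)))) \<partial>data_law n x f0) *
        ennreal (exp (- squared_gap n x f0 f / 2))"
  proof (rule nn_integral_multc)
    have "(\<lambda>y. (f (x i) - f0 (x i)) * (y i - f0 (x i))) \<in> borel_measurable (data_law n x f0)" if "i \<in> {1..n}" for i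
      by (intro borel_measurable_times borel_measurable_diff measurable_datum that) auto
    then have "(\<lambda>y. \<Sum>i\<in>{1..n}. (f (x i) - f0 (x i)) * (y i - f0 (x i))) \<in> borel_measurable (data_law n x f0)"
      by (rule borel_measurable_sum)
    then show "(\<lambda>y. ennreal (exp (\<Sum>i\<in>{1..n}. (f (x i) - f0 (x i)) * (y i - f0 (x i))))) \<in> borel_measurable (data_law n x f0)"
      by measurable
  qed
  also have "\<dots> = 1"
    unfolding gaussian_linear_generating[where t = "\<lambda>i. f (x i) - f0 (x i)" and f = f0 and x = x] squared_gap_def
    by (simp only: ennreal_mult'[symmetric] exp_ge_zero mult_exp_exp) simp
  finally show ?thesis .
qed

lemma sum_over_cells:
  fixes h :: "cell \<Rightarrow> real"
  assumes "partition_on (cube p) T" "finite T" "\<Omega> \<in> T" "z \<in> \<Omega>"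
  shows "(\<Sum>\<Omega>\<in>T. h \<Omega> * indicator \<Omega> z) = h \<Omega>"
proof -
  have "(\<Sum>\<Omega>'\<in>T. h \<Omega>' * indicator \<Omega>' z) = (\<Sum>\<Omega>'\<in>T. if \<Omega>' = \<Omega> then h \<Omega> else 0)"
    using assms by (intro sum.cong) (auto simp: partition_on_def disjoint_def indicator_def)
  then show ?thesis using assms by simp
qed

lemma step_fun_on_cell:
  assumes "partition_on (cube p) T" "finite T" "\<Omega> \<in> T" "z \<in> \<Omega>"
  shows "step_fun p T \<beta> z = \<beta> \<Omega>"
proof -
  have "z \<in> cube p" using assms by (auto simp: partition_on_def)
  then show ?thesis using sum_over_cells[OF assms, of \<beta>] by (simp add: step_fun_def)
qed

definition cell_mean :: "nat \<Rightarrow> (nat \<Rightarrow> point) \<Rightarrow> (point \<Rightarrow> real) \<Rightarrow> cell \<Rightarrow> real" where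
  "cell_mean n x f0 \<Omega> = (\<Sum>i\<in>{i\<in>{1..n}. x i \<in> \<Omega>}. f0 (x i)) / real (npoints n x \<Omega>)"

text \<open>Cell means are the least-squares heights, so this is the component of \<open>f0\<close>
  on the design that is orthogonal to all step functions on \<open>T\<close>.\<close>

definition residual :: "nat \<Rightarrow> (nat \<Rightarrow> point) \<Rightarrow> (point \<Rightarrow> real) \<Rightarrow> partition \<Rightarrow> nat \<Rightarrow> real" where
  "residual n x f0 T i = f0 (x i) - (\<Sum>\<Omega>\<in>T. cell_mean n x f0 \<Omega> * indicator \<Omega> (x i))"

text \<open>
  An orthogonal system spanning the step functions on \<open>T\<close> together with \<open>f0\<close>, as vectors of values at the
  design points. If \<open>f0\<close> is itself a step function on \<open>T\<close>, then \<open>None\<close> is the zero vector (\<open>0 / 0 = 0\<close>).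
\<close>

primrec direction ::
  "nat \<Rightarrow> (nat \<Rightarrow> point) \<Rightarrow> (point \<Rightarrow> real) \<Rightarrow> partition \<Rightarrow> cell option \<Rightarrow> nat \<Rightarrow> real"
where
  "direction n x f0 T (Some \<Omega>) = (\<lambda>i. indicator \<Omega> (x i) / sqrt (npoints n x \<Omega>))"
| "direction n x f0 T None = (\<lambda>i. residual n x f0 T i / sqrt (\<Sum>i\<in>{1..n}. (residual n x f0 T i)\<^sup>2))"

text \<open>The \<open>Q\<close> of the overview, in coordinates. For a valid tree the directions
  are orthonormal, except that the residual direction may be zero and then adds nothing.\<close>

definition noise_energy :: "nat \<Rightarrow> (nat \<Rightarrow> point) \<Rightarrow> (point \<Rightarrow> real) \<Rightarrow> partition \<Rightarrow> (nat \<Rightarrow> real) \<Rightarrow> real" where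
  "noise_energy n x f0 T y =
     (\<Sum>d\<in>insert None (Some ` T). (\<Sum>i\<in>{1..n}. direction n x f0 T d i * (y i - f0 (x i)))\<^sup>2)"

lemma measurable_noise_energy [measurable]:
  "noise_energy n x f0 T \<in> borel_measurable (data_law n x f)"
  unfolding noise_energy_def[abs_def]
  by (intro borel_measurable_sum borel_measurable_power borel_measurable_times borel_measurable_diff measurable_datum) auto

context
  fixes p n :: nat and x :: "nat \<Rightarrow> point" and C K :: nat and S T and f0 :: "point \<Rightarrow> real"
  assumes C: "0 < C" and n: "0 < n"
    and T: "T \<in> valid_trees p n x C S K"
    and design: "\<And>i. i \<in> {1..n} \<Longrightarrow> x i \<in> cube p"
begin

lemma cells_partition: "partition_on (cube p) T" and cells_finite: "finite T"
  using valid_trees_partition[OF T C n] by auto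

lemma design_cell:
  assumes "i \<in> {1..n}"
  obtains \<Omega> where "\<Omega> \<in> T" "x i \<in> \<Omega>"
  using design[OF assms] cells_partition by (auto simp: partition_on_def)

lemma sum_residual_cell:
  assumes "\<Omega> \<in> T"
  shows "(\<Sum>i\<in>{1..n}. indicator \<Omega> (x i) * residual n x f0 T i) = 0"
proof -
  have "(\<Sum>i\<in>{1..n}. indicator \<Omega> (x i) * residual n x f0 T i)
    = (\<Sum>i\<in>{i\<in>{1..n}. x i \<in> \<Omega>}. f0 (x i) - cell_mean n x f0 \<Omega>)"
    using sum_over_cells[OF cells_partition cells_finite assms, of _ "cell_mean n x f0"]
    by (intro sum.mono_neutral_cong_right) (auto simp: residual_def indicator_def)
  also have "\<dots> = 0"
    using valid_trees_nonempty_cells(1)[OF T C n assms]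
    by (simp only: sum_subtractf cell_mean_def sum_constant npoints_def[symmetric]) simp
  finally show ?thesis .
qed

text \<open>Distinct cells have disjoint supports; a cell and the residual are orthogonal because
  deviations from a cell mean cancel within the cell.\<close>

lemma direction_orthogonal:
  assumes "d \<in> insert None (Some ` T)" "d' \<in> insert None (Some ` T)" "d \<noteq> d'"
  shows "(\<Sum>i\<in>{1..n}. direction n x f0 T d i * direction n x f0 T d' i) = 0"
proof -
  have mixed: "(\<Sum>i\<in>{1..n}. direction n x f0 T None i * direction n x f0 T (Some \<Omega>) i) = 0" if "\<Omega> \<in> T" for \<Omega>
  proof -
    have "(\<Sum>i\<in>{1..n}. direction n x f0 T None i * direction n x f0 T (Some \<Omega>) i)
      = (\<Sum>i\<in>{1..n}. indicator \<Omega> (x i) * residual n x f0 T i) /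
          (sqrt (\<Sum>i\<in>{1..n}. (residual n x f0 T i)\<^sup>2) * sqrt (npoints n x \<Omega>))"
      unfolding direction.simps sum_divide_distrib
      by (intro sum.cong refl) (simp only: times_divide_times_eq mult.commute)
    then show ?thesis by (simp only: sum_residual_cell[OF that])
  qed
  have cells: "(\<Sum>i\<in>{1..n}. direction n x f0 T (Some \<Omega>) i * direction n x f0 T (Some \<Omega>') i) = 0"
    if "\<Omega> \<in> T" "\<Omega>' \<in> T" "\<Omega> \<noteq> \<Omega>'" for \<Omega> \<Omega>'
    using that cells_partition by (intro sum.neutral) (auto simp: partition_on_def disjoint_def indicator_def)
  show ?thesis
  proof (cases d)
    case None
    then show ?thesis using assms mixed by (auto simp del: direction.simps)
  next
    case (Some \<Omega>)
    show ?thesis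
    proof (cases d')
      case None
      then show ?thesis using assms mixed[of \<Omega>] Some
        by (auto simp: mult.commute[of _ "direction n x f0 T None _"] simp del: direction.simps)
    next
      case (Some \<Omega>')
      then show ?thesis using assms cells \<open>d = Some \<Omega>\<close> by (auto simp del: direction.simps)
    qed
  qed
qed

lemma direction_length_cell:
  assumes "\<Omega> \<in> T"
  shows "(\<Sum>i\<in>{1..n}. (direction n x f0 T (Some \<Omega>) i)\<^sup>2) = 1"
proof -
  have "(\<Sum>i\<in>{1..n}. (direction n x f0 T (Some \<Omega>) i)\<^sup>2)
    = (\<Sum>i\<in>{i\<in>{1..n}. x i \<in> \<Omega>}. 1 / real (npoints n x \<Omega>))"
    by (intro sum.mono_neutral_cong_right) (auto simp: indicator_def power_divide)
  then show ?thesis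
    using valid_trees_nonempty_cells(1)[OF T C n assms] by (simp only: sum_constant npoints_def[symmetric]) simp
qed

lemma direction_length_residual:
  "(\<Sum>i\<in>{1..n}. (direction n x f0 T None i)\<^sup>2) = (if (\<Sum>i\<in>{1..n}. (residual n x f0 T i)\<^sup>2) = 0 then 0 else 1)"
proof -
  have "0 \<le> (\<Sum>i\<in>{1..n}. (residual n x f0 T i)\<^sup>2)" by (intro sum_nonneg) auto
  then show ?thesis by (auto simp: power_divide sum_divide_distrib[symmetric])
qed

text \<open>Markov's inequality for \<open>exp (Q / 4)\<close>, with \<open>Q\<close> the noise
  energy. The system has \<open>K + 1 \<le> 2 * K\<close> members, whence \<open>2 ^ K\<close> in
  place of a power of \<open>sqrt 2\<close>.\<close>

lemma noise_energy_tail: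
  "emeasure (data_law n x f0) {y \<in> space (data_law n x f0). t < noise_energy n x f0 T y}
    \<le> ennreal (2 ^ K * exp (- t / 4))"
proof -
  let ?P = "data_law n x f0" and ?A = "insert None (Some ` T)"
  have card: "card ?A = K + 1"
    using cells_finite valid_trees_partition(2)[OF T C n] by (subst card_insert_disjoint) (auto simp: card_image)
  have K1: "1 \<le> K" using valid_trees_partition[OF T C n] by simp
  have "(\<integral>\<^sup>+ y. ennreal (exp (noise_energy n x f0 T y / 4)) \<partial>?P) \<le> ennreal (sqrt 2 ^ card ?A)"
    unfolding noise_energy_def
  proof (rule chi_square_generating)
    show "(\<Sum>i\<in>{1..n}. (direction n x f0 T d i)\<^sup>2) \<le> 1" if "d \<in> ?A" for d
      using that direction_length_cell direction_length_residual by (auto simp del: direction.simps)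
  qed (use cells_finite direction_orthogonal in auto)
  also have "sqrt 2 ^ card ?A \<le> sqrt 2 ^ (2 * K)"
    using K1 unfolding card by (intro power_increasing) auto
  also have "sqrt 2 ^ (2 * K) = 2 ^ K" by (simp add: power_mult)
  finally have exp_le: "(\<integral>\<^sup>+ y. ennreal (exp (noise_energy n x f0 T y / 4)) \<partial>?P) \<le> ennreal (2 ^ K)"
    by (simp add: ennreal_leI)
  have m: "(\<lambda>y. ennreal (exp (noise_energy n x f0 T y / 4))) \<in> borel_measurable ?P"
    by measurable
  have ge_1: "1 \<le> ennreal (exp (- t / 4)) * ennreal (exp (q / 4))" if "t < q" for q
  proof -
    have "1 \<le> exp (- t / 4 + q / 4)" using that by simp
    then have "ennreal 1 \<le> ennreal (exp (- t / 4 + q / 4))" by (rule ennreal_leI)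
    then show ?thesis by (simp only: ennreal_mult'[symmetric] exp_ge_zero mult_exp_exp ennreal_1)
  qed
  have "emeasure ?P {y \<in> space ?P. t < noise_energy n x f0 T y}
    \<le> emeasure ?P {y \<in> space ?P. 1 \<le> ennreal (exp (- t / 4)) * ennreal (exp (noise_energy n x f0 T y / 4))}"
  proof (rule emeasure_mono)
    show "{y \<in> space ?P. t < noise_energy n x f0 T y}
      \<subseteq> {y \<in> space ?P. 1 \<le> ennreal (exp (- t / 4)) * ennreal (exp (noise_energy n x f0 T y / 4))}"
      using ge_1 by blast
    show "{y \<in> space ?P. 1 \<le> ennreal (exp (- t / 4)) * ennreal (exp (noise_energy n x f0 T y / 4))} \<in> sets ?P"
      using m by measurable
  qed
  also have "\<dots> \<le> ennreal (exp (- t / 4)) * (\<integral>\<^sup>+ y. ennreal (exp (noise_energy n x f0 T y / 4)) * indicator (space ?P) y \<partial>?P)"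
    by (intro nn_integral_Markov_inequality borel_measurable_times_ennreal m borel_measurable_indicator sets.top)
  also have "(\<integral>\<^sup>+ y. ennreal (exp (noise_energy n x f0 T y / 4)) * indicator (space ?P) y \<partial>?P)
      = (\<integral>\<^sup>+ y. ennreal (exp (noise_energy n x f0 T y / 4)) \<partial>?P)"
    by (intro nn_integral_cong) auto
  also have "ennreal (exp (- t / 4)) * \<dots> \<le> ennreal (exp (- t / 4)) * ennreal (2 ^ K)"
    by (intro mult_left_mono exp_le) auto
  also have "\<dots> = ennreal (2 ^ K * exp (- t / 4))"
    by (simp only: mult.commute[of "2 ^ K"] ennreal_mult'[symmetric] exp_ge_zero)
  finally show ?thesis .
qed

text \<open>Cauchy-Schwarz inside the span of the directions: the deviation lies there, so only the
  projection of the noise matters, and Parseval's identity turns the other factor into the squared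
  gap.\<close>

lemma noise_inner_product_bound:
  "\<bar>\<Sum>i\<in>{1..n}. (step_fun p T \<beta> (x i) - f0 (x i)) * (y i - f0 (x i))\<bar>
    \<le> sqrt (noise_energy n x f0 T y * squared_gap n x f0 (step_fun p T \<beta>))"
proof -
  let ?A = "insert None (Some ` T)" and ?v = "direction n x f0 T"
  let ?rho = "\<Sum>i\<in>{1..n}. (residual n x f0 T i)\<^sup>2"
  define e where "e i = y i - f0 (x i)" for i
  define g where "g i = step_fun p T \<beta> (x i) - f0 (x i)" for i
  \<comment> \<open>Cell coefficients compare the height with the cell mean; along the residual the
    step function has no component, so only \<open>- f0\<close> contributes.\<close>
  define c where "c d = (case d of Some \<Omega> \<Rightarrow> (\<beta> \<Omega> - cell_mean n x f0 \<Omega>) * sqrt (npoints n x \<Omega>) | None \<Rightarrow> - sqrt ?rho)" for d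
  have finA: "finite ?A" using cells_finite by simp
  have g_eq: "g i = (\<Sum>d\<in>?A. c d * ?v d i)" if i: "i \<in> {1..n}" for i
  proof -
    \<comment> \<open>A residual of length zero vanishes at every design point, so having the zero
      vector as its direction loses nothing.\<close>
    have "residual n x f0 T i = 0" if "?rho = 0"
      using that i by (subst (asm) sum_nonneg_eq_0_iff) auto
    then have None: "c None * ?v None i = - residual n x f0 T i"
      by (auto simp: c_def)
    have "(\<Sum>d\<in>Some ` T. c d * ?v d i) = (\<Sum>\<Omega>\<in>T. c (Some \<Omega>) * ?v (Some \<Omega>) i)"
      by (subst sum.reindex) auto
    also have "\<dots> = (\<Sum>\<Omega>\<in>T. (\<beta> \<Omega> - cell_mean n x f0 \<Omega>) * indicator \<Omega> (x i))"
      using valid_trees_nonempty_cells(1)[OF T C n] by (intro sum.cong) (fastforce simp: c_def)+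
    also have "\<dots> = step_fun p T \<beta> (x i) - (f0 (x i) - residual n x f0 T i)"
      using design[OF i] by (simp add: step_fun_def residual_def left_diff_distrib sum_subtractf)
    finally have "(\<Sum>d\<in>Some ` T. c d * ?v d i) = g i + residual n x f0 T i" by (simp add: g_def)
    moreover have "None \<notin> Some ` T" "finite (Some ` T)" using cells_finite by auto
    ultimately show ?thesis using None by (simp del: direction.simps)
  qed
  have "squared_gap n x f0 (step_fun p T \<beta>) = (\<Sum>i\<in>{1..n}. (g i)\<^sup>2)"
    by (simp add: squared_gap_def g_def)
  also have "\<dots> = (\<Sum>i\<in>{1..n}. \<Sum>d\<in>?A. \<Sum>d'\<in>?A. c d * c d' * (?v d i * ?v d' i))"
    by (intro sum.cong refl) (simp only: g_eq power2_eq_square sum_product ac_simps)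
  also have "\<dots> = (\<Sum>d\<in>?A. \<Sum>d'\<in>?A. c d * c d' * (\<Sum>i\<in>{1..n}. ?v d i * ?v d' i))"
    by (simp only: sum_distrib_left) (subst sum.swap, rule sum.cong[OF refl], rule sum.swap)
  also have "\<dots> = (\<Sum>d\<in>?A. (c d)\<^sup>2)"
  proof (rule sum.cong[OF refl])
    fix d assume d: "d \<in> ?A"
    have "(\<Sum>d'\<in>?A. c d * c d' * (\<Sum>i\<in>{1..n}. ?v d i * ?v d' i))
      = (\<Sum>d'\<in>?A. if d' = d then c d * c d * (\<Sum>i\<in>{1..n}. ?v d i * ?v d i) else 0)"
      using direction_orthogonal[OF d] by (intro sum.cong) (auto simp del: direction.simps)
    also have "\<dots> = (c d)\<^sup>2 * (\<Sum>i\<in>{1..n}. (?v d i)\<^sup>2)"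
      using finA d by (subst sum.delta) (auto simp: power2_eq_square simp del: direction.simps)
    \<comment> \<open>Where the residual direction has length zero instead of one, its coefficient
      is zero too.\<close>
    also have "\<dots> = (c d)\<^sup>2"
      using d direction_length_cell direction_length_residual by (auto simp: c_def simp del: direction.simps split: if_splits)
    finally show "(\<Sum>d'\<in>?A. c d * c d' * (\<Sum>i\<in>{1..n}. ?v d i * ?v d' i)) = (c d)\<^sup>2" .
  qed
  finally have gap: "squared_gap n x f0 (step_fun p T \<beta>) = (\<Sum>d\<in>?A. (c d)\<^sup>2)" .
  have "(\<Sum>i\<in>{1..n}. g i * e i) = (\<Sum>i\<in>{1..n}. \<Sum>d\<in>?A. c d * (?v d i * e i))"
    by (intro sum.cong refl) (simp only: g_eq sum_distrib_right mult.assoc)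
  also have "\<dots> = (\<Sum>d\<in>?A. c d * (\<Sum>i\<in>{1..n}. ?v d i * e i))"
    by (subst sum.swap) (simp only: sum_distrib_left)
  finally have "(\<Sum>i\<in>{1..n}. g i * e i)\<^sup>2 \<le> (\<Sum>d\<in>?A. (c d)\<^sup>2) * (\<Sum>d\<in>?A. (\<Sum>i\<in>{1..n}. ?v d i * e i)\<^sup>2)"
    using Cauchy_Schwarz_ineq_sum[of c "\<lambda>d. \<Sum>i\<in>{1..n}. ?v d i * e i" ?A] by simp
  then have "(\<Sum>i\<in>{1..n}. g i * e i)\<^sup>2 \<le> noise_energy n x f0 T y * squared_gap n x f0 (step_fun p T \<beta>)"
    unfolding gap noise_energy_def e_def by (simp only: mult.commute)
  then show ?thesis unfolding g_def e_def using real_le_rsqrt real_sqrt_le_mono by fastforce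
qed

end

section \<open>Approximation by k-d trees\<close>

text \<open>An empty cell gets width 0, since a supremum over the empty set carries no information;
  splits with an empty part then need no exclusion.\<close>

definition extent :: "nat \<Rightarrow> cell \<Rightarrow> real" where
  "extent j \<Omega> = (if \<Omega> = {} then 0 else (SUP z\<in>\<Omega>. z j) - (INF z\<in>\<Omega>. z j))"

lemma cube_coordinate_bounds:
  assumes "\<Omega> \<subseteq> cube p" "j \<in> {1..p}"
  shows "bdd_above ((\<lambda>z. z j) ` \<Omega>)" "bdd_below ((\<lambda>z. z j) ` \<Omega>)"
proof -
  have "0 \<le> z j \<and> z j \<le> 1" if "z \<in> \<Omega>" for z
    using assms that by (auto simp: cube_def PiE_def Pi_def)
  then show "bdd_above ((\<lambda>z. z j) ` \<Omega>)" "bdd_below ((\<lambda>z. z j) ` \<Omega>)"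
    by (auto intro!: bdd_aboveI[of _ 1] bdd_belowI[of _ 0])
qed

lemma extent_ge:
  assumes "\<Omega> \<subseteq> cube p" "j \<in> {1..p}" "y \<in> \<Omega>" "z \<in> \<Omega>"
  shows "\<bar>y j - z j\<bar> \<le> extent j \<Omega>"
proof -
  note b = cube_coordinate_bounds[OF assms(1,2)]
  have "y j \<le> (SUP z\<in>\<Omega>. z j)" "z j \<le> (SUP z\<in>\<Omega>. z j)" "(INF z\<in>\<Omega>. z j) \<le> y j" "(INF z\<in>\<Omega>. z j) \<le> z j"
    using assms b by (auto intro: cSUP_upper cINF_lower)
  then show ?thesis using assms by (auto simp: extent_def)
qed

lemma extent_nonneg:
  assumes "\<Omega> \<subseteq> cube p" "j \<in> {1..p}"
  shows "0 \<le> extent j \<Omega>"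
  using extent_ge[OF assms] by (cases "\<Omega> = {}") (fastforce simp: extent_def)+

lemma extent_mono:
  assumes "\<Omega>' \<subseteq> \<Omega>" "\<Omega> \<subseteq> cube p" "j \<in> {1..p}"
  shows "extent j \<Omega>' \<le> extent j \<Omega>"
proof (cases "\<Omega>' = {}")
  case True
  then show ?thesis using extent_nonneg assms by (simp add: extent_def)
next
  case False
  then show ?thesis
    using cube_coordinate_bounds[OF assms(2,3)] assms
    by (auto simp: extent_def intro!: diff_mono cSUP_subset_mono cINF_superset_mono)
qed

text \<open>The threshold separates the ranges of the two parts, so their widths fit side by side
  into that of the cell.\<close>

lemma extent_split:
  assumes "\<Omega> \<subseteq> cube p" "j \<in> {1..p}"
  shows "extent j (lower_part \<Omega> j \<tau>) + extent j (upper_part \<Omega> j \<tau>) \<le> extent j \<Omega>"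
proof -
  let ?L = "lower_part \<Omega> j \<tau>" and ?U = "upper_part \<Omega> j \<tau>"
  have sub: "?L \<subseteq> \<Omega>" "?U \<subseteq> \<Omega>" by (auto simp: lower_part_def upper_part_def)
  show ?thesis
  proof (cases "?L = {} \<or> ?U = {}")
    case True
    then show ?thesis
      using extent_mono[OF sub(1) assms] extent_mono[OF sub(2) assms]
      by (auto simp: extent_def[of j "{}"])
  next
    case False
    then have ne: "?L \<noteq> {}" "?U \<noteq> {}" "\<Omega> \<noteq> {}" using sub by auto
    have "(SUP z\<in>?L. z j) \<le> \<tau>"
      using ne by (intro cSUP_least) (auto simp: lower_part_def)
    moreover have "\<tau> \<le> (INF z\<in>?U. z j)"
      using ne by (intro cINF_greatest) (auto simp: upper_part_def)
    moreover have "(INF z\<in>\<Omega>. z j) \<le> (INF z\<in>?L. z j)"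
      using ne sub cube_coordinate_bounds[OF assms] by (intro cINF_superset_mono) auto
    moreover have "(SUP z\<in>?U. z j) \<le> (SUP z\<in>\<Omega>. z j)"
      using ne sub cube_coordinate_bounds[OF assms] by (intro cSUP_subset_mono) auto
    ultimately show ?thesis using ne by (simp add: extent_def)
  qed
qed

text \<open>A child has at most \<open>(m + 1) / 2\<close> of the \<open>m\<close> points. This map
  fixes 1, so rounding costs at most one point however deep the tree is.\<close>

lemma kd_along_cells:
  assumes "kd_along p n x js T"
  shows "finite T \<and> (\<forall>\<Omega>\<in>T. \<Omega> \<subseteq> cube p \<and> real (npoints n x \<Omega>) \<le> real n / 2 ^ length js + 1)"
  using assms
proof (induction rule: kd_along.induct)
  case root
  have "npoints n x (cube p) \<le> card {1..n}" unfolding npoints_def by (intro card_mono) auto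
  then show ?case by simp
next
  case (level js T j \<tau>)
  let ?T' = "\<Union>\<Omega>\<in>T. {lower_part \<Omega> j (\<tau> \<Omega>), upper_part \<Omega> j (\<tau> \<Omega>)}"
  have "\<Omega>' \<subseteq> cube p \<and> real (npoints n x \<Omega>') \<le> real n / 2 ^ length (js @ [j]) + 1" if "\<Omega>' \<in> ?T'" for \<Omega>'
  proof -
    from that obtain \<Omega> where \<Omega>: "\<Omega> \<in> T" "\<Omega>' \<in> {lower_part \<Omega> j (\<tau> \<Omega>), upper_part \<Omega> j (\<tau> \<Omega>)}" by blast
    then have "median_split n x \<Omega> j (\<tau> \<Omega>)" using level by blast
    then have "npoints n x \<Omega>' \<in> {npoints n x \<Omega> div 2, (npoints n x \<Omega> + 1) div 2}"
      using \<Omega>(2) unfolding median_split_def by blast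
    then have "2 * npoints n x \<Omega>' \<le> npoints n x \<Omega> + 1" by auto
    then have "2 * real (npoints n x \<Omega>') \<le> real (npoints n x \<Omega>) + 1" by linarith
    moreover have "real (npoints n x \<Omega>) \<le> real n / 2 ^ length js + 1" "\<Omega> \<subseteq> cube p" using level \<Omega> by auto
    moreover have "\<Omega>' \<subseteq> \<Omega>" using \<Omega>(2) by (auto simp: lower_part_def upper_part_def)
    ultimately show ?thesis by auto
  qed
  then show ?case using level by blast
qed

text \<open>Only an inequality, because children of different cells, or the two children of one
  cell, can be the same set, which the union counts once.\<close>

lemma sum_UN_pair_le:
  fixes f :: "'b \<Rightarrow> real"
  assumes "finite T" "\<And>\<Omega>. \<Omega> \<in> T \<Longrightarrow> 0 \<le> f (g \<Omega>)" "\<And>\<Omega>. \<Omega> \<in> T \<Longrightarrow> 0 \<le> f (h \<Omega>)"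
  shows "sum f (\<Union>\<Omega>\<in>T. {g \<Omega>, h \<Omega>}) \<le> (\<Sum>\<Omega>\<in>T. f (g \<Omega>) + f (h \<Omega>))"
proof -
  have "(\<Union>\<Omega>\<in>T. {g \<Omega>, h \<Omega>}) = g ` T \<union> h ` T" by auto
  then have "sum f (\<Union>\<Omega>\<in>T. {g \<Omega>, h \<Omega>}) + sum f (g ` T \<inter> h ` T) = sum f (g ` T) + sum f (h ` T)"
    using sum.union_inter[of "g ` T" "h ` T" f] assms by simp
  moreover have "0 \<le> sum f (g ` T \<inter> h ` T)" using assms by (intro sum_nonneg) auto
  moreover have "sum f (g ` T) \<le> sum (f \<circ> g) T" "sum f (h ` T) \<le> sum (f \<circ> h) T"
    using sum_image_le[of T f g] sum_image_le[of T f h] assms by auto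
  ultimately show ?thesis by (simp add: sum.distrib)
qed

text \<open>
  A split along \<open>j\<close> does not increase the sum of the \<open>j\<close>-extents, and a split along another coordinate at most
  doubles it.
\<close>

lemma kd_along_extent:
  assumes "kd_along p n x js T" "j \<in> {1..p}"
  shows "2 ^ count_list js j * sum (extent j) T \<le> 2 ^ length js"
  using assms
proof (induction rule: kd_along.induct)
  case root
  have "(SUP z\<in>cube p. z j) \<le> 1"
    using cube_nonempty root by (intro cSUP_least) (auto simp: cube_def PiE_def Pi_def)
  moreover have "0 \<le> (INF z\<in>cube p. z j)"
    using cube_nonempty root by (intro cINF_greatest) (auto simp: cube_def PiE_def Pi_def)
  ultimately show ?case using cube_nonempty by (simp add: extent_def)
next
  case (level js T i \<tau>)
  let ?T' = "\<Union>\<Omega>\<in>T. {lower_part \<Omega> i (\<tau> \<Omega>), upper_part \<Omega> i (\<tau> \<Omega>)}"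
  have cells: "finite T" "\<And>\<Omega>. \<Omega> \<in> T \<Longrightarrow> \<Omega> \<subseteq> cube p" using kd_along_cells level.hyps(1) by blast+
  have sub: "lower_part \<Omega> i (\<tau> \<Omega>) \<subseteq> \<Omega>" "upper_part \<Omega> i (\<tau> \<Omega>) \<subseteq> \<Omega>" for \<Omega>
    by (auto simp: lower_part_def upper_part_def)
  have "sum (extent j) ?T' \<le> (\<Sum>\<Omega>\<in>T. extent j (lower_part \<Omega> i (\<tau> \<Omega>)) + extent j (upper_part \<Omega> i (\<tau> \<Omega>)))"
    by (intro sum_UN_pair_le cells(1) extent_nonneg[OF order_trans[OF _ cells(2)] level.prems]) (auto simp: sub)
  also have "\<dots> \<le> (\<Sum>\<Omega>\<in>T. (if i = j then 1 else 2) * extent j \<Omega>)"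
  proof (intro sum_mono)
    fix \<Omega> assume "\<Omega> \<in> T"
    then have "\<Omega> \<subseteq> cube p" by (rule cells(2))
    then show "extent j (lower_part \<Omega> i (\<tau> \<Omega>)) + extent j (upper_part \<Omega> i (\<tau> \<Omega>)) \<le> (if i = j then 1 else 2) * extent j \<Omega>"
      using extent_split[of \<Omega> p j "\<tau> \<Omega>"] extent_mono[OF sub(1)[of \<Omega>] _ level.prems] extent_mono[OF sub(2)[of \<Omega>] _ level.prems] level.prems
      by (cases "i = j") auto
  qed
  also have "\<dots> = (if i = j then 1 else 2) * sum (extent j) T" by (simp add: sum_distrib_left)
  finally have "2 ^ count_list (js @ [i]) j * sum (extent j) ?T'
      \<le> 2 ^ count_list (js @ [i]) j * ((if i = j then 1 else 2) * sum (extent j) T)"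
    by (intro mult_left_mono) auto
  also have "\<dots> = 2 * (2 ^ count_list js j * sum (extent j) T)" by simp
  also have "\<dots> \<le> 2 * 2 ^ length js" using level.IH level.prems by (intro mult_left_mono) auto
  finally show ?case by simp
qed

lemma cell_diam_le:
  assumes "\<Omega> \<subseteq> cube p" "S \<subseteq> {1..p}" "i \<in> {1..n}" "x i \<in> \<Omega>"
  shows "cell_diam n x S \<Omega> \<le> (\<Sum>j\<in>S. extent j \<Omega>)"
proof -
  let ?X = "\<Omega> \<inter> x ` {1..n}"
  let ?D = "{L2_set (\<lambda>j. y j - z j) S | y z. y \<in> ?X \<and> z \<in> ?X}"
  have D: "?D = (\<lambda>(y, z). L2_set (\<lambda>j. y j - z j) S) ` (?X \<times> ?X)" by auto
  have "L2_set (\<lambda>j. y j - z j) S \<le> (\<Sum>j\<in>S. extent j \<Omega>)" if "y \<in> \<Omega>" "z \<in> \<Omega>" for y z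
  proof -
    have "L2_set (\<lambda>j. y j - z j) S \<le> (\<Sum>j\<in>S. \<bar>y j - z j\<bar>)" by (rule L2_set_le_sum_abs)
    also have "\<dots> \<le> (\<Sum>j\<in>S. extent j \<Omega>)"
      using assms that by (intro sum_mono extent_ge) auto
    finally show ?thesis .
  qed
  moreover have "finite ?D" "?D \<noteq> {}" unfolding D using assms by auto
  ultimately show ?thesis unfolding cell_diam_def by (subst Max_le_iff) auto
qed

lemma cell_diam_ge:
  assumes "y \<in> \<Omega> \<inter> x ` {1..n}" "z \<in> \<Omega> \<inter> x ` {1..n}"
  shows "L2_set (\<lambda>j. y j - z j) S \<le> cell_diam n x S \<Omega>"
proof -
  let ?X = "\<Omega> \<inter> x ` {1..n}"
  let ?D = "{L2_set (\<lambda>j. y j - z j) S | y z. y \<in> ?X \<and> z \<in> ?X}"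
  have D: "?D = (\<lambda>(y, z). L2_set (\<lambda>j. y j - z j) S) ` (?X \<times> ?X)" by auto
  have "finite ?D" unfolding D by auto
  then show ?thesis unfolding cell_diam_def using assms by (intro Max_ge) auto
qed

lemma distinct_count_list: "distinct js \<Longrightarrow> j \<in> set js \<Longrightarrow> count_list js j = 1"
  by (induction js) auto

lemma count_list_concat_replicate:
  "count_list (concat (replicate s js)) j = s * count_list js j"
  by (induction s) auto

text \<open>Regularity trades the largest diameter for the weighted mean. Each weight is at most
  \<open>2 / K\<close>, with \<open>K\<close> the number of cells, and diameters are dominated by
  extents, whose sum in each coordinate is at most \<open>K / 2 ^ s\<close> after \<open>s\<close>
  rounds; adding over \<open>card S\<close> coordinates gives the bound.\<close>

lemma regular_kd_tree:
  assumes reg: "regular_design p n x C M S" and S: "S \<subseteq> {1..p}" and C: "0 < C" and n: "0 < n"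
    and s: "1 \<le> s" "C * 2 ^ (s * card S) \<le> n" and M: "0 < M"
  obtains T where "T \<in> valid_trees p n x C S (2 ^ (s * card S))"
    "\<And>\<Omega> y z. \<Omega> \<in> T \<Longrightarrow> y \<in> \<Omega> \<inter> x ` {1..n} \<Longrightarrow> z \<in> \<Omega> \<inter> x ` {1..n} \<Longrightarrow>
       L2_set (\<lambda>j. y j - z j) S \<le> 2 * M * real (card S) / 2 ^ s"
proof -
  let ?K = "2 ^ (s * card S) :: nat"
  obtain T where T: "T \<in> valid_trees p n x C S ?K" and kd: "kd_tree p n x S s T"
    and diam: "Max (cell_diam n x S ` T) < M * (\<Sum>\<Omega>\<in>T. emp_measure n x \<Omega> * cell_diam n x S \<Omega>)"
    using reg s unfolding regular_design_def by blast
  obtain js where js: "distinct js" "set js = S" "kd_along p n x (concat (replicate s js)) T"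
    using kd unfolding kd_tree_def by blast
  have len: "length (concat (replicate s js)) = s * card S"
    using distinct_card[OF js(1)] js(2) by (simp add: length_concat sum_list_replicate)
  note cells = kd_along_cells[OF js(3), unfolded len]
  have finT: "finite T" using cells by blast
  have "real ?K \<le> real n"
  proof -
    have "?K \<le> C * ?K" using C by simp
    then show ?thesis using s by (simp only: of_nat_le_iff)
  qed
  have mu: "emp_measure n x \<Omega> \<le> 2 / real ?K" if "\<Omega> \<in> T" for \<Omega>
  proof -
    have "real (npoints n x \<Omega>) \<le> real n / real ?K + 1" using cells that by simp
    \<comment> \<open>With at least as many points as cells, the one extra point from rounding at
      most doubles the bound.\<close>
    also have "1 \<le> real n / real ?K" using \<open>real ?K \<le> real n\<close> by (simp add: le_divide_eq)
    finally have "real (npoints n x \<Omega>) \<le> 2 * real n / real ?K" by simp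
    then show ?thesis using n by (simp add: emp_measure_def field_simps)
  qed
  have diam_nonneg: "0 \<le> cell_diam n x S \<Omega>" if "\<Omega> \<in> T" for \<Omega>
  proof -
    obtain i where "i \<in> {1..n}" "x i \<in> \<Omega>" using valid_trees_nonempty_cells(2)[OF T C n \<open>\<Omega> \<in> T\<close>] by blast
    then show ?thesis using cell_diam_ge[of "x i" \<Omega> x n "x i" S] L2_set_nonneg order_trans by blast
  qed
  have "(\<Sum>\<Omega>\<in>T. emp_measure n x \<Omega> * cell_diam n x S \<Omega>) \<le> (\<Sum>\<Omega>\<in>T. 2 / real ?K * (\<Sum>j\<in>S. extent j \<Omega>))"
  proof (intro sum_mono mult_mono mu diam_nonneg)
    fix \<Omega> assume "\<Omega> \<in> T"
    then obtain i where "i \<in> {1..n}" "x i \<in> \<Omega>" using valid_trees_nonempty_cells(2)[OF T C n] by blast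
    then show "cell_diam n x S \<Omega> \<le> (\<Sum>j\<in>S. extent j \<Omega>)"
      using cells \<open>\<Omega> \<in> T\<close> by (intro cell_diam_le[where p = p and i = i] S) auto
  qed auto
  also have "\<dots> = 2 / real ?K * (\<Sum>j\<in>S. sum (extent j) T)"
    unfolding sum_distrib_left[symmetric] by (subst sum.swap) simp
  also have "\<dots> \<le> 2 / real ?K * (\<Sum>j\<in>S. real ?K / 2 ^ s)"
  proof (intro mult_left_mono sum_mono)
    fix j assume "j \<in> S"
    then have "count_list (concat (replicate s js)) j = s"
      using js by (simp add: count_list_concat_replicate distinct_count_list)
    then have "2 ^ s * sum (extent j) T \<le> real ?K"
      using kd_along_extent[OF js(3), of j] S \<open>j \<in> S\<close> len by auto
    then show "sum (extent j) T \<le> real ?K / 2 ^ s" by (simp add: le_divide_eq mult.commute)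
  qed auto
  also have "\<dots> = 2 * real (card S) / 2 ^ s" by simp
  finally have total: "(\<Sum>\<Omega>\<in>T. emp_measure n x \<Omega> * cell_diam n x S \<Omega>) \<le> 2 * real (card S) / 2 ^ s" .
  have "L2_set (\<lambda>j. y j - z j) S \<le> 2 * M * real (card S) / 2 ^ s"
    if "\<Omega> \<in> T" "y \<in> \<Omega> \<inter> x ` {1..n}" "z \<in> \<Omega> \<inter> x ` {1..n}" for \<Omega> y z
  proof -
    have "L2_set (\<lambda>j. y j - z j) S \<le> cell_diam n x S \<Omega>" using cell_diam_ge that by blast
    also have "\<dots> \<le> Max (cell_diam n x S ` T)" using finT that by (intro Max_ge) auto
    also have "\<dots> \<le> M * (2 * real (card S) / 2 ^ s)"
      using diam mult_left_mono[OF total, of M] M by linarith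
    finally show ?thesis by (simp add: mult.assoc mult.left_commute)
  qed
  with T that show ?thesis by blast
qed

section \<open>Hoelder functions of the active coordinates\<close>

lemma holder_norm_upper:
  assumes "f \<in> holder_class p \<alpha>" "y \<in> cube p" "z \<in> cube p"
  shows "\<bar>f y - f z\<bar> / L2_set (\<lambda>j. y j - z j) {1..p} powr \<alpha> \<le> holder_norm p \<alpha> f"
  using assms unfolding holder_norm_def holder_class_def
  by (intro cSup_upper) (auto simp: holder_quotients_def)

lemma holder_norm_nonneg: "f \<in> holder_class p \<alpha> \<Longrightarrow> 0 \<le> holder_norm p \<alpha> f"
  using holder_norm_upper[of f p \<alpha>] cube_nonempty[of p] by fastforce

lemma holder_class_difference:
  assumes "f \<in> holder_class p \<alpha>" "y \<in> cube p" "z \<in> cube p"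
  shows "\<bar>f y - f z\<bar> \<le> holder_norm p \<alpha> f * L2_set (\<lambda>j. y j - z j) {1..p} powr \<alpha>"
proof (cases "L2_set (\<lambda>j. y j - z j) {1..p} = 0")
  case True
  then have "\<And>j. j \<in> {1..p} \<Longrightarrow> y j = z j" by (subst (asm) L2_set_eq_0_iff) auto
  \<comment> \<open>Points of the cube are extensional, so agreement on \<open>{1..p}\<close> is
    equality.\<close>
  then have "y = z" using assms unfolding cube_def by (rule_tac PiE_ext) auto
  then show ?thesis using holder_norm_nonneg[OF assms(1)] by simp
next
  case False
  then have "0 < L2_set (\<lambda>j. y j - z j) {1..p} powr \<alpha>" by simp
  then show ?thesis using holder_norm_upper[OF assms] by (simp add: pos_divide_le_eq)
qed

text \<open>Coordinates of \<open>z\<close> outside \<open>S\<close> can be replaced by those of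
  \<open>y\<close>: the value of \<open>f\<close> stays, and the distance shrinks to its part in
  \<open>S\<close>.\<close>

lemma holder_class_difference_active:
  assumes f: "f \<in> holder_class p \<alpha> \<inter> constant_outside p S" and S: "S \<subseteq> {1..p}"
    and y: "y \<in> cube p" and z: "z \<in> cube p"
  shows "\<bar>f y - f z\<bar> \<le> holder_norm p \<alpha> f * L2_set (\<lambda>j. y j - z j) S powr \<alpha>"
proof -
  define z' where "z' = (\<lambda>j\<in>{1..p}. if j \<in> S then z j else y j)"
  have z': "z' \<in> cube p" using y z by (auto simp: cube_def z'_def PiE_def Pi_def)
  have "\<forall>j\<in>S. z' j = z j" using S by (auto simp: z'_def)
  then have "f z' = f z" using f z' z unfolding constant_outside_def by blast
  moreover have "L2_set (\<lambda>j. y j - z' j) {1..p} = L2_set (\<lambda>j. y j - z j) S"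
    unfolding L2_set_def using S by (intro arg_cong[of _ _ sqrt] sum.mono_neutral_cong_right) (auto simp: z'_def)
  moreover have "f \<in> holder_class p \<alpha>" using f by simp
  ultimately show ?thesis using holder_class_difference[of f p \<alpha>, OF _ y z'] by simp
qed

text \<open>A supremum over an unbounded set would say nothing, so boundedness comes first: it
  follows from the Hoelder condition and the crude bound \<open>p\<close> on the diameter of the
  cube.\<close>

lemma sup_norm_upper:
  assumes f: "f \<in> holder_class p \<alpha>" and \<alpha>: "0 < \<alpha>" and z: "z \<in> cube p"
  shows "\<bar>f z\<bar> \<le> sup_norm p f"
proof -
  obtain z0 where z0: "z0 \<in> cube p" using cube_nonempty by blast
  have "\<bar>f y\<bar> \<le> \<bar>f z0\<bar> + holder_norm p \<alpha> f * real p powr \<alpha>" if y: "y \<in> cube p" for y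
  proof -
    have coord: "\<bar>y j - z0 j\<bar> \<le> 1" if "j \<in> {1..p}" for j
    proof -
      have "y j \<in> {0..1}" "z0 j \<in> {0..1}" using y z0 that by (auto simp: cube_def PiE_def Pi_def)
      then show ?thesis by auto
    qed
    have "L2_set (\<lambda>j. y j - z0 j) {1..p} \<le> (\<Sum>j\<in>{1..p}. \<bar>y j - z0 j\<bar>)" by (rule L2_set_le_sum_abs)
    also have "\<dots> \<le> (\<Sum>j\<in>{1..p}. 1)" using coord by (intro sum_mono) auto
    finally have "L2_set (\<lambda>j. y j - z0 j) {1..p} \<le> real p" by simp
    then have "L2_set (\<lambda>j. y j - z0 j) {1..p} powr \<alpha> \<le> real p powr \<alpha>"
      using \<alpha> by (intro powr_mono2) (auto simp: L2_set_nonneg)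
    then have "\<bar>f y - f z0\<bar> \<le> holder_norm p \<alpha> f * real p powr \<alpha>"
      using holder_class_difference[OF f y z0] mult_left_mono[OF _ holder_norm_nonneg[OF f]] by fastforce
    then show ?thesis by linarith
  qed
  then have "bdd_above ((\<lambda>z. \<bar>f z\<bar>) ` cube p)" by (intro bdd_aboveI2) auto
  then show ?thesis unfolding sup_norm_def using z by (intro cSUP_upper)
qed

text \<open>Logarithmic size of a model: \<open>ln p\<close> per selected coordinate and
  \<open>ln n\<close> per cell. Prior mass, number of trees and noise level are all expressed in
  this one quantity.\<close>

definition complexity :: "nat \<Rightarrow> nat \<Rightarrow> nat set \<Rightarrow> nat \<Rightarrow> real" where
  "complexity p n S K = real (card S) * ln (real p) + real K * ln (real n)"

text \<open>
  If \<open>n / n powr (q / (2 * \<alpha> + q))\<close> stays bounded, then the rate is of the order \<open>sqrt (ln n)\<close> and the zero function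
  is a good enough approximation.
\<close>

lemma tree_approximation:
  fixes p n C :: nat and x :: "nat \<Rightarrow> point" and f0 :: "point \<Rightarrow> real" and S0 :: "nat set" and \<alpha> M c1 c2 c3 :: real
  defines "q \<equiv> real (card S0)"
  defines "N \<equiv> real n powr (q / (2 * \<alpha> + q))"
  assumes n: "3 \<le> n" and C: "0 < C" "C \<le> n" and p: "1 \<le> p"
    and design: "\<And>i. i \<in> {1..n} \<Longrightarrow> x i \<in> cube p"
    and \<alpha>: "0 < \<alpha>" "\<alpha> \<le> 1"
    and S0: "S0 \<subseteq> {1..p}" "0 < card S0"
    and f0: "f0 \<in> holder_class p \<alpha> \<inter> constant_outside p S0"
    and c1: "q * holder_norm p \<alpha> f0 \<le> c1 * sqrt (ln (real n))"
    and c2: "sup_norm p f0 \<le> c2 * sqrt (ln (real n))"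
    and c3: "ln (real p) \<le> c3 * N" "0 < c3"
    and M: "0 < M" and reg: "regular_design p n x C M S0"
  obtains S K T b \<delta> where "(S, K, T) \<in> tree_indices p n x C"
    "complexity p n S K \<le> (1 + 2 * c3) * (N * ln (real n))"
    "\<And>\<Omega>. \<Omega> \<in> T \<Longrightarrow> \<bar>b \<Omega>\<bar> \<le> c2 * sqrt (ln (real n))"
    "\<And>\<Omega> i. \<Omega> \<in> T \<Longrightarrow> i \<in> {1..n} \<Longrightarrow> x i \<in> \<Omega> \<Longrightarrow> \<bar>f0 (x i) - b \<Omega>\<bar> \<le> \<delta>"
    "0 \<le> \<delta>" "real n * \<delta>\<^sup>2 \<le> (max (real C) 4 * c2\<^sup>2 + ((1 + 4 * M) * c1)\<^sup>2) * (N * ln (real n))"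
proof -
  \<comment> \<open>In the nontrivial case \<open>?m * N \<le> n\<close>: the \<open>C\<close>
    leaves room for a valid tree with at most \<open>N\<close> cells, and the 4 forces
    \<open>r \<ge> 2\<close> below and thus at least one round of splits.\<close>
  let ?m = "max (real C) 4" and ?L = "ln (real n)"
  have f0h: "f0 \<in> holder_class p \<alpha>" using f0 by auto
  have L: "1 \<le> ?L"
  proof -
    have "exp 1 \<le> (3 :: real)" by (rule exp_le)
    then have "exp 1 \<le> real n" using n by linarith
    then show ?thesis using n by (simp add: ln_ge_iff)
  qed
  have q: "1 \<le> q" using S0 by (simp add: q_def)
  have N1: "1 \<le> N" unfolding N_def using n q \<alpha> by (intro ge_one_powr_ge_zero) auto
  have sup: "\<bar>f0 (x i)\<bar> \<le> c2 * sqrt ?L" if "i \<in> {1..n}" for i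
    using sup_norm_upper[OF f0h \<alpha>(1) design[OF that]] c2 by linarith
  have c2': "0 \<le> c2 * sqrt ?L" using sup[of 1] n by fastforce
  have L_le: "?L \<le> N * ?L" using N1 L by (simp add: mult_le_cancel_right1)
  show thesis
  proof (cases "real n < ?m * N")
    case True
    have idx: "({}, 1, {cube p}) \<in> tree_indices p n x C"
    proof -
      have "{i. Suc 0 \<le> i \<and> i \<le> n \<and> x i \<in> cube p} = {1..n}" using design by auto
      then have "npoints n x (cube p) = n" by (simp add: npoints_def)
      then show ?thesis
        using C tree_partition.root[of p n x]
        by (auto simp: tree_indices_def valid_trees_def emp_measure_def divide_right_mono)
    qed
    show thesis
    proof (rule that[OF idx, of "\<lambda>_. 0" "c2 * sqrt ?L"])
      have "0 \<le> 2 * c3 * (N * ?L)" using c3 N1 L by (intro mult_nonneg_nonneg) auto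
      then have "?L \<le> N * ?L + 2 * c3 * (N * ?L)" using L_le by linarith
      then show "complexity p n {} 1 \<le> (1 + 2 * c3) * (N * ?L)"
        by (simp add: complexity_def algebra_simps)
      have "real n * (c2 * sqrt ?L)\<^sup>2 = real n * (c2\<^sup>2 * ?L)" using L by (simp add: power_mult_distrib)
      also have "\<dots> \<le> (?m * N) * (c2\<^sup>2 * ?L)" using True L by (intro mult_right_mono) auto
      also have "\<dots> = ?m * c2\<^sup>2 * (N * ?L)" by simp
      also have "\<dots> \<le> (?m * c2\<^sup>2 + ((1 + 4 * M) * c1)\<^sup>2) * (N * ?L)"
        using N1 L by (intro mult_right_mono) auto
      finally show "real n * (c2 * sqrt ?L)\<^sup>2 \<le> (?m * c2\<^sup>2 + ((1 + 4 * M) * c1)\<^sup>2) * (N * ?L)" .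
    qed (use sup c2' in auto)
  next
    case False
    then have nN: "?m * N \<le> real n" by simp
    \<comment> \<open>Ideal number of pieces per active coordinate: with \<open>N = r powr q\<close>
      cells, the squared bias, of order \<open>r powr (- 2 * \<alpha>)\<close>, equals
      \<open>N / n\<close> up to constants and logarithms.\<close>
    define r where "r = real n powr (1 / (2 * \<alpha> + q))"
    have r_q: "r powr q = N" unfolding r_def N_def by (simp add: powr_powr)
    have "r powr (2 * \<alpha>) * N = r powr (2 * \<alpha> + q)" by (simp add: r_q[symmetric] powr_add)
    also have "\<dots> = real n" unfolding r_def using \<alpha> q n by (simp add: powr_powr)
    finally have r_2a: "r powr (2 * \<alpha>) * N = real n" .
    have r0: "0 < r" unfolding r_def using n by simp
    have r2: "2 \<le> r"
    proof (rule ccontr)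
      assume "\<not> 2 \<le> r"
      then have "r powr (2 * \<alpha>) < 2 powr (2 * \<alpha>)" using \<alpha> r0 by (intro powr_less_mono2) auto
      also have "\<dots> \<le> 2 powr 2" using \<alpha> by (intro powr_mono) auto
      finally have "r powr (2 * \<alpha>) < 4" by simp
      then have "r powr (2 * \<alpha>) * N < 4 * N" using N1 by simp
      also have "\<dots> \<le> ?m * N" using N1 by (intro mult_right_mono) auto
      finally show False using nN r_2a by simp
    qed
    \<comment> \<open>Largest number of rounds with \<open>2 ^ s \<le> r\<close>; rounding down
      costs at most a factor 2 in the cell width.\<close>
    define s where "s = nat \<lfloor>log 2 r\<rfloor>"
    have log1: "1 \<le> log 2 r" using r2 by (simp add: le_log_iff)
    then have s1: "1 \<le> s" unfolding s_def by (simp add: le_nat_iff le_floor_iff)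
    have "real s = of_int \<lfloor>log 2 r\<rfloor>" unfolding s_def using log1 by simp
    then have "real s \<le> log 2 r" "log 2 r \<le> real s + 1" by linarith+
    then have "2 powr real s \<le> r" "r \<le> 2 powr (real s + 1)" using r0 by (auto simp: le_log_iff log_le_iff)
    then have rs: "2 ^ s \<le> r" "r \<le> 2 * 2 ^ s" by (auto simp: powr_add powr_realpow)
    have K: "2 ^ (s * card S0) \<le> N"
    proof -
      have "2 ^ (s * card S0) = (2 ^ s :: real) ^ card S0" by (simp add: power_mult)
      also have "\<dots> \<le> r ^ card S0" using rs by (intro power_mono) auto
      also have "\<dots> = N" using r0 r_q by (simp add: q_def powr_realpow)
      finally show ?thesis .
    qed
    have "real C * 2 ^ (s * card S0) \<le> ?m * N" using K by (intro mult_mono) auto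
    then have "real (C * 2 ^ (s * card S0)) \<le> real n" using nN by simp
    then have CK: "C * 2 ^ (s * card S0) \<le> n" by (simp only: of_nat_le_iff)
    obtain T where T: "T \<in> valid_trees p n x C S0 (2 ^ (s * card S0))"
      and diam: "\<And>\<Omega> y z. \<Omega> \<in> T \<Longrightarrow> y \<in> \<Omega> \<inter> x ` {1..n} \<Longrightarrow> z \<in> \<Omega> \<inter> x ` {1..n} \<Longrightarrow>
         L2_set (\<lambda>j. y j - z j) S0 \<le> 2 * M * real (card S0) / 2 ^ s"
      using regular_kd_tree[OF reg S0(1) C(1) _ s1 CK M] n by auto
    have idx: "(S0, 2 ^ (s * card S0), T) \<in> tree_indices p n x C"
      using T S0 by (auto simp: tree_indices_def)
    define g where "g \<Omega> = (SOME i. i \<in> {1..n} \<and> x i \<in> \<Omega>)" for \<Omega>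
    have g: "g \<Omega> \<in> {1..n} \<and> x (g \<Omega>) \<in> \<Omega>" if "\<Omega> \<in> T" for \<Omega>
      unfolding g_def using valid_trees_nonempty_cells(2)[OF T C(1) _ that] n by (rule_tac someI_ex) auto
    \<comment> \<open>\<open>4 * M\<close> is \<open>2 * M\<close> from the diameter bound times the
      rounding factor 2. The added 1 makes the base at least one, so that raising it to the power
      \<alpha> \<le> 1 does not increase it.\<close>
    define \<delta> where "\<delta> = (1 + 4 * M) * (c1 * sqrt ?L) * r powr (- \<alpha>)"
    have H: "holder_norm p \<alpha> f0 * (2 * M * real (card S0) / 2 ^ s) powr \<alpha> \<le> \<delta>"
    proof -
      have "2 * M * real (card S0) / 2 ^ s \<le> (1 + 4 * M) * q / r"
      proof -
        have "2 * M * q * r \<le> 2 * M * q * (2 * 2 ^ s)" using rs M q by (intro mult_left_mono) auto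
        also have "\<dots> = (4 * M) * q * 2 ^ s" by simp
        also have "\<dots> \<le> (1 + 4 * M) * q * 2 ^ s" using q by (intro mult_right_mono) auto
        finally show ?thesis using r0 by (simp add: q_def field_simps)
      qed
      then have "(2 * M * real (card S0) / 2 ^ s) powr \<alpha> \<le> ((1 + 4 * M) * q / r) powr \<alpha>"
        using \<alpha> M by (intro powr_mono2) auto
      also have "\<dots> = (1 + 4 * M) powr \<alpha> * q powr \<alpha> * r powr (- \<alpha>)"
        using M q r0 by (simp add: powr_divide powr_mult powr_minus_divide)
      also have "\<dots> \<le> (1 + 4 * M) * q * r powr (- \<alpha>)"
      proof -
        have "(1 + 4 * M) powr \<alpha> \<le> (1 + 4 * M) powr 1" using \<alpha> M by (intro powr_mono) auto
        moreover have "q powr \<alpha> \<le> q powr 1" using \<alpha> q by (intro powr_mono) auto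
        ultimately show ?thesis using M q by (intro mult_right_mono mult_mono) auto
      qed
      finally have "holder_norm p \<alpha> f0 * (2 * M * real (card S0) / 2 ^ s) powr \<alpha>
          \<le> holder_norm p \<alpha> f0 * ((1 + 4 * M) * q * r powr (- \<alpha>))"
        by (intro mult_left_mono holder_norm_nonneg[OF f0h])
      also have "\<dots> = (1 + 4 * M) * (q * holder_norm p \<alpha> f0) * r powr (- \<alpha>)" by simp
      also have "\<dots> \<le> \<delta>" unfolding \<delta>_def using c1 M by (intro mult_right_mono mult_left_mono) auto
      finally show ?thesis .
    qed
    show thesis
    proof (rule that[OF idx, of "\<lambda>\<Omega>. f0 (x (g \<Omega>))" \<delta>])
      \<comment> \<open>One round or more along each active coordinate gives at least
        \<open>2 ^ card S0\<close> cells, and there are at most \<open>n\<close>; hence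
        \<open>q \<le> 2 * ln n\<close>. The logarithm in the bound on the complexity absorbs this
        \<open>q\<close>.\<close>
      have "2 ^ card S0 \<le> (2 :: real) ^ (s * card S0)" using s1 by (intro power_increasing) auto
      also have "\<dots> \<le> N" by (rule K)
      also have "\<dots> \<le> real n"
      proof -
        have "1 * N \<le> ?m * N" using N1 by (intro mult_right_mono) auto
        then show ?thesis using nN by simp
      qed
      finally have "ln (2 ^ card S0) \<le> ?L" using n by (subst ln_le_cancel_iff) auto
      then have "q * ln 2 \<le> ?L" by (simp add: q_def ln_realpow)
      moreover have "q * (2 / 3) \<le> q * ln 2" using q ln2_ge_two_thirds by (intro mult_left_mono) auto
      ultimately have q_le: "q \<le> 2 * ?L" using L by simp
      have "q * ln (real p) \<le> 2 * ?L * (c3 * N)"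
        using q_le c3 q L p by (intro mult_mono) auto
      moreover have "real (2 ^ (s * card S0)) * ?L \<le> N * ?L" using K L by (intro mult_right_mono) auto
      ultimately show "complexity p n S0 (2 ^ (s * card S0)) \<le> (1 + 2 * c3) * (N * ?L)"
        unfolding complexity_def q_def[symmetric] by (simp add: algebra_simps)
      show "\<bar>f0 (x (g \<Omega>))\<bar> \<le> c2 * sqrt ?L" if "\<Omega> \<in> T" for \<Omega> using sup g that by blast
      show "\<bar>f0 (x i) - f0 (x (g \<Omega>))\<bar> \<le> \<delta>" if "\<Omega> \<in> T" "i \<in> {1..n}" "x i \<in> \<Omega>" for \<Omega> i
      proof -
        have "\<bar>f0 (x i) - f0 (x (g \<Omega>))\<bar> \<le> holder_norm p \<alpha> f0 * L2_set (\<lambda>j. x i j - x (g \<Omega>) j) S0 powr \<alpha>"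
          using holder_class_difference_active[OF f0 S0(1)] design g that by blast
        also have "\<dots> \<le> holder_norm p \<alpha> f0 * (2 * M * real (card S0) / 2 ^ s) powr \<alpha>"
          using that g \<alpha> by (intro mult_left_mono holder_norm_nonneg[OF f0h] powr_mono2 diam[OF that(1)]) (auto simp: L2_set_nonneg)
        finally show ?thesis using H by simp
      qed
      show "0 \<le> \<delta>" using H holder_norm_nonneg[OF f0h] by (meson mult_nonneg_nonneg order_trans powr_ge_zero)
      have "r powr (- \<alpha>) * r powr (- \<alpha>) * r powr (2 * \<alpha>) = 1"
        using r0 by (simp flip: powr_add)
      then have "real n * (r powr (- \<alpha>))\<^sup>2 = N"
        unfolding r_2a[symmetric] power2_eq_square by (metis (no_types, opaque_lifting) mult.assoc mult.commute mult_1)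
      then have "real n * \<delta>\<^sup>2 = ((1 + 4 * M) * c1)\<^sup>2 * (N * ?L)"
        unfolding \<delta>_def using L by (simp add: power_mult_distrib)
      also have "\<dots> \<le> (?m * c2\<^sup>2 + ((1 + 4 * M) * c1)\<^sup>2) * (N * ?L)"
        using N1 L by (intro mult_right_mono) auto
      finally show "real n * \<delta>\<^sup>2 \<le> (?m * c2\<^sup>2 + ((1 + 4 * M) * c1)\<^sup>2) * (N * ?L)" .
    qed
  qed
qed

section \<open>Prior weights\<close>

lemma tree_indices_Sigma:
  assumes "0 < C" "0 < n"
  shows "tree_indices p n x C = (SIGMA S:Pow {1..p}. SIGMA K:{1..n}. valid_trees p n x C S K)"
  using valid_trees_partition(4)[OF _ assms] by (auto simp: tree_indices_def)

lemma sum_tree_indices: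
  fixes F :: "nat set \<times> nat \<times> partition \<Rightarrow> real"
  assumes "0 < C" "0 < n"
  shows "(\<Sum>i\<in>tree_indices p n x C. F i) =
    (\<Sum>S\<in>Pow {1..p}. \<Sum>K\<in>{1..n}. \<Sum>T\<in>valid_trees p n x C S K. F (S, K, T))"
proof -
  have fin: "finite (valid_trees p n x C S K)" if "S \<in> Pow {1..p}" for S K
    using that finite_subset by (intro finite_valid_trees) auto
  have "(\<Sum>i\<in>tree_indices p n x C. F i) = (\<Sum>S\<in>Pow {1..p}. \<Sum>j\<in>(SIGMA K:{1..n}. valid_trees p n x C S K). F (S, j))"
    unfolding tree_indices_Sigma[OF assms]
    by (subst sum.Sigma) (use fin in \<open>auto intro!: finite_SigmaI\<close>)
  also have "\<dots> = (\<Sum>S\<in>Pow {1..p}. \<Sum>K\<in>{1..n}. \<Sum>T\<in>valid_trees p n x C S K. F (S, K, T))"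
    by (intro sum.cong refl, subst sum.Sigma) (use fin in auto)
  finally show ?thesis .
qed

lemma sum_Pow_card:
  fixes h :: "nat \<Rightarrow> real"
  shows "(\<Sum>S\<in>Pow {1..p}. h (card S)) = (\<Sum>q\<in>{0..p}. real (p choose q) * h q)"
proof -
  have "card S \<le> p" if "S \<subseteq> {1..p}" for S
    using card_mono[OF _ that] by simp
  then have "(\<Sum>S\<in>Pow {1..p}. h (card S)) = (\<Sum>q\<in>{0..p}. \<Sum>S\<in>{S\<in>Pow {1..p}. card S = q}. h (card S))"
    by (intro sum.group[symmetric]) auto
  also have "\<dots> = (\<Sum>q\<in>{0..p}. real (p choose q) * h q)"
  proof (intro sum.cong refl)
    fix q
    have "card {S\<in>Pow {1..p}. card S = q} = p choose q"
      using n_subsets[of "{1..p}" q] by (simp add: Pow_def)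
    then show "(\<Sum>S\<in>{S\<in>Pow {1..p}. card S = q}. h (card S)) = real (p choose q) * h q"
      by simp
  qed
  finally show ?thesis .
qed

lemma sum_half_powers_le_2:
  fixes u :: "nat \<Rightarrow> real"
  assumes "\<And>q. u q \<le> (1 / 2) ^ q"
  shows "(\<Sum>q\<in>{0..m}. u q) \<le> 2"
proof -
  have "(\<Sum>q\<in>{0..m}. u q) \<le> (\<Sum>q\<in>{0..m}. (1 / 2) ^ q)" by (intro sum_mono assms)
  also have "\<dots> \<le> (\<Sum>q. (1 / 2 :: real) ^ q)" by (intro sum_le_suminf summable_geometric) auto
  finally show ?thesis by (simp add: suminf_geometric)
qed

text \<open>One sample size is fixed here. The lower bounds 3 make \<open>ln n\<close> and
  \<open>ln p\<close> at least one; \<open>p_large\<close> holds for all large \<open>p\<close> and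
  makes the prior on the dimension decay geometrically with ratio 1/2.\<close>

locale tree_regression =
  fixes p n C :: nat and x :: "nat \<Rightarrow> point" and a c l :: real
    and \<pi> :: "nat set \<Rightarrow> nat \<Rightarrow> partition \<Rightarrow> real"
  assumes n: "3 \<le> n" and p: "3 \<le> p" and C: "0 < C"
    and design: "\<And>i. i \<in> {1..n} \<Longrightarrow> x i \<in> cube p"
    and hyperparameters: "0 < a" "0 < c" "0 < l"
    and p_large: "real p powr (- (a / 2)) \<le> c / 2"
    and tree_prior: "tree_prior p n x C \<pi>"
begin

lemma n0: "0 < n" using n by simp

lemma exp_1_le: "3 \<le> (m :: nat) \<Longrightarrow> exp 1 \<le> real m"
  using exp_le by linarith

lemma ln_n: "1 \<le> ln (real n)"
  using exp_1_le[OF n] n by (simp add: ln_ge_iff)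

lemma ln_p: "1 \<le> ln (real p)"
  using exp_1_le[OF p] p by (simp add: ln_ge_iff)

abbreviation "indices \<equiv> tree_indices p n x C"
abbreviation "weight \<equiv> prior_weight p a c l \<pi>"

lemma finite_indices: "finite indices"
  using finite_tree_indices C n0 by blast

lemma \<pi>_nonneg: "0 \<le> \<pi> S K T"
  using tree_prior by (auto simp: tree_prior_def)

lemma exp_l: "0 < exp l - 1"
  using hyperparameters by simp

lemma prior_factors_nonneg: "0 \<le> prior_q p a c q" "0 \<le> prior_S p S" "0 \<le> prior_K l K"
  using hyperparameters exp_l by (auto simp: prior_q_def prior_S_def prior_K_def intro!: divide_nonneg_nonneg sum_nonneg mult_nonneg_nonneg)

lemma weight_nonneg: "0 \<le> weight i"
  using prior_factors_nonneg \<pi>_nonneg by (cases i) (auto simp: prior_weight_def)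

lemma sum_\<pi>_le_1:
  assumes "S \<subseteq> {1..p}"
  shows "(\<Sum>T\<in>valid_trees p n x C S K. \<pi> S K T) \<le> 1"
proof -
  let ?V = "valid_trees p n x C S K" and ?ind = "induced_partition n x"
  have fin: "finite ?V" using assms finite_subset by (intro finite_valid_trees) auto
  have "(\<Sum>T\<in>?V. \<pi> S K T) = (\<Sum>P\<in>?ind ` ?V. \<Sum>T\<in>{T\<in>?V. ?ind T = P}. \<pi> S K T)"
    using fin by (intro sum.group[symmetric]) auto
  also have "\<dots> = (\<Sum>P\<in>?ind ` ?V. 1 / real (partitioning_number p n x C S K))"
    using tree_prior by (intro sum.cong) (auto simp: tree_prior_def)
  also have "\<dots> \<le> 1" by (simp add: partitioning_number_def)
  finally show ?thesis .
qed

text \<open>Half of the exponent \<open>a\<close> pays for the factor \<open>p powr (d * q)\<close>;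
  the other half, by \<open>p_large\<close>, absorbs \<open>1 / c\<close> and leaves the ratio
  1/2.\<close>

lemma prior_q_base:
  assumes "0 \<le> d" "d \<le> a / 2"
  shows "c powr (- real q) * real p powr (- a * real q) * exp (d * (real q * ln (real p))) \<le> (1 / 2) ^ q"
proof -
  have "c powr (- real q) * real p powr (- a * real q) * exp (d * (real q * ln (real p)))
    = (inverse c * real p powr (d - a)) ^ q"
  proof -
    have "real p powr (- a * real q) * exp (d * (real q * ln (real p))) = (real p powr (d - a)) ^ q"
      using p by (simp add: powr_def exp_of_nat_mult[symmetric] exp_add[symmetric] algebra_simps)
    moreover have "c powr (- real q) = inverse c ^ q"
      using hyperparameters by (simp add: powr_minus powr_realpow power_inverse)
    ultimately show ?thesis by (simp add: power_mult_distrib)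
  qed
  also have "\<dots> \<le> (1 / 2) ^ q"
  proof (intro power_mono)
    have "real p powr (d - a) \<le> real p powr (- (a / 2))" using assms p by (intro powr_mono) auto
    then have "inverse c * real p powr (d - a) \<le> inverse c * (c / 2)"
      using p_large hyperparameters by (intro mult_left_mono) auto
    then show "inverse c * real p powr (d - a) \<le> 1 / 2" using hyperparameters by simp
  qed (use hyperparameters in auto)
  finally show ?thesis .
qed

lemma prior_q_normalizer:
  "1 \<le> (\<Sum>r\<in>{0..p}. c powr (- real r) * real p powr (- a * real r))"
  "(\<Sum>r\<in>{0..p}. c powr (- real r) * real p powr (- a * real r)) \<le> 2"
proof -
  have "(\<Sum>r\<in>{0}. c powr (- real r) * real p powr (- a * real r)) \<le> (\<Sum>r\<in>{0..p}. c powr (- real r) * real p powr (- a * real r))"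
    by (intro sum_mono2) auto
  then show "1 \<le> (\<Sum>r\<in>{0..p}. c powr (- real r) * real p powr (- a * real r))"
    using hyperparameters p by simp
  show "(\<Sum>r\<in>{0..p}. c powr (- real r) * real p powr (- a * real r)) \<le> 2"
    using prior_q_base[of 0] hyperparameters by (intro sum_half_powers_le_2) auto
qed

text \<open>The bound factorises. The coordinate part stays geometric; in the part for
  \<open>K\<close>, the factor \<open>n powr (d * K)\<close> only rescales the Poisson parameter to
  \<open>l * n powr d\<close>, which explains the exponential on the right.\<close>

lemma weight_exponential_moment:
  assumes "0 \<le> d" "d \<le> a / 2"
  shows "(\<Sum>(S, K, T)\<in>indices. weight (S, K, T) * exp (d * complexity p n S K))
    \<le> 2 * exp (l * real n powr d) / (exp l - 1)"
proof -
  define h where "h q = prior_q p a c q / real (p choose q) * exp (d * (real q * ln (real p)))" for q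
  define k where "k K = prior_K l K * exp (d * (real K * ln (real n)))" for K
  have h0: "0 \<le> h q" and k0: "0 \<le> k K" for q K
    using prior_factors_nonneg by (auto simp: h_def k_def)
  have inner: "(\<Sum>T\<in>valid_trees p n x C S K. weight (S, K, T) * exp (d * complexity p n S K)) \<le> h (card S) * k K"
    if "S \<in> Pow {1..p}" for S K
  proof -
    have "(\<Sum>T\<in>valid_trees p n x C S K. weight (S, K, T) * exp (d * complexity p n S K))
      = h (card S) * k K * (\<Sum>T\<in>valid_trees p n x C S K. \<pi> S K T)"
      unfolding sum_distrib_left
      by (intro sum.cong refl)
        (simp add: prior_weight_def h_def k_def prior_S_def complexity_def distrib_left exp_add)
    also have "\<dots> \<le> h (card S) * k K"
      using that sum_\<pi>_le_1[of S K] h0 k0 by (intro mult_left_le) auto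
    finally show ?thesis .
  qed
  have "(\<Sum>(S, K, T)\<in>indices. weight (S, K, T) * exp (d * complexity p n S K))
    = (\<Sum>S\<in>Pow {1..p}. \<Sum>K\<in>{1..n}. \<Sum>T\<in>valid_trees p n x C S K. weight (S, K, T) * exp (d * complexity p n S K))"
    by (subst sum_tree_indices[OF C n0]) simp
  also have "\<dots> \<le> (\<Sum>S\<in>Pow {1..p}. \<Sum>K\<in>{1..n}. h (card S) * k K)"
    by (intro sum_mono inner)
  also have "\<dots> = (\<Sum>S\<in>Pow {1..p}. h (card S)) * (\<Sum>K\<in>{1..n}. k K)"
    by (simp only: sum_product)
  also have "\<dots> \<le> 2 * (exp (l * real n powr d) / (exp l - 1))"
  proof (intro mult_mono)
    have "real (p choose q) * h q \<le> (1 / 2) ^ q" if "q \<in> {0..p}" for q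
    proof -
      have "real (p choose q) * h q = prior_q p a c q * exp (d * (real q * ln (real p)))"
        using that by (simp add: h_def)
      also have "\<dots> \<le> c powr (- real q) * real p powr (- a * real q) * exp (d * (real q * ln (real p)))"
      proof (intro mult_right_mono)
        have "prior_q p a c q \<le> c powr (- real q) * real p powr (- a * real q) / 1"
          unfolding prior_q_def using prior_q_normalizer(1) by (intro divide_left_mono) auto
        then show "prior_q p a c q \<le> c powr (- real q) * real p powr (- a * real q)" by simp
      qed auto
      also have "\<dots> \<le> (1 / 2) ^ q" by (rule prior_q_base[OF assms])
      finally show ?thesis .
    qed
    then have "(\<Sum>q\<in>{0..p}. real (p choose q) * h q) \<le> (\<Sum>q\<in>{0..p}. (1 / 2) ^ q)"
      by (intro sum_mono) auto
    also have "\<dots> \<le> 2" by (intro sum_half_powers_le_2) auto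
    finally show "(\<Sum>S\<in>Pow {1..p}. h (card S)) \<le> 2" unfolding sum_Pow_card .
    have "(\<Sum>K\<in>{1..n}. k K) = (\<Sum>K\<in>{1..n}. (l * real n powr d) ^ K / fact K) / (exp l - 1)"
      unfolding sum_divide_distrib using n0
      by (intro sum.cong refl) (simp add: k_def prior_K_def power_mult_distrib powr_def exp_of_nat_mult[symmetric] mult.left_commute)
    also have "\<dots> \<le> exp (l * real n powr d) / (exp l - 1)"
    proof (intro divide_right_mono)
      have "(\<Sum>K\<in>{1..n}. (l * real n powr d) ^ K / fact K) \<le> (\<Sum>K. (l * real n powr d) ^ K / fact K)"
        using hyperparameters summable_exp_generic[of "l * real n powr d"]
        by (intro sum_le_suminf) (auto simp: divide_inverse mult.commute)
      then show "(\<Sum>K\<in>{1..n}. (l * real n powr d) ^ K / fact K) \<le> exp (l * real n powr d)"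
        by (simp add: exp_def divide_inverse mult.commute)
    qed (use exp_l in auto)
    finally show "(\<Sum>K\<in>{1..n}. k K) \<le> exp (l * real n powr d) / (exp l - 1)" .
  qed (use k0 exp_l in \<open>auto intro: sum_nonneg\<close>)
  finally show ?thesis by simp
qed

text \<open>Only the mass of a whole trace class is prescribed, hence the sum. The 5 collects 1 for
  \<open>p choose q \<le> p ^ q\<close>, 1 for \<open>fact K \<le> n ^ K\<close> and 3 for the
  number of trees; the divisor is the bound 2 on the normalizer of \<open>prior_q\<close> times
  \<open>exp l - 1\<close> from \<open>prior_K\<close>.\<close>

lemma class_weight_lower:
  assumes idx: "(S, K, T0) \<in> indices"
  shows "exp (- (\<bar>ln c\<bar> + a + \<bar>ln l\<bar> + 5) * complexity p n S K) / (2 * (exp l - 1))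
    \<le> (\<Sum>T\<in>{T\<in>valid_trees p n x C S K. induced_partition n x T = induced_partition n x T0}. weight (S, K, T))"
proof -
  let ?V = "valid_trees p n x C S K" and ?Lp = "ln (real p)" and ?Ln = "ln (real n)"
  define q where "q = card S"
  have T0: "T0 \<in> ?V" and S: "S \<subseteq> {1..p}" using idx by (auto simp: tree_indices_def)
  note V = valid_trees_partition[OF T0 C n0]
  have q: "q \<le> p" using card_mono[OF _ S] by (simp add: q_def)
  have qLp: "0 \<le> real q * ?Lp" "real q \<le> real q * ?Lp" and KLn: "0 \<le> real K * ?Ln" "real K \<le> real K * ?Ln"
    using ln_p ln_n by (auto simp: mult_le_cancel_left1)
  have "(\<Sum>T\<in>{T\<in>?V. induced_partition n x T = induced_partition n x T0}. weight (S, K, T))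
    = prior_q p a c q * prior_S p S * prior_K l K * (\<Sum>T\<in>{T\<in>?V. induced_partition n x T = induced_partition n x T0}. \<pi> S K T)"
    unfolding sum_distrib_left by (simp add: prior_weight_def q_def)
  also have "(\<Sum>T\<in>{T\<in>?V. induced_partition n x T = induced_partition n x T0}. \<pi> S K T) = 1 / real (partitioning_number p n x C S K)"
    using tree_prior T0 unfolding tree_prior_def by blast
  finally have eq: "(\<Sum>T\<in>{T\<in>?V. induced_partition n x T = induced_partition n x T0}. weight (S, K, T))
    = prior_q p a c q * prior_S p S * prior_K l K * (1 / real (partitioning_number p n x C S K))" .
  have q_lower: "exp (- (\<bar>ln c\<bar> + a) * (real q * ?Lp)) / 2 \<le> prior_q p a c q"
  proof -
    have "real q * ln c \<le> real q * \<bar>ln c\<bar>" by (intro mult_left_mono) auto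
    also have "\<dots> = \<bar>ln c\<bar> * real q" by simp
    also have "\<dots> \<le> \<bar>ln c\<bar> * (real q * ?Lp)" using qLp by (intro mult_left_mono) auto
    finally have "exp (- (\<bar>ln c\<bar> + a) * (real q * ?Lp)) \<le> exp (- real q * ln c + - a * real q * ?Lp)"
      by (simp add: algebra_simps)
    also have "\<dots> = c powr (- real q) * real p powr (- a * real q)"
      using hyperparameters p unfolding exp_add by (simp add: powr_def)
    finally have "exp (- (\<bar>ln c\<bar> + a) * (real q * ?Lp)) / 2 \<le> c powr (- real q) * real p powr (- a * real q) / 2"
      by simp
    also have "\<dots> \<le> prior_q p a c q"
      unfolding prior_q_def using prior_q_normalizer by (intro divide_left_mono) (auto intro!: mult_pos_pos)
    finally show ?thesis .
  qed
  have S_lower: "exp (- (real q * ?Lp)) \<le> prior_S p S"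
  proof -
    have "real (p choose q) \<le> real (p ^ q)" using binomial_le_pow[OF q] by (simp only: of_nat_le_iff)
    also have "\<dots> = exp (real q * ?Lp)" using p by (simp add: exp_of_nat_mult)
    finally have "real (p choose q) \<le> exp (real q * ?Lp)" .
    moreover have "0 < real (p choose q)" using q by simp
    ultimately have "1 / exp (real q * ?Lp) \<le> 1 / real (p choose q)" by (intro divide_left_mono) auto
    then show ?thesis by (simp add: prior_S_def q_def exp_minus divide_inverse)
  qed
  have K_lower: "exp (- (\<bar>ln l\<bar> + 1) * (real K * ?Ln)) / (exp l - 1) \<le> prior_K l K"
  proof -
    have "real K * - ln l \<le> real K * \<bar>ln l\<bar>" by (intro mult_left_mono) auto
    then have "- (real K * ln l) \<le> \<bar>ln l\<bar> * real K" by (simp add: mult.commute)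
    also have "\<dots> \<le> \<bar>ln l\<bar> * (real K * ?Ln)" using KLn by (intro mult_left_mono) auto
    finally have "exp (- (\<bar>ln l\<bar> + 1) * (real K * ?Ln)) \<le> exp (real K * ln l + - (real K * ?Ln))"
      by (simp add: algebra_simps)
    also have "\<dots> = l ^ K / real n ^ K"
      using hyperparameters n0 by (simp add: exp_diff exp_of_nat_mult)
    also have "\<dots> \<le> l ^ K / fact K"
    proof (intro divide_left_mono)
      have "fact K \<le> (real K) ^ K" using fact_le_power[of K] by simp
      also have "\<dots> \<le> real n ^ K" using V by (intro power_mono) auto
      finally show "fact K \<le> real n ^ K" .
    qed (use hyperparameters n0 in auto)
    finally have "exp (- (\<bar>ln l\<bar> + 1) * (real K * ?Ln)) / (exp l - 1) \<le> l ^ K / fact K / (exp l - 1)"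
      using exp_l by (intro divide_right_mono) auto
    then show ?thesis by (simp add: prior_K_def mult.commute)
  qed
  have D_lower: "exp (- 3 * (real K * ?Ln)) \<le> 1 / real (partitioning_number p n x C S K)"
  proof -
    have fin: "finite ?V" using V by (intro finite_valid_trees)
    have "partitioning_number p n x C S K \<le> card ?V"
      unfolding partitioning_number_def by (rule card_image_le[OF fin])
    also have "\<dots> \<le> n ^ (3 * K)" by (rule card_valid_trees[OF C n0])
    finally have "real (partitioning_number p n x C S K) \<le> real (n ^ (3 * K))" by (simp only: of_nat_le_iff)
    also have "\<dots> = exp (real (3 * K) * ?Ln)" using n0 by (simp only: exp_of_nat_mult) simp
    finally have "real (partitioning_number p n x C S K) \<le> exp (3 * (real K * ?Ln))" by (simp add: mult.assoc)
    moreover have "0 < partitioning_number p n x C S K"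
      unfolding partitioning_number_def using T0 fin by (auto simp: card_gt_0_iff)
    ultimately have "1 / exp (3 * (real K * ?Ln)) \<le> 1 / real (partitioning_number p n x C S K)"
      by (intro divide_left_mono) auto
    then show ?thesis by (simp add: exp_minus divide_inverse)
  qed
  have "exp (- (\<bar>ln c\<bar> + a + \<bar>ln l\<bar> + 5) * complexity p n S K)
    \<le> exp (- (\<bar>ln c\<bar> + a) * (real q * ?Lp) + - (real q * ?Lp) + - (\<bar>ln l\<bar> + 1) * (real K * ?Ln) + - 3 * (real K * ?Ln))"
  proof -
    have "0 \<le> (\<bar>ln l\<bar> + 4) * (real q * ?Lp)" "0 \<le> (\<bar>ln c\<bar> + a + 1) * (real K * ?Ln)"
      using hyperparameters qLp KLn by (auto intro!: mult_nonneg_nonneg)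
    then show ?thesis unfolding complexity_def q_def[symmetric] by (simp add: algebra_simps)
  qed
  also have "\<dots> = exp (- (\<bar>ln c\<bar> + a) * (real q * ?Lp)) * exp (- (real q * ?Lp)) * exp (- (\<bar>ln l\<bar> + 1) * (real K * ?Ln)) * exp (- 3 * (real K * ?Ln))"
    by (simp only: exp_add)
  finally have "exp (- (\<bar>ln c\<bar> + a + \<bar>ln l\<bar> + 5) * complexity p n S K) / (2 * (exp l - 1))
    \<le> exp (- (\<bar>ln c\<bar> + a) * (real q * ?Lp)) * exp (- (real q * ?Lp)) * exp (- (\<bar>ln l\<bar> + 1) * (real K * ?Ln)) * exp (- 3 * (real K * ?Ln)) / (2 * (exp l - 1))"
    using exp_l by (intro divide_right_mono) auto
  also have "\<dots> = (exp (- (\<bar>ln c\<bar> + a) * (real q * ?Lp)) / 2) * exp (- (real q * ?Lp)) * (exp (- (\<bar>ln l\<bar> + 1) * (real K * ?Ln)) / (exp l - 1)) * exp (- 3 * (real K * ?Ln))"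
    by simp
  also have "\<dots> \<le> prior_q p a c q * prior_S p S * prior_K l K * (1 / real (partitioning_number p n x C S K))"
    using prior_factors_nonneg exp_l
    by (intro mult_mono q_lower S_lower K_lower D_lower mult_nonneg_nonneg) (auto intro!: divide_nonneg_nonneg)
  finally show ?thesis unfolding eq .
qed

end

section \<open>Noise level and evidence\<close>

context tree_regression
begin

text \<open>
  The tail bound \<open>exp (- t / 4)\<close> at this level is \<open>p powr (- 6 * card S) * n powr (- 6 * K) * exp (- R)\<close>, which is
  summable over all \<open>S\<close> and \<open>K\<close> and the at most \<open>n ^ (3 * K)\<close> trees.
\<close>

definition noise_level :: "real \<Rightarrow> nat set \<Rightarrow> nat \<Rightarrow> real" where
  "noise_level R S K = 24 * complexity p n S K + 4 * R"

definition low_noise :: "(point \<Rightarrow> real) \<Rightarrow> real \<Rightarrow> (nat \<Rightarrow> real) \<Rightarrow> bool" where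
  "low_noise f0 R y \<longleftrightarrow> (\<forall>S K T. (S, K, T) \<in> indices \<longrightarrow> noise_energy n x f0 T y \<le> noise_level R S K)"

lemma not_low_noise_eq:
  "{y \<in> space (data_law n x f0). \<not> low_noise f0 R y}
    = (\<Union>(S, K, T)\<in>indices. {y \<in> space (data_law n x f0). noise_level R S K < noise_energy n x f0 T y})"
  unfolding low_noise_def not_all not_imp not_le by blast

lemma low_noise_measurable: "{y \<in> space (data_law n x f0). \<not> low_noise f0 R y} \<in> sets (data_law n x f0)"
  unfolding not_low_noise_eq using finite_indices by (intro sets.finite_UN) auto

lemma low_noise_prob:
  "emeasure (data_law n x f0) {y \<in> space (data_law n x f0). \<not> low_noise f0 R y} \<le> ennreal (2 * exp (- R))"
proof -
  let ?P = "data_law n x f0" and ?Lp = "ln (real p)" and ?Ln = "ln (real n)"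
  \<comment> \<open>Of the tail factor \<open>n powr (- 6 * K)\<close>, the power
    \<open>2 ^ K\<close> uses up one \<open>n ^ K\<close> and the count of trees three. The
    remaining \<open>n powr (- 2 * K)\<close> is at most \<open>n powr (- 2)\<close>, which pays for
    the sum over \<open>K \<le> n\<close>.\<close>
  have step: "2 ^ K * exp (- noise_level R S K / 4) * real (card (valid_trees p n x C S K))
      \<le> exp (- R) * (exp (- 6 * (real (card S) * ?Lp)) * exp (- 2 * ?Ln))"
    if "K \<in> {1..n}" for S K
  proof -
    have "2 ^ K * exp (- noise_level R S K / 4) * real (card (valid_trees p n x C S K))
      \<le> exp (real K * ?Ln) * exp (- noise_level R S K / 4) * exp (real (3 * K) * ?Ln)"
    proof (intro mult_mono)
      have "2 ^ K \<le> real n ^ K" using n by (intro power_mono) auto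
      then show "2 ^ K \<le> exp (real K * ?Ln)" using n0 by (simp add: exp_of_nat_mult)
      have "real (card (valid_trees p n x C S K)) \<le> real (n ^ (3 * K))"
        using card_valid_trees[OF C n0] by (simp only: of_nat_le_iff)
      then show "real (card (valid_trees p n x C S K)) \<le> exp (real (3 * K) * ?Ln)"
        unfolding exp_of_nat_mult using n0 by simp
    qed auto
    also have "\<dots> = exp (real K * ?Ln - noise_level R S K / 4 + real (3 * K) * ?Ln)"
      by (simp flip: exp_add)
    also have "\<dots> \<le> exp (- R + (- 6 * (real (card S) * ?Lp) + - 2 * ?Ln))"
    proof -
      have "1 * ?Ln \<le> real K * ?Ln" using that ln_n by (intro mult_right_mono) auto
      then show ?thesis by (simp add: noise_level_def complexity_def algebra_simps)
    qed
    also have "\<dots> = exp (- R) * (exp (- 6 * (real (card S) * ?Lp)) * exp (- 2 * ?Ln))"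
      by (simp only: exp_add)
    finally show ?thesis .
  qed
  have "emeasure ?P {y \<in> space ?P. \<not> low_noise f0 R y}
    \<le> (\<Sum>i\<in>indices. emeasure ?P (case i of (S, K, T) \<Rightarrow> {y \<in> space ?P. noise_level R S K < noise_energy n x f0 T y}))"
    unfolding not_low_noise_eq using finite_indices by (intro emeasure_subadditive_finite) auto
  also have "\<dots> \<le> (\<Sum>i\<in>indices. ennreal (case i of (S, K, T) \<Rightarrow> 2 ^ K * exp (- noise_level R S K / 4)))"
    using noise_energy_tail[OF C n0 _ design] by (intro sum_mono) (auto simp: tree_indices_def)
  also have "\<dots> = ennreal (\<Sum>i\<in>indices. case i of (S, K, T) \<Rightarrow> 2 ^ K * exp (- noise_level R S K / 4))"
    by (intro sum_ennreal) auto
  also have "(\<Sum>i\<in>indices. case i of (S, K, T) \<Rightarrow> 2 ^ K * exp (- noise_level R S K / 4))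
    = (\<Sum>S\<in>Pow {1..p}. \<Sum>K\<in>{1..n}. 2 ^ K * exp (- noise_level R S K / 4) * real (card (valid_trees p n x C S K)))"
    by (subst sum_tree_indices[OF C n0]) (simp add: mult.commute)
  also have "\<dots> \<le> (\<Sum>S\<in>Pow {1..p}. \<Sum>K\<in>{1..n}. exp (- R) * (exp (- 6 * (real (card S) * ?Lp)) * exp (- 2 * ?Ln)))"
    by (intro sum_mono step)
  also have "\<dots> = exp (- R) * ((\<Sum>S\<in>Pow {1..p}. exp (- 6 * (real (card S) * ?Lp))) * (real n * exp (- 2 * ?Ln)))"
    by (simp add: sum_distrib_left sum_distrib_right mult_ac)
  also have "\<dots> \<le> exp (- R) * (2 * 1)"
  proof (intro mult_left_mono mult_mono)
    have "real (p choose q) * exp (- 6 * (real q * ?Lp)) \<le> (1 / 2) ^ q" if "q \<in> {0..p}" for q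
    proof -
      have "real (p choose q) \<le> real (p ^ q)" using binomial_le_pow[of q p] that by (simp only: of_nat_le_iff) auto
      also have "\<dots> = exp (real q * ?Lp)" using p by (simp add: exp_of_nat_mult)
      finally have "real (p choose q) * exp (- 6 * (real q * ?Lp)) \<le> exp (real q * ?Lp) * exp (- 6 * (real q * ?Lp))"
        by (intro mult_right_mono) auto
      also have "\<dots> = exp (real q * (- 5 * ?Lp))" by (simp add: algebra_simps flip: exp_add)
      also have "\<dots> \<le> exp (real q * (- ?Lp))" using ln_p by (intro iffD2[OF exp_le_cancel_iff] mult_left_mono) auto
      also have "\<dots> = (inverse (real p)) ^ q" unfolding exp_of_nat_mult using p by (simp add: exp_minus)
      also have "\<dots> \<le> (1 / 2) ^ q" using p by (intro power_mono) (auto simp: field_simps)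
      finally show ?thesis .
    qed
    then have "(\<Sum>q\<in>{0..p}. real (p choose q) * exp (- 6 * (real q * ?Lp))) \<le> (\<Sum>q\<in>{0..p}. (1 / 2) ^ q)"
      by (intro sum_mono) auto
    also have "\<dots> \<le> 2" by (intro sum_half_powers_le_2) auto
    finally show "(\<Sum>S\<in>Pow {1..p}. exp (- 6 * (real (card S) * ?Lp))) \<le> 2"
      using sum_Pow_card[of "\<lambda>q. exp (- 6 * (real q * ?Lp))" p] by simp
    have "real n * exp (- 2 * ?Ln) = exp (?Ln + - 2 * ?Ln)" unfolding exp_add using n0 by simp
    also have "\<dots> \<le> 1" using ln_n by simp
    finally show "real n * exp (- 2 * ?Ln) \<le> 1" .
  qed (auto intro: sum_nonneg)
  finally show ?thesis by (simp add: ennreal_leI mult.commute)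
qed

section \<open>Integrated likelihood of a single tree\<close>

abbreviation marginal :: "(point \<Rightarrow> real) \<Rightarrow> partition \<Rightarrow> (nat \<Rightarrow> real) \<Rightarrow> ennreal" where
  "marginal f0 T y \<equiv> (\<integral>\<^sup>+ \<beta>. ennreal (likelihood_ratio n x f0 y (step_fun p T \<beta>)) \<partial>height_law T)"

lemma likelihood_ratio_measurable:
  "(\<lambda>f. likelihood_ratio n x f0 y f) \<in> borel_measurable (tree_fun_space p n x C)"
proof -
  have m: "(\<lambda>f. f (x i)) \<in> borel_measurable (tree_fun_space p n x C)" if "i \<in> {1..n}" for i
    using measurable_eval design[OF that] by blast
  show ?thesis
    unfolding likelihood_ratio_def squared_gap_def
    by (rule measurable_compose[OF _ borel_measurable_exp])
      (intro borel_measurable_diff borel_measurable_sum borel_measurable_times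
        borel_measurable_divide borel_measurable_power m borel_measurable_const, auto)
qed

lemma likelihood_ratio_measurable_pair:
  assumes "(S, K, T) \<in> indices"
  shows "(\<lambda>(y, \<beta>). ennreal (likelihood_ratio n x f0 y (step_fun p T \<beta>)))
    \<in> borel_measurable (data_law n x f0 \<Otimes>\<^sub>M height_law T)"
proof -
  let ?PH = "data_law n x f0 \<Otimes>\<^sub>M height_law T"
  have m1: "(\<lambda>z. step_fun p T (snd z) (x i)) \<in> borel_measurable ?PH" if "i \<in> {1..n}" for i
    by (rule measurable_compose[OF measurable_compose[OF measurable_snd measurable_step_fun[OF assms]] measurable_eval[OF design[OF that]]])
  have m2: "(\<lambda>z. fst z i) \<in> borel_measurable ?PH" if "i \<in> {1..n}" for i
    by (rule measurable_compose[OF measurable_fst measurable_datum[OF that]])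
  have "(\<lambda>z. likelihood_ratio n x f0 (fst z) (step_fun p T (snd z))) \<in> borel_measurable ?PH"
    unfolding likelihood_ratio_def squared_gap_def
    by (rule measurable_compose[OF _ borel_measurable_exp])
      (intro borel_measurable_diff borel_measurable_sum borel_measurable_times
        borel_measurable_divide borel_measurable_power m1 m2 borel_measurable_const, auto)
  then show ?thesis by (simp add: case_prod_beta')
qed

lemma marginal_measurable:
  assumes "(S, K, T) \<in> indices"
  shows "marginal f0 T \<in> borel_measurable (data_law n x f0)"
proof -
  interpret H: prob_space "height_law T" by (rule prob_space_height_law)
  show ?thesis by (rule H.borel_measurable_nn_integral[OF likelihood_ratio_measurable_pair[OF assms]])
qed

text \<open>Each fixed step function has a ratio of mean one, and averaging over the heights keeps
  this. No bound on the noise is involved, so it serves for trees of any complexity.\<close>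

lemma expectation_marginal:
  assumes "(S, K, T) \<in> indices"
  shows "(\<integral>\<^sup>+ y. marginal f0 T y \<partial>data_law n x f0) = 1"
proof -
  interpret H: prob_space "height_law T" by (rule prob_space_height_law)
  interpret P: prob_space "data_law n x f0" by (rule prob_space_data_law)
  interpret PH: pair_sigma_finite "data_law n x f0" "height_law T" ..
  have "(\<integral>\<^sup>+ y. marginal f0 T y \<partial>data_law n x f0)
    = (\<integral>\<^sup>+ \<beta>. \<integral>\<^sup>+ y. ennreal (likelihood_ratio n x f0 y (step_fun p T \<beta>)) \<partial>data_law n x f0 \<partial>height_law T)"
    by (rule PH.Fubini'[symmetric]) (rule likelihood_ratio_measurable_pair[OF assms])
  then show ?thesis by (simp add: expectation_likelihood_ratio H.emeasure_space_1)
qed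

text \<open>The interval stays within distance \<open>B + 1\<close> of the origin, where the density
  is at least its value at \<open>B + 1\<close>.\<close>

lemma std_normal_interval:
  assumes B: "\<bar>u\<bar> \<le> B" and \<rho>: "0 \<le> \<rho>" "\<rho> \<le> 1"
  shows "ennreal (2 * \<rho> * (exp (- (B + 1)\<^sup>2 / 2) / sqrt (2 * pi))) \<le> emeasure std_normal {u - \<rho>..u + \<rho>}"
proof -
  let ?m = "exp (- (B + 1)\<^sup>2 / 2) / sqrt (2 * pi)"
  have "ennreal (2 * \<rho> * ?m) = ennreal ?m * ennreal (2 * \<rho>)"
    using \<rho> by (subst mult.commute, intro ennreal_mult) auto
  also have "\<dots> = (\<integral>\<^sup>+ v. ennreal ?m * indicator {u - \<rho>..u + \<rho>} v \<partial>lborel)"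
    using \<rho> by (subst nn_integral_cmult_indicator) (auto simp: emeasure_lborel_Icc)
  also have "\<dots> \<le> (\<integral>\<^sup>+ v. ennreal (std_normal_density v) * indicator {u - \<rho>..u + \<rho>} v \<partial>lborel)"
  proof (intro nn_integral_mono)
    fix v :: real
    show "ennreal ?m * indicator {u - \<rho>..u + \<rho>} v \<le> ennreal (std_normal_density v) * indicator {u - \<rho>..u + \<rho>} v"
    proof (cases "v \<in> {u - \<rho>..u + \<rho>}")
      case True
      then have "\<bar>v\<bar> \<le> \<bar>B + 1\<bar>" using B \<rho> by auto
      then have "v\<^sup>2 \<le> (B + 1)\<^sup>2" by (simp only: abs_le_square_iff)
      then have "?m \<le> exp (- v\<^sup>2 / 2) / sqrt (2 * pi)" by (intro divide_right_mono) auto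
      then show ?thesis by (intro mult_right_mono ennreal_leI) (auto simp: std_normal_density_def)
    qed auto
  qed
  also have "\<dots> = emeasure std_normal {u - \<rho>..u + \<rho>}" by (subst emeasure_density) auto
  finally show ?thesis .
qed

text \<open>The radius \<open>1 / sqrt n\<close> adds at most a constant to the squared gap, and
  each height costs only a factor polynomial in \<open>n\<close>, because the centres are of order
  \<open>sqrt (ln n)\<close>.\<close>

lemma height_box_prob:
  assumes T: "finite T" "card T = K"
    and b: "\<And>\<Omega>. \<Omega> \<in> T \<Longrightarrow> \<bar>b \<Omega>\<bar> \<le> c2 * sqrt (ln (real n))"
  shows "ennreal (exp (- (c2\<^sup>2 + 3) * (real K * ln (real n))))
    \<le> emeasure (height_law T) {\<beta> \<in> space (height_law T). \<forall>\<Omega>\<in>T. \<bar>\<beta> \<Omega> - b \<Omega>\<bar> \<le> 1 / sqrt (real n)}"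
proof -
  let ?\<rho> = "1 / sqrt (real n)" and ?L = "ln (real n)" and ?B = "c2 * sqrt (ln (real n))"
  interpret U1: prob_space std_normal by (rule prob_space_std_normal)
  interpret U: product_sigma_finite "\<lambda>_ :: cell. std_normal"
    by (intro product_sigma_finite.intro) (rule U1.sigma_finite_measure_axioms)
  have \<rho>: "0 \<le> ?\<rho>" "?\<rho> \<le> 1" using n by auto
  have single: "exp (- (c2\<^sup>2 + 3) * ?L) \<le> 2 * ?\<rho> * (exp (- (?B + 1)\<^sup>2 / 2) / sqrt (2 * pi))"
  proof -
    have "sqrt (2 * pi) \<le> sqrt 16" using pi_less_4 by (intro real_sqrt_le_mono) simp
    then have s4: "sqrt (2 * pi) \<le> 4" by simp
    \<comment> \<open>Origin of \<open>c2\<^sup>2 + 3\<close>: one \<open>ln n\<close> beats the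
      factor 1/2, half a \<open>ln n\<close> is the radius, and \<open>c2\<^sup>2 * ln n + 1\<close>
      comes from the density; \<open>1 \<le> ln n\<close> absorbs the rest.\<close>
    have "exp (- ?L) * exp (- (?L / 2)) * exp (- (?B\<^sup>2 + 1)) \<le> (1 / 2) * ?\<rho> * exp (- (?B + 1)\<^sup>2 / 2)"
    proof (intro mult_mono)
      show "exp (- ?L) \<le> 1 / 2" using n by (simp add: exp_minus field_simps)
      have "exp (?L / 2) = sqrt (real n)" using n0 by (simp add: ln_sqrt[symmetric])
      then show "exp (- (?L / 2)) \<le> ?\<rho>" by (simp only: exp_minus inverse_eq_divide order_refl)
      have "0 \<le> (?B - 1)\<^sup>2" by simp
      then have "(?B + 1)\<^sup>2 / 2 \<le> ?B\<^sup>2 + 1" by (simp add: power2_eq_square algebra_simps)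
      then show "exp (- (?B\<^sup>2 + 1)) \<le> exp (- (?B + 1)\<^sup>2 / 2)" by simp
    qed auto
    also have "\<dots> = 2 * ?\<rho> * (exp (- (?B + 1)\<^sup>2 / 2) / 4)" by simp
    also have "\<dots> \<le> 2 * ?\<rho> * (exp (- (?B + 1)\<^sup>2 / 2) / sqrt (2 * pi))"
      using s4 by (intro mult_left_mono divide_left_mono) auto
    finally have "exp (- ?L + - (?L / 2) + - (?B\<^sup>2 + 1)) \<le> 2 * ?\<rho> * (exp (- (?B + 1)\<^sup>2 / 2) / sqrt (2 * pi))"
      by (simp only: exp_add)
    moreover have "exp (- (c2\<^sup>2 + 3) * ?L) \<le> exp (- ?L + - (?L / 2) + - (?B\<^sup>2 + 1))"
      using ln_n by (simp add: power_mult_distrib algebra_simps)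
    ultimately show ?thesis by linarith
  qed
  have "ennreal (exp (- (c2\<^sup>2 + 3) * (real K * ?L))) = (\<Prod>\<Omega>\<in>T. ennreal (exp (- (c2\<^sup>2 + 3) * ?L)))"
    using T by (simp add: ennreal_power exp_of_nat_mult[symmetric] mult_ac)
  also have "\<dots> \<le> (\<Prod>\<Omega>\<in>T. emeasure std_normal {b \<Omega> - ?\<rho>..b \<Omega> + ?\<rho>})"
    by (intro prod_mono_ennreal order_trans[OF ennreal_leI[OF single] std_normal_interval] b \<rho>)
  also have "\<dots> = emeasure (height_law T) (\<Pi>\<^sub>E \<Omega>\<in>T. {b \<Omega> - ?\<rho>..b \<Omega> + ?\<rho>})"
    by (rule U.emeasure_PiM[symmetric]) (use T in auto)
  also have "(\<Pi>\<^sub>E \<Omega>\<in>T. {b \<Omega> - ?\<rho>..b \<Omega> + ?\<rho>}) = {\<beta> \<in> space (height_law T). \<forall>\<Omega>\<in>T. \<bar>\<beta> \<Omega> - b \<Omega>\<bar> \<le> ?\<rho>}"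
    by (auto simp: space_PiM PiE_def Pi_def abs_le_iff algebra_simps)
  finally show ?thesis .
qed

end

text \<open>Losses in units of \<open>R\<close>, for complexity \<open>C1 * R\<close> and total
  squared bias \<open>C2 * R\<close>: the prior mass and the height box (5 and
  \<open>c2\<^sup>2 + 3\<close>) times \<open>C1\<close>; the noise term, with level
  \<open>24 * C1 + 4\<close> and squared gap \<open>2 * C2 + 2\<close>; and half of that
  gap.\<close>

definition evidence_exponent :: "real \<Rightarrow> real \<Rightarrow> real \<Rightarrow> real \<Rightarrow> real \<Rightarrow> real \<Rightarrow> real" where
  "evidence_exponent a c l c2 C1 C2 =
     (\<bar>ln c\<bar> + a + \<bar>ln l\<bar> + 8 + c2\<^sup>2) * C1 + sqrt ((24 * C1 + 4) * (2 * C2 + 2)) + C2 + 1"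

context tree_regression
begin

lemma marginal_lower:
  assumes idx: "(S, K, T) \<in> indices" and noise: "noise_energy n x f0 T y \<le> t"
    and b: "\<And>\<Omega>. \<Omega> \<in> T \<Longrightarrow> \<bar>b \<Omega>\<bar> \<le> c2 * sqrt (ln (real n))"
    and approx: "\<And>\<Omega> i. \<Omega> \<in> T \<Longrightarrow> i \<in> {1..n} \<Longrightarrow> x i \<in> \<Omega> \<Longrightarrow> \<bar>f0 (x i) - b \<Omega>\<bar> \<le> \<delta>"
    and \<delta>: "0 \<le> \<delta>" "real n * \<delta>\<^sup>2 \<le> g"
  shows "ennreal (exp (- (c2\<^sup>2 + 3) * (real K * ln (real n)) - (sqrt (t * (2 * g + 2)) + g + 1))) \<le> marginal f0 T y"
proof -
  have T: "T \<in> valid_trees p n x C S K" using idx by (auto simp: tree_indices_def)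
  note V = valid_trees_partition[OF T C n0]
  let ?box = "{\<beta> \<in> space (height_law T). \<forall>\<Omega>\<in>T. \<bar>\<beta> \<Omega> - b \<Omega>\<bar> \<le> 1 / sqrt (real n)}"
  let ?m = "sqrt (t * (2 * g + 2)) + g + 1"
  have box_meas: "?box \<in> sets (height_law T)"
  proof -
    have "{\<beta> \<in> space (height_law T). \<bar>\<beta> \<Omega> - b \<Omega>\<bar> \<le> 1 / sqrt (real n)} \<in> sets (height_law T)" if "\<Omega> \<in> T" for \<Omega>
    proof -
      have "(\<lambda>\<beta>. \<bar>\<beta> \<Omega> - b \<Omega>\<bar>) \<in> borel_measurable (height_law T)"
        using measurable_height[OF that] by (intro borel_measurable_abs borel_measurable_diff) auto
      then show ?thesis by (rule borel_measurable_le) auto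
    qed
    then show ?thesis using V(3) by (intro sets.sets_Collect_finite_All) auto
  qed
  have ratio: "exp (- ?m) \<le> likelihood_ratio n x f0 y (step_fun p T \<beta>)" if \<beta>: "\<beta> \<in> ?box" for \<beta>
  proof -
    let ?G = "squared_gap n x f0 (step_fun p T \<beta>)" and ?Q = "noise_energy n x f0 T y"
    \<comment> \<open>\<open>2 * \<delta>\<^sup>2\<close> is the bias and \<open>2 / n\<close> the
      box radius, by \<open>(u + v)\<^sup>2 \<le> 2 * u\<^sup>2 + 2 * v\<^sup>2\<close>; summation
      over the design gives at most \<open>2 * g + 2\<close>.\<close>
    have "?G \<le> (\<Sum>i\<in>{1..n}. 2 * \<delta>\<^sup>2 + 2 / real n)"
      unfolding squared_gap_def
    proof (intro sum_mono)
      fix i assume i: "i \<in> {1..n}"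
      obtain \<Omega> where \<Omega>: "\<Omega> \<in> T" "x i \<in> \<Omega>"
        using design_cell[OF C n0 T design i] by blast
      have "\<bar>step_fun p T \<beta> (x i) - f0 (x i)\<bar> = \<bar>(\<beta> \<Omega> - b \<Omega>) - (f0 (x i) - b \<Omega>)\<bar>"
        using step_fun_on_cell[OF V(1,3) \<Omega>] by simp
      also have "\<dots> \<le> 1 / sqrt (real n) + \<delta>"
      proof -
        have "\<bar>\<beta> \<Omega> - b \<Omega>\<bar> \<le> 1 / sqrt (real n)" using \<beta> \<Omega> by blast
        then show ?thesis
          using approx[OF \<Omega>(1) i \<Omega>(2)] abs_triangle_ineq4[of "\<beta> \<Omega> - b \<Omega>" "f0 (x i) - b \<Omega>"] by linarith
      qed
      finally have "\<bar>step_fun p T \<beta> (x i) - f0 (x i)\<bar>\<^sup>2 \<le> (1 / sqrt (real n) + \<delta>)\<^sup>2"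
        by (intro power_mono) auto
      also have "\<dots> \<le> 2 * (1 / sqrt (real n))\<^sup>2 + 2 * \<delta>\<^sup>2"
        using zero_le_power2[of "1 / sqrt (real n) - \<delta>"] unfolding power2_sum power2_diff by linarith
      also have "\<dots> = 2 * \<delta>\<^sup>2 + 2 / real n" by (simp add: power_divide)
      finally show "(step_fun p T \<beta> (x i) - f0 (x i))\<^sup>2 \<le> 2 * \<delta>\<^sup>2 + 2 / real n" by simp
    qed
    also have "\<dots> = 2 * (real n * \<delta>\<^sup>2) + 2" using n0 by (simp add: algebra_simps)
    also have "\<dots> \<le> 2 * g + 2" using \<delta> by simp
    finally have G: "?G \<le> 2 * g + 2" .
    have G0: "0 \<le> ?G" "0 \<le> ?Q" unfolding squared_gap_def noise_energy_def by (auto intro!: sum_nonneg)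
    have "?Q * ?G \<le> t * (2 * g + 2)" using G G0 noise by (intro mult_mono) auto
    then have "sqrt (?Q * ?G) \<le> sqrt (t * (2 * g + 2))" by (rule real_sqrt_le_mono)
    then have "- sqrt (t * (2 * g + 2)) \<le> (\<Sum>i\<in>{1..n}. (step_fun p T \<beta> (x i) - f0 (x i)) * (y i - f0 (x i)))"
      using noise_inner_product_bound[OF C n0 T design, of \<beta> f0 y] by linarith
    then show ?thesis unfolding likelihood_ratio_def using G by simp
  qed
  have "ennreal (exp (- (c2\<^sup>2 + 3) * (real K * ln (real n)) - ?m))
    = ennreal (exp (- ?m)) * ennreal (exp (- (c2\<^sup>2 + 3) * (real K * ln (real n))))"
    by (simp only: ennreal_mult'[symmetric] exp_ge_zero mult_exp_exp) (simp add: algebra_simps)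
  also have "\<dots> \<le> ennreal (exp (- ?m)) * emeasure (height_law T) ?box"
    by (intro mult_left_mono height_box_prob[OF V(3) V(2)] b) auto
  also have "\<dots> = (\<integral>\<^sup>+ \<beta>. ennreal (exp (- ?m)) * indicator ?box \<beta> \<partial>height_law T)"
    using box_meas by (subst nn_integral_cmult_indicator) auto
  also have "\<dots> \<le> marginal f0 T y"
  proof (intro nn_integral_mono)
    fix \<beta>
    show "ennreal (exp (- ?m)) * indicator ?box \<beta> \<le> ennreal (likelihood_ratio n x f0 y (step_fun p T \<beta>))"
      using ratio[of \<beta>] by (cases "\<beta> \<in> ?box") (auto intro: ennreal_leI simp del: ennreal_le_iff)
  qed
  finally show ?thesis .
qed

section \<open>Evidence and posterior\<close>

abbreviation "tree_law \<equiv> prior p n x C a c l \<pi>"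

lemma evidence_eq:
  "(\<integral>\<^sup>+ f. ennreal (likelihood_ratio n x f0 y f) \<partial>tree_law)
    = (\<Sum>(S, K, T)\<in>indices. ennreal (weight (S, K, T)) * marginal f0 T y)"
  by (rule nn_integral_prior[OF finite_indices]) (use likelihood_ratio_measurable in measurable)

text \<open>The prior mass of \<open>T0\<close> itself may be zero, so every tree with the same
  trace has to contribute. Approximation matters at the design points only, and low noise covers all
  trees at once, so the same bound holds for each of them.\<close>

lemma evidence_lower:
  assumes idx: "(S, K, T0) \<in> indices" and noise: "low_noise f0 R y" and R: "1 \<le> R"
    and b: "\<And>\<Omega>. \<Omega> \<in> T0 \<Longrightarrow> \<bar>b \<Omega>\<bar> \<le> c2 * sqrt (ln (real n))"
    and approx: "\<And>\<Omega> i. \<Omega> \<in> T0 \<Longrightarrow> i \<in> {1..n} \<Longrightarrow> x i \<in> \<Omega> \<Longrightarrow> \<bar>f0 (x i) - b \<Omega>\<bar> \<le> \<delta>"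
    and \<delta>: "0 \<le> \<delta>" "real n * \<delta>\<^sup>2 \<le> C2 * R"
    and complexity: "complexity p n S K \<le> C1 * R"
  shows "ennreal (exp (- evidence_exponent a c l c2 C1 C2 * R) / (2 * (exp l - 1)))
    \<le> (\<integral>\<^sup>+ f. ennreal (likelihood_ratio n x f0 y f) \<partial>tree_law)"
proof -
  let ?V = "valid_trees p n x C S K" and ?X = "x ` {1..n}"
  let ?class = "{T\<in>?V. induced_partition n x T = induced_partition n x T0}"
  let ?t = "(24 * C1 + 4) * R"
  define m where "m = exp (- (c2\<^sup>2 + 3) * (real K * ln (real n)) - (sqrt (?t * (2 * (C2 * R) + 2)) + C2 * R + 1))"
  have V: "T0 \<in> ?V" "S \<subseteq> {1..p}" "1 \<le> K" using idx by (auto simp: tree_indices_def)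
  have fin: "finite ?V" using V finite_subset by (intro finite_valid_trees) auto
  have C2: "0 \<le> C2"
  proof -
    have "0 \<le> C2 * R" using \<delta> by (meson mult_nonneg_nonneg of_nat_0_le_iff order_trans zero_le_power2)
    then show ?thesis using R by (simp add: zero_le_mult_iff)
  qed
  have comp0: "0 \<le> complexity p n S K" "real K * ln (real n) \<le> complexity p n S K"
    using ln_p ln_n by (auto simp: complexity_def)
  have C1: "0 \<le> C1"
  proof -
    have "0 \<le> C1 * R" using comp0 complexity by linarith
    then show ?thesis using R by (simp add: zero_le_mult_iff)
  qed
  have marg: "ennreal m \<le> marginal f0 T y" if T: "T \<in> ?class" for T
  proof -
    \<comment> \<open>Cells of \<open>T\<close> and \<open>T0\<close> are matched by their design
      points, and the heights \<open>b\<close> are carried over along this matching.\<close>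
    define r where "r \<Omega> = (SOME \<Omega>0. \<Omega>0 \<in> T0 \<and> \<Omega> \<inter> ?X = \<Omega>0 \<inter> ?X)" for \<Omega>
    have r: "r \<Omega> \<in> T0 \<and> \<Omega> \<inter> ?X = r \<Omega> \<inter> ?X" if "\<Omega> \<in> T" for \<Omega>
    proof -
      have "\<Omega> \<inter> ?X \<in> induced_partition n x T" using that by (auto simp: induced_partition_def)
      then have "\<exists>\<Omega>0. \<Omega>0 \<in> T0 \<and> \<Omega> \<inter> ?X = \<Omega>0 \<inter> ?X" using T by (auto simp: induced_partition_def)
      then show ?thesis unfolding r_def by (rule someI_ex)
    qed
    have idxT: "(S, K, T) \<in> indices" using T V by (auto simp: tree_indices_def)
    have "noise_level R S K \<le> ?t" using complexity by (simp add: noise_level_def algebra_simps)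
    then have "noise_energy n x f0 T y \<le> ?t" using noise idxT unfolding low_noise_def by fastforce
    then show ?thesis
      unfolding m_def
    proof (rule marginal_lower[OF idxT])
      show "\<bar>b (r \<Omega>)\<bar> \<le> c2 * sqrt (ln (real n))" if "\<Omega> \<in> T" for \<Omega> using b r that by blast
      show "\<bar>f0 (x i) - b (r \<Omega>)\<bar> \<le> \<delta>" if "\<Omega> \<in> T" "i \<in> {1..n}" "x i \<in> \<Omega>" for \<Omega> i
      proof -
        have "x i \<in> r \<Omega>" using r[OF that(1)] that by blast
        then show ?thesis using approx r that by blast
      qed
    qed (use \<delta> in auto)
  qed
  have "exp (- evidence_exponent a c l c2 C1 C2 * R) / (2 * (exp l - 1))
    \<le> m * (exp (- (\<bar>ln c\<bar> + a + \<bar>ln l\<bar> + 5) * complexity p n S K) / (2 * (exp l - 1)))"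
  proof -
    have "sqrt (?t * (2 * (C2 * R) + 2)) \<le> sqrt (((24 * C1 + 4) * (2 * C2 + 2)) * R\<^sup>2)"
    proof (rule real_sqrt_le_mono)
      have "2 * (C2 * R) + 2 \<le> (2 * C2 + 2) * R" using R by (simp add: algebra_simps)
      then have "?t * (2 * (C2 * R) + 2) \<le> ?t * ((2 * C2 + 2) * R)" using C1 R by (intro mult_left_mono) auto
      then show "?t * (2 * (C2 * R) + 2) \<le> ((24 * C1 + 4) * (2 * C2 + 2)) * R\<^sup>2"
        by (simp add: power2_eq_square mult_ac)
    qed
    also have "\<dots> = sqrt ((24 * C1 + 4) * (2 * C2 + 2)) * R" using R by (simp add: real_sqrt_mult)
    finally have s: "sqrt (?t * (2 * (C2 * R) + 2)) \<le> sqrt ((24 * C1 + 4) * (2 * C2 + 2)) * R" .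
    have "(c2\<^sup>2 + 3) * (real K * ln (real n)) \<le> (c2\<^sup>2 + 3) * (C1 * R)"
      using comp0 complexity by (intro mult_left_mono) auto
    moreover have "(\<bar>ln c\<bar> + a + \<bar>ln l\<bar> + 5) * complexity p n S K \<le> (\<bar>ln c\<bar> + a + \<bar>ln l\<bar> + 5) * (C1 * R)"
      using complexity hyperparameters by (intro mult_left_mono) auto
    ultimately have "- evidence_exponent a c l c2 C1 C2 * R
      \<le> (- (c2\<^sup>2 + 3) * (real K * ln (real n)) - (sqrt (?t * (2 * (C2 * R) + 2)) + C2 * R + 1))
        + - (\<bar>ln c\<bar> + a + \<bar>ln l\<bar> + 5) * complexity p n S K"
      using s R unfolding evidence_exponent_def by (simp add: algebra_simps)
    then have "exp (- evidence_exponent a c l c2 C1 C2 * R) \<le> m * exp (- (\<bar>ln c\<bar> + a + \<bar>ln l\<bar> + 5) * complexity p n S K)"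
      unfolding m_def mult_exp_exp by (simp only: exp_le_cancel_iff)
    then have "exp (- evidence_exponent a c l c2 C1 C2 * R) / (2 * (exp l - 1))
      \<le> m * exp (- (\<bar>ln c\<bar> + a + \<bar>ln l\<bar> + 5) * complexity p n S K) / (2 * (exp l - 1))"
      using exp_l by (intro divide_right_mono) auto
    then show ?thesis by (simp only: times_divide_eq_right)
  qed
  also have "\<dots> \<le> m * (\<Sum>T\<in>?class. weight (S, K, T))"
    by (intro mult_left_mono class_weight_lower[OF idx]) (simp add: m_def)
  also have "\<dots> = (\<Sum>T\<in>?class. weight (S, K, T) * m)" by (simp add: sum_distrib_left mult.commute)
  finally have "ennreal (exp (- evidence_exponent a c l c2 C1 C2 * R) / (2 * (exp l - 1)))
    \<le> ennreal (\<Sum>T\<in>?class. weight (S, K, T) * m)" by (rule ennreal_leI)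
  also have "\<dots> = (\<Sum>T\<in>?class. ennreal (weight (S, K, T)) * ennreal m)"
    using weight_nonneg by (subst sum_ennreal[symmetric]) (auto simp: m_def ennreal_mult')
  also have "\<dots> \<le> (\<Sum>T\<in>?class. ennreal (weight (S, K, T)) * marginal f0 T y)"
    by (intro sum_mono mult_left_mono marg) auto
  also have "\<dots> = (\<Sum>(S, K, T)\<in>(\<lambda>T. (S, K, T)) ` ?class. ennreal (weight (S, K, T)) * marginal f0 T y)"
    by (subst sum.reindex) (auto simp: inj_on_def)
  also have "\<dots> \<le> (\<Sum>(S, K, T)\<in>indices. ennreal (weight (S, K, T)) * marginal f0 T y)"
    using V finite_indices by (intro sum_mono2) (auto simp: tree_indices_def)
  finally show ?thesis unfolding evidence_eq .
qed

text \<open>The likelihood of \<open>f0\<close> cancels between the numerator and the normalising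
  constant. Should that constant be infinite, its inverse is zero and the bound still holds.\<close>

lemma posterior_le:
  assumes ne: "indices \<noteq> {}" and F: "F \<in> sets (tree_fun_space p n x C)"
    and num: "(\<integral>\<^sup>+ f. ennreal (likelihood_ratio n x f0 y f) * indicator F f \<partial>tree_law) \<le> ennreal u"
    and den: "ennreal d \<le> (\<integral>\<^sup>+ f. ennreal (likelihood_ratio n x f0 y f) \<partial>tree_law)"
    and ud: "0 \<le> u" "0 < d"
  shows "measure (posterior n x tree_law y) F \<le> u / d"
proof -
  let ?L = "\<lambda>f. ennreal (likelihood n x y f)" and ?r = "\<lambda>f. ennreal (likelihood_ratio n x f0 y f)"
  define base where "base = likelihood n x y f0"
  have sets: "sets tree_law = sets (tree_fun_space p n x C)" by (rule sets_prior[OF ne])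
  have L0: "0 < base" unfolding base_def by (rule likelihood_pos)
  have lik: "likelihood n x y f = base * likelihood_ratio n x f0 y f" for f
    unfolding base_def by (rule likelihood_eq_ratio)
  then have L_eq: "?L f = ennreal base * ?r f" for f
    using L0 by (simp add: ennreal_mult')
  have r_meas: "?r \<in> borel_measurable tree_law"
    unfolding measurable_cong_sets[OF sets refl] using likelihood_ratio_measurable by measurable
  then have L_meas: "?L \<in> borel_measurable tree_law" unfolding L_eq by measurable
  define Z where "Z = (\<integral>\<^sup>+ f. ?L f \<partial>tree_law)"
  have "Z = ennreal base * (\<integral>\<^sup>+ f. ?r f \<partial>tree_law)"
    unfolding Z_def L_eq by (rule nn_integral_cmult[OF r_meas])
  then have Z: "ennreal (base * d) \<le> Z"
    using mult_left_mono[OF den, of "ennreal base"] L0 by (simp add: ennreal_mult')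
  have inv: "inverse Z \<le> inverse (ennreal (base * d))"
  proof (cases Z)
    case (real z)
    then have z: "base * d \<le> z" "0 < base * d" using Z L0 ud by auto
    then have "inverse Z = ennreal (inverse z)" "inverse (ennreal (base * d)) = ennreal (inverse (base * d))"
      unfolding real by (intro inverse_ennreal; linarith)+
    then show ?thesis using ennreal_leI[OF le_imp_inverse_le[OF z]] by (simp only:)
  qed auto
  have "emeasure (posterior n x tree_law y) F = (\<integral>\<^sup>+ f. ?L f / Z * indicator F f \<partial>tree_law)"
    unfolding posterior_def Z_def[symmetric] using L_meas F sets by (subst emeasure_density) auto
  also have "\<dots> \<le> (\<integral>\<^sup>+ f. ennreal (1 / d) * (?r f * indicator F f) \<partial>tree_law)"
  proof (intro nn_integral_mono)
    fix f
    have "?L f / Z \<le> ?L f / ennreal (base * d)" 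
      unfolding divide_ennreal_def by (intro mult_left_mono inv) auto
    also have "\<dots> = ennreal (base * likelihood_ratio n x f0 y f / (base * d))"
      unfolding lik using L0 ud
      by (intro divide_ennreal) (auto simp: likelihood_ratio_def)
    also have "\<dots> = ennreal (1 / d) * ?r f"
      using L0 ud by (subst ennreal_mult'[symmetric]) auto
    finally have "?L f / Z \<le> ennreal (1 / d) * ?r f" .
    then have "?L f / Z * indicator F f \<le> ennreal (1 / d) * ?r f * indicator F f" by (intro mult_right_mono) auto
    then show "?L f / Z * indicator F f \<le> ennreal (1 / d) * (?r f * indicator F f)" by (simp only: mult.assoc)
  qed
  also have "\<dots> = ennreal (1 / d) * (\<integral>\<^sup>+ f. ?r f * indicator F f \<partial>tree_law)"
    using r_meas F sets by (intro nn_integral_cmult) auto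
  also have "\<dots> \<le> ennreal (1 / d) * ennreal u" by (intro mult_left_mono num) auto
  also have "\<dots> = ennreal (u / d)" using ud by (subst ennreal_mult'[symmetric]) auto
  finally show ?thesis unfolding measure_def using ud by (intro enn2real_leI) auto
qed

definition out_of_sieve :: "real \<Rightarrow> (nat set \<times> nat \<times> partition) set" where
  "out_of_sieve B = {(S, K, T)\<in>indices. B < complexity p n S K}"

definition out_of_sieve_evidence :: "(point \<Rightarrow> real) \<Rightarrow> real \<Rightarrow> (nat \<Rightarrow> real) \<Rightarrow> ennreal" where
  "out_of_sieve_evidence f0 B y = (\<Sum>(S, K, T)\<in>out_of_sieve B. ennreal (weight (S, K, T)) * marginal f0 T y)"

lemma out_of_sieve_subset: "out_of_sieve B \<subseteq> indices"
  by (auto simp: out_of_sieve_def)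

lemma out_of_sieve_evidence_measurable:
  "out_of_sieve_evidence f0 B \<in> borel_measurable (data_law n x f0)"
proof -
  have "(\<lambda>y. ennreal (weight (S, K, T)) * marginal f0 T y) \<in> borel_measurable (data_law n x f0)"
    if "(S, K, T) \<in> out_of_sieve B" for S K T
    using that out_of_sieve_subset by (intro borel_measurable_times_ennreal marginal_measurable) auto
  then show ?thesis unfolding out_of_sieve_evidence_def[abs_def] by (intro borel_measurable_sum) auto
qed

text \<open>Since marginals have mean one, the expectation is the prior mass beyond
  \<open>B\<close>; the exponential moment of the complexity bounds it as in Chernoff's
  inequality.\<close>

lemma expectation_out_of_sieve:
  assumes d: "0 \<le> d" "d \<le> a / 2"
  shows "(\<integral>\<^sup>+ y. out_of_sieve_evidence f0 B y \<partial>data_law n x f0)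
    \<le> ennreal (exp (- d * B) * (2 * exp (l * real n powr d) / (exp l - 1)))"
proof -
  have m: "(\<lambda>y. ennreal (weight (S, K, T)) * marginal f0 T y) \<in> borel_measurable (data_law n x f0)"
    "(\<integral>\<^sup>+ y. ennreal (weight (S, K, T)) * marginal f0 T y \<partial>data_law n x f0) = ennreal (weight (S, K, T))"
    if "(S, K, T) \<in> out_of_sieve B" for S K T
  proof -
    have idx: "(S, K, T) \<in> indices" using that out_of_sieve_subset by blast
    show "(\<lambda>y. ennreal (weight (S, K, T)) * marginal f0 T y) \<in> borel_measurable (data_law n x f0)"
      by (intro borel_measurable_times_ennreal marginal_measurable[OF idx]) auto
    show "(\<integral>\<^sup>+ y. ennreal (weight (S, K, T)) * marginal f0 T y \<partial>data_law n x f0) = ennreal (weight (S, K, T))"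
      by (subst nn_integral_cmult[OF marginal_measurable[OF idx]]) (simp add: expectation_marginal[OF idx])
  qed
  have "(\<integral>\<^sup>+ y. out_of_sieve_evidence f0 B y \<partial>data_law n x f0)
    = (\<Sum>i\<in>out_of_sieve B. \<integral>\<^sup>+ y. (case i of (S, K, T) \<Rightarrow> ennreal (weight (S, K, T)) * marginal f0 T y) \<partial>data_law n x f0)"
    unfolding out_of_sieve_evidence_def using m by (intro nn_integral_sum) auto
  also have "\<dots> = (\<Sum>i\<in>out_of_sieve B. ennreal (weight i))"
    using m by (intro sum.cong) auto
  also have "\<dots> = ennreal (\<Sum>i\<in>out_of_sieve B. weight i)"
    using weight_nonneg by (intro sum_ennreal)
  also have "(\<Sum>i\<in>out_of_sieve B. weight i)
    \<le> (\<Sum>(S, K, T)\<in>out_of_sieve B. exp (- d * B) * (weight (S, K, T) * exp (d * complexity p n S K)))"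
  proof (intro sum_mono)
    fix i assume i: "i \<in> out_of_sieve B"
    obtain S K T where i_eq: "i = (S, K, T)" by (cases i)
    have "d * B \<le> d * complexity p n S K"
      using i d by (intro mult_left_mono) (auto simp: i_eq out_of_sieve_def)
    then have "1 \<le> exp (- d * B) * exp (d * complexity p n S K)" by (simp flip: exp_add)
    then have "weight i * 1 \<le> weight i * (exp (- d * B) * exp (d * complexity p n S K))"
      by (intro mult_left_mono weight_nonneg)
    then show "weight i \<le> (case i of (S, K, T) \<Rightarrow> exp (- d * B) * (weight (S, K, T) * exp (d * complexity p n S K)))"
      by (simp add: i_eq mult_ac)
  qed
  also have "\<dots> \<le> (\<Sum>(S, K, T)\<in>indices. exp (- d * B) * (weight (S, K, T) * exp (d * complexity p n S K)))"
    using finite_indices weight_nonneg by (intro sum_mono2) (auto simp: out_of_sieve_def)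
  also have "\<dots> = exp (- d * B) * (\<Sum>(S, K, T)\<in>indices. weight (S, K, T) * exp (d * complexity p n S K))"
    by (simp add: sum_distrib_left case_prod_beta')
  also have "\<dots> \<le> exp (- d * B) * (2 * exp (l * real n powr d) / (exp l - 1))"
    by (intro mult_left_mono weight_exponential_moment d) auto
  finally show ?thesis by (simp only: ennreal_leI)
qed

text \<open>Within the sieve, 16 times the noise energy is at most \<open>V\<close> and so at most
  the squared gap \<open>G\<close>; the noise term is then at most \<open>G / 4\<close> and the log
  ratio at most \<open>- G / 4\<close>. Outside the sieve the indicator of \<open>F\<close> is
  dropped.\<close>

lemma numerator_upper:
  assumes noise: "low_noise f0 R y" and F: "F \<in> sets (tree_fun_space p n x C)"
    and gap: "\<And>f. f \<in> F \<Longrightarrow> V \<le> squared_gap n x f0 f"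
    and V: "16 * (24 * B + 4 * R) \<le> V"
    and d: "0 \<le> d" "d \<le> a / 2"
  shows "(\<integral>\<^sup>+ f. ennreal (likelihood_ratio n x f0 y f) * indicator F f \<partial>tree_law)
    \<le> ennreal (exp (- V / 4) * (2 * exp (l * real n powr d) / (exp l - 1))) + out_of_sieve_evidence f0 B y"
proof -
  let ?r = "\<lambda>f. ennreal (likelihood_ratio n x f0 y f)"
  let ?in = "indices - out_of_sieve B"
  have in_sieve: "(\<integral>\<^sup>+ \<beta>. ?r (step_fun p T \<beta>) * indicator F (step_fun p T \<beta>) \<partial>height_law T) \<le> ennreal (exp (- V / 4))"
    if i: "(S, K, T) \<in> ?in" for S K T
  proof -
    interpret H: prob_space "height_law T" by (rule prob_space_height_law)
    have T: "T \<in> valid_trees p n x C S K" using i by (auto simp: tree_indices_def)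
    have "?r (step_fun p T \<beta>) * indicator F (step_fun p T \<beta>) \<le> ennreal (exp (- V / 4))" for \<beta>
    proof (cases "step_fun p T \<beta> \<in> F")
      case True
      let ?G = "squared_gap n x f0 (step_fun p T \<beta>)" and ?Q = "noise_energy n x f0 T y"
      have "?Q \<le> noise_level R S K" using noise i by (auto simp: low_noise_def)
      moreover have "complexity p n S K \<le> B" using i by (auto simp: out_of_sieve_def)
      ultimately have "16 * ?Q \<le> V" using V by (simp add: noise_level_def)
      then have Q: "?Q \<le> ?G / 16" using gap[OF True] by simp
      have G0: "0 \<le> ?G" unfolding squared_gap_def by (auto intro!: sum_nonneg)
      have "?Q * ?G \<le> (?G / 16) * ?G" using Q G0 by (intro mult_right_mono)
      also have "\<dots> = (?G / 4)\<^sup>2" by (simp add: power2_eq_square)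
      finally have "sqrt (?Q * ?G) \<le> ?G / 4" using G0 by (intro real_le_lsqrt) auto
      then have "(\<Sum>i\<in>{1..n}. (step_fun p T \<beta> (x i) - f0 (x i)) * (y i - f0 (x i))) \<le> ?G / 4"
        using noise_inner_product_bound[OF C n0 T design, of \<beta> f0 y] by linarith
      then have "likelihood_ratio n x f0 y (step_fun p T \<beta>) \<le> exp (- V / 4)"
        unfolding likelihood_ratio_def using gap[OF True] by simp
      then show ?thesis using True by (simp add: ennreal_leI)
    qed auto
    then have "(\<integral>\<^sup>+ \<beta>. ?r (step_fun p T \<beta>) * indicator F (step_fun p T \<beta>) \<partial>height_law T) \<le> (\<integral>\<^sup>+ \<beta>. ennreal (exp (- V / 4)) \<partial>height_law T)"
      by (intro nn_integral_mono)
    then show ?thesis by (simp add: H.emeasure_space_1)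
  qed
  have "(\<integral>\<^sup>+ f. ?r f * indicator F f \<partial>tree_law)
    = (\<Sum>(S, K, T)\<in>indices. ennreal (weight (S, K, T)) * (\<integral>\<^sup>+ \<beta>. ?r (step_fun p T \<beta>) * indicator F (step_fun p T \<beta>) \<partial>height_law T))"
    by (intro nn_integral_prior[OF finite_indices] borel_measurable_times_ennreal
        measurable_compose[OF likelihood_ratio_measurable measurable_ennreal] borel_measurable_indicator F)
  also have "\<dots> = (\<Sum>(S, K, T)\<in>?in. ennreal (weight (S, K, T)) * (\<integral>\<^sup>+ \<beta>. ?r (step_fun p T \<beta>) * indicator F (step_fun p T \<beta>) \<partial>height_law T))
    + (\<Sum>(S, K, T)\<in>out_of_sieve B. ennreal (weight (S, K, T)) * (\<integral>\<^sup>+ \<beta>. ?r (step_fun p T \<beta>) * indicator F (step_fun p T \<beta>) \<partial>height_law T))"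
    by (rule sum.subset_diff[OF out_of_sieve_subset finite_indices])
  also have "\<dots> \<le> ennreal (exp (- V / 4) * (2 * exp (l * real n powr d) / (exp l - 1))) + out_of_sieve_evidence f0 B y"
  proof (rule add_mono)
    have "(\<Sum>(S, K, T)\<in>?in. ennreal (weight (S, K, T)) * (\<integral>\<^sup>+ \<beta>. ?r (step_fun p T \<beta>) * indicator F (step_fun p T \<beta>) \<partial>height_law T))
      \<le> (\<Sum>(S, K, T)\<in>?in. ennreal (weight (S, K, T)) * ennreal (exp (- V / 4)))"
    proof (rule sum_mono)
      fix i assume "i \<in> ?in"
      then show "(case i of (S, K, T) \<Rightarrow> ennreal (weight (S, K, T)) * (\<integral>\<^sup>+ \<beta>. ?r (step_fun p T \<beta>) * indicator F (step_fun p T \<beta>) \<partial>height_law T))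
        \<le> (case i of (S, K, T) \<Rightarrow> ennreal (weight (S, K, T)) * ennreal (exp (- V / 4)))"
        using in_sieve by (cases i) (auto intro!: mult_left_mono)
    qed
    also have "\<dots> = ennreal (\<Sum>(S, K, T)\<in>?in. weight (S, K, T) * exp (- V / 4))"
      using weight_nonneg by (subst sum_ennreal[symmetric]) (auto simp: ennreal_mult' case_prod_beta')
    also have "\<dots> \<le> ennreal (exp (- V / 4) * (2 * exp (l * real n powr d) / (exp l - 1)))"
    proof (rule ennreal_leI)
      have "(\<Sum>(S, K, T)\<in>?in. weight (S, K, T) * exp (- V / 4)) \<le> (\<Sum>(S, K, T)\<in>indices. weight (S, K, T) * exp (- V / 4))"
        using finite_indices weight_nonneg by (intro sum_mono2) auto
      also have "\<dots> = exp (- V / 4) * (\<Sum>i\<in>indices. weight i)"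
        by (simp add: sum_distrib_left case_prod_beta' mult.commute)
      \<comment> \<open>The exponential moment also bounds the total prior mass, as the complexity
        is nonnegative.\<close>
      also have "\<dots> \<le> exp (- V / 4) * (\<Sum>(S, K, T)\<in>indices. weight (S, K, T) * exp (d * complexity p n S K))"
      proof (intro mult_left_mono sum_mono)
        fix i assume "i \<in> indices"
        obtain S K T where i_eq: "i = (S, K, T)" by (cases i)
        have "0 \<le> complexity p n S K" using ln_p ln_n by (auto simp: complexity_def)
        then have "1 \<le> exp (d * complexity p n S K)" using d by simp
        then have "weight i * 1 \<le> weight i * exp (d * complexity p n S K)" by (intro mult_left_mono weight_nonneg)
        then show "weight i \<le> (case i of (S, K, T) \<Rightarrow> weight (S, K, T) * exp (d * complexity p n S K))"
          by (simp add: i_eq)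
      qed auto
      also have "\<dots> \<le> exp (- V / 4) * (2 * exp (l * real n powr d) / (exp l - 1))"
        by (intro mult_left_mono weight_exponential_moment d) auto
      finally show "(\<Sum>(S, K, T)\<in>?in. weight (S, K, T) * exp (- V / 4)) \<le> exp (- V / 4) * (2 * exp (l * real n powr d) / (exp l - 1))" .
    qed
    finally show "(\<Sum>(S, K, T)\<in>?in. ennreal (weight (S, K, T)) * (\<integral>\<^sup>+ \<beta>. ?r (step_fun p T \<beta>) * indicator F (step_fun p T \<beta>) \<partial>height_law T))
      \<le> ennreal (exp (- V / 4) * (2 * exp (l * real n powr d) / (exp l - 1)))" .
    show "(\<Sum>(S, K, T)\<in>out_of_sieve B. ennreal (weight (S, K, T)) * (\<integral>\<^sup>+ \<beta>. ?r (step_fun p T \<beta>) * indicator F (step_fun p T \<beta>) \<partial>height_law T))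
      \<le> out_of_sieve_evidence f0 B y"
      unfolding out_of_sieve_evidence_def case_prod_beta'
      by (intro sum_mono mult_left_mono nn_integral_mono) (auto simp: indicator_def)
  qed
  finally show ?thesis .
qed

text \<open>Half of the threshold \<open>e\<close> is allotted to the trees in the sieve, where low
  noise gives a deterministic bound, and half to the others, where Markov's inequality is
  applied.\<close>

lemma posterior_tail:
  assumes ne: "indices \<noteq> {}" and F: "F \<in> sets (tree_fun_space p n x C)"
    and gap: "\<And>f. f \<in> F \<Longrightarrow> V \<le> squared_gap n x f0 f"
    and V: "16 * (24 * B + 4 * R) \<le> V"
    and d: "0 \<le> d" "d \<le> a / 2"
    and lo: "0 < lo" "\<And>y. low_noise f0 R y \<Longrightarrow> ennreal lo \<le> (\<integral>\<^sup>+ f. ennreal (likelihood_ratio n x f0 y f) \<partial>tree_law)"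
    and e: "0 < e" and W: "W = 2 * exp (l * real n powr d) / (exp l - 1)"
    and small: "exp (- V / 4) * W \<le> e / 2 * lo"
  shows "emeasure (data_law n x f0) {y \<in> space (data_law n x f0). e < measure (posterior n x tree_law y) F}
    \<le> ennreal (2 * exp (- R) + 2 / (e * lo) * (exp (- d * B) * W))"
proof -
  let ?P = "data_law n x f0" and ?out = "out_of_sieve_evidence f0 B"
  let ?bad1 = "{y \<in> space ?P. \<not> low_noise f0 R y}"
  let ?bad2 = "{y \<in> space ?P. 1 \<le> ennreal (2 / (e * lo)) * ?out y}"
  have W0: "0 \<le> W" using W exp_l by simp
  have sub: "{y \<in> space ?P. e < measure (posterior n x tree_law y) F} \<subseteq> ?bad1 \<union> ?bad2"
  proof (rule subsetI, rule ccontr)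
    fix y assume y: "y \<in> {y \<in> space ?P. e < measure (posterior n x tree_law y) F}" "y \<notin> ?bad1 \<union> ?bad2"
    then have noise: "low_noise f0 R y" and out: "ennreal (2 / (e * lo)) * ?out y < 1" by (auto simp: not_le)
    have "?out y = ennreal (e * lo / 2) * (ennreal (2 / (e * lo)) * ?out y)"
      using e lo(1) by (simp add: mult.assoc[symmetric] flip: ennreal_mult')
    also have "\<dots> \<le> ennreal (e * lo / 2) * 1" using out by (intro mult_left_mono) auto
    finally have out_le: "?out y \<le> ennreal (e * lo / 2)" by simp
    have "(\<integral>\<^sup>+ f. ennreal (likelihood_ratio n x f0 y f) * indicator F f \<partial>tree_law)
      \<le> ennreal (exp (- V / 4) * W) + ?out y"
      using numerator_upper[OF noise F gap V d] unfolding W by simp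
    also have "\<dots> \<le> ennreal (e / 2 * lo) + ennreal (e * lo / 2)"
      by (intro add_mono ennreal_leI small out_le)
    also have "\<dots> = ennreal (e * lo)" using e lo(1) by (subst ennreal_plus[symmetric]) auto
    finally have "measure (posterior n x tree_law y) F \<le> e * lo / lo"
      using e lo by (intro posterior_le[OF ne F _ lo(2)[OF noise]]) auto
    then show False using y lo(1) by simp
  qed
  have bad2: "?bad2 \<in> sets ?P"
    using out_of_sieve_evidence_measurable by measurable
  have "emeasure ?P {y \<in> space ?P. e < measure (posterior n x tree_law y) F} \<le> emeasure ?P (?bad1 \<union> ?bad2)"
    using sub bad2 low_noise_measurable by (intro emeasure_mono) auto
  also have "\<dots> \<le> emeasure ?P ?bad1 + emeasure ?P ?bad2"
    by (intro emeasure_subadditive bad2 low_noise_measurable)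
  also have "\<dots> \<le> ennreal (2 * exp (- R)) + ennreal (2 / (e * lo)) * ennreal (exp (- d * B) * W)"
  proof (intro add_mono low_noise_prob)
    have "emeasure ?P ?bad2 \<le> ennreal (2 / (e * lo)) * (\<integral>\<^sup>+ y. ?out y * indicator (space ?P) y \<partial>?P)"
      by (intro nn_integral_Markov_inequality borel_measurable_times_ennreal out_of_sieve_evidence_measurable
          borel_measurable_indicator sets.top)
    also have "(\<integral>\<^sup>+ y. ?out y * indicator (space ?P) y \<partial>?P) = (\<integral>\<^sup>+ y. ?out y \<partial>?P)"
      by (intro nn_integral_cong) auto
    also have "ennreal (2 / (e * lo)) * \<dots> \<le> ennreal (2 / (e * lo)) * ennreal (exp (- d * B) * W)"
      unfolding W by (intro mult_left_mono expectation_out_of_sieve d) auto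
    finally show "emeasure ?P ?bad2 \<le> ennreal (2 / (e * lo)) * ennreal (exp (- d * B) * W)" .
  qed
  also have "\<dots> = ennreal (2 * exp (- R) + 2 / (e * lo) * (exp (- d * B) * W))"
    using e lo(1) W0 by (subst ennreal_mult'[symmetric], simp, subst ennreal_plus[symmetric]) auto
  finally show ?thesis .
qed

end

section \<open>Contraction\<close>

text \<open>A sufficient squared radius in units of \<open>R\<close>: by the first entry it is at
  least 16 times the noise level in a sieve of complexity \<open>(l + D + 1) / d * R\<close> with
  \<open>d = min (a / 2) (1 / 3)\<close>, by the second a quarter of it covers the exponents
  \<open>l\<close>, \<open>D\<close> and a spare 1.\<close>

definition noise_exponent :: "real \<Rightarrow> real \<Rightarrow> real \<Rightarrow> real" where
  "noise_exponent a l D = max (16 * (24 * ((l + D + 1) / min (a / 2) (1 / 3)) + 4)) (4 * (l + D + 1))"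

context tree_regression
begin

text \<open>\<open>D\<close> does not involve \<open>card S0\<close>, \<open>n\<close> or
  \<open>p\<close>, so the bound is uniform along a sequence in which the active set
  changes.\<close>

lemma contraction_bound:
  fixes f0 :: "point \<Rightarrow> real" and S0 :: "nat set" and \<alpha> M c1 c2 c3 e m :: real
  defines "q \<equiv> real (card S0)"
  defines "N \<equiv> real n powr (q / (2 * \<alpha> + q))"
  defines "D \<equiv> evidence_exponent a c l c2 (1 + 2 * c3) (max (real C) 4 * c2\<^sup>2 + ((1 + 4 * M) * c1)\<^sup>2)"
  assumes Cn: "C \<le> n" and \<alpha>: "0 < \<alpha>" "\<alpha> \<le> 1"
    and S0: "S0 \<subseteq> {1..p}" "0 < card S0"
    and f0: "f0 \<in> holder_class p \<alpha> \<inter> constant_outside p S0"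
    and c1: "q * holder_norm p \<alpha> f0 \<le> c1 * sqrt (ln (real n))"
    and c2: "sup_norm p f0 \<le> c2 * sqrt (ln (real n))"
    and c3: "ln (real p) \<le> c3 * N" "0 < c3"
    and M: "0 < M" and reg: "regular_design p n x C M S0"
    and e: "0 < e" "8 / real n \<le> e"
    and m: "0 \<le> m" "noise_exponent a l D \<le> m\<^sup>2"
  shows "measure (data_law n x f0)
      {y \<in> space (data_law n x f0). e < measure (posterior n x tree_law y)
         {f \<in> tree_funs p n x C. m * contraction_rate \<alpha> (card S0) n < emp_norm n x (\<lambda>z. f0 z - f z)}}
    \<le> (2 + 8 / e) / real n"
proof -
  define R where "R = N * ln (real n)"
  define d where "d = min (a / 2) (1 / 3)"
  \<comment> \<open>Chosen so that \<open>d * B = (l + D + 1) * R\<close>: \<open>l\<close> cancels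
    the growth \<open>exp (l * R)\<close> of the prior moment, \<open>D\<close> the lower bound on
    the evidence, and 1 leaves the factor \<open>exp (- R)\<close>.\<close>
  define B where "B = (l + D + 1) / d * R"
  define V where "V = noise_exponent a l D * R"
  define W where "W = 2 * exp (l * real n powr d) / (exp l - 1)"
  define lo where "lo = exp (- D * R) / (2 * (exp l - 1))"
  let ?F = "{f \<in> tree_funs p n x C. m * contraction_rate \<alpha> (card S0) n < emp_norm n x (\<lambda>z. f0 z - f z)}"
  have q: "1 \<le> q" using S0 by (simp add: q_def)
  have d: "0 < d" "d \<le> a / 2" "d \<le> 1 / 3" using hyperparameters by (auto simp: d_def)
  have N: "1 \<le> N" unfolding N_def using n q \<alpha> by (intro ge_one_powr_ge_zero) auto
  have R_N: "N \<le> R" unfolding R_def using N ln_n by (simp add: mult_le_cancel_left1)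
  have R_ln: "ln (real n) \<le> R" unfolding R_def using N ln_n by (simp add: mult_le_cancel_right1)
  have R1: "1 \<le> R" using R_ln ln_n by linarith
  have exp_R: "exp (- R) \<le> 1 / real n"
  proof -
    have "exp (- R) \<le> exp (- ln (real n))" using R_ln by simp
    then show ?thesis using n0 by (simp add: exp_minus inverse_eq_divide)
  qed
  have nd: "real n powr d \<le> R"
  proof -
    have "3 * q \<ge> 2 * \<alpha> + q" using q \<alpha> by linarith
    then have "1 / 3 \<le> q / (2 * \<alpha> + q)" using q \<alpha> by (simp add: field_simps)
    then have "d \<le> q / (2 * \<alpha> + q)" using d by linarith
    then have "real n powr d \<le> N" unfolding N_def using n by (intro powr_mono) auto
    then show ?thesis using R_N by linarith
  qed
  have W: "W \<le> 2 * exp (l * R) / (exp l - 1)"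
    unfolding W_def using nd hyperparameters exp_l by (intro divide_right_mono mult_left_mono) auto
  have p1: "1 \<le> p" using p by simp
  note approx = tree_approximation[OF n C Cn p1 design \<alpha> S0 f0 c1[unfolded q_def] c2
      c3[unfolded N_def q_def] M reg, folded q_def, folded N_def]
  obtain S K T b \<delta> where tree: "(S, K, T) \<in> indices"
    "complexity p n S K \<le> (1 + 2 * c3) * (N * ln (real n))"
    "\<And>\<Omega>. \<Omega> \<in> T \<Longrightarrow> \<bar>b \<Omega>\<bar> \<le> c2 * sqrt (ln (real n))"
    "\<And>\<Omega> i. \<Omega> \<in> T \<Longrightarrow> i \<in> {1..n} \<Longrightarrow> x i \<in> \<Omega> \<Longrightarrow> \<bar>f0 (x i) - b \<Omega>\<bar> \<le> \<delta>"
    "0 \<le> \<delta>" "real n * \<delta>\<^sup>2 \<le> (max (real C) 4 * c2\<^sup>2 + ((1 + 4 * M) * c1)\<^sup>2) * (N * ln (real n))"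
    by (rule approx, assumption, rule that)
  have ev: "ennreal lo \<le> (\<integral>\<^sup>+ f. ennreal (likelihood_ratio n x f0 y f) \<partial>tree_law)" if "low_noise f0 R y" for y
    unfolding lo_def D_def
    by (rule evidence_lower[OF tree(1) that R1 tree(3,4,5) _ _]) (use tree in \<open>auto simp: R_def\<close>)
  have F: "?F \<in> sets (tree_fun_space p n x C)"
  proof -
    have ev: "(\<lambda>f. f (x i)) \<in> borel_measurable (tree_fun_space p n x C)" if "i \<in> {1..n}" for i
      using measurable_eval design[OF that] by blast
    have "(\<lambda>f. emp_norm n x (\<lambda>z. f0 z - f z)) \<in> borel_measurable (tree_fun_space p n x C)"
      unfolding emp_norm_def
      by (rule measurable_compose[OF _ borel_measurable_sqrt])
        (intro borel_measurable_divide borel_measurable_sum borel_measurable_power borel_measurable_diff ev borel_measurable_const, auto)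
    then have "{f \<in> space (tree_fun_space p n x C). m * contraction_rate \<alpha> (card S0) n < emp_norm n x (\<lambda>z. f0 z - f z)} \<in> sets (tree_fun_space p n x C)"
      by measurable
    then show ?thesis by (simp only: space_tree_fun_space)
  qed
  have gap: "V \<le> squared_gap n x f0 f" if f: "f \<in> ?F" for f
  proof -
    let ?r = "contraction_rate \<alpha> (card S0) n"
    have r0: "0 \<le> ?r" using ln_n by (auto simp: contraction_rate_def)
    \<comment> \<open>Bias-variance balance: \<open>1 - 2 * \<alpha> / (2 * \<alpha> + q) = q / (2 *
      \<alpha> + q)\<close>, so \<open>n\<close> times the squared rate is
      \<open>N * ln n\<close>.\<close>
    have n_rate: "real n * ?r\<^sup>2 = R"
    proof -
      have "real n * (real n powr (- \<alpha> / (2 * \<alpha> + q)))\<^sup>2 = real n powr 1 * (real n powr (- \<alpha> / (2 * \<alpha> + q)) * real n powr (- \<alpha> / (2 * \<alpha> + q)))"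
        using n0 by (simp add: power2_eq_square)
      also have "\<dots> = real n powr (1 + (- \<alpha> / (2 * \<alpha> + q) + - \<alpha> / (2 * \<alpha> + q)))"
        by (simp only: powr_add)
      also have "1 + (- \<alpha> / (2 * \<alpha> + q) + - \<alpha> / (2 * \<alpha> + q)) = q / (2 * \<alpha> + q)"
      proof -
        have "2 * \<alpha> + q \<noteq> 0" using q \<alpha> by linarith
        moreover have "1 + (- \<alpha> / s + - \<alpha> / s) = (s - 2 * \<alpha>) / s" if "s \<noteq> 0" for s
          using that by (simp add: diff_divide_distrib)
        ultimately show ?thesis by (metis add_diff_cancel_left')
      qed
      finally show ?thesis
        using ln_n by (simp add: contraction_rate_def R_def N_def q_def power_mult_distrib)
    qed
    have "V \<le> m\<^sup>2 * R" unfolding V_def using m R1 by (intro mult_right_mono) auto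
    also have "\<dots> = real n * (m * ?r)\<^sup>2" by (simp add: n_rate[symmetric] power_mult_distrib)
    also have "\<dots> \<le> real n * (emp_norm n x (\<lambda>z. f0 z - f z))\<^sup>2"
      using f m r0 by (intro mult_left_mono power_mono) auto
    also have "\<dots> = squared_gap n x f0 f"
      using n0 by (simp add: emp_norm_def squared_gap_def sum_nonneg power2_commute)
    finally show ?thesis .
  qed
  have V: "16 * (24 * B + 4 * R) \<le> V" "(l + D + 1) * R \<le> V / 4"
  proof -
    have "16 * (24 * B + 4 * R) = 16 * (24 * ((l + D + 1) / d) + 4) * R" by (simp add: B_def algebra_simps)
    also have "\<dots> \<le> V" unfolding V_def noise_exponent_def d_def using R1 by (intro mult_right_mono) auto
    finally show "16 * (24 * B + 4 * R) \<le> V" .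
    have "4 * (l + D + 1) * R \<le> V" unfolding V_def noise_exponent_def using R1 by (intro mult_right_mono) auto
    then have "4 * ((l + D + 1) * R) \<le> V" by (simp only: mult.assoc)
    then show "(l + D + 1) * R \<le> V / 4" by simp
  qed
  have lo0: "0 < lo" using exp_l by (simp add: lo_def)
  have combine: "exp (- ((l + D + 1) * R)) * W \<le> 4 * exp (- R) * lo"
  proof -
    have "exp (- ((l + D + 1) * R)) * W \<le> exp (- ((l + D + 1) * R)) * (2 * exp (l * R) / (exp l - 1))"
      by (intro mult_left_mono W) auto
    also have "\<dots> = 2 * (exp (- ((l + D + 1) * R)) * exp (l * R)) / (exp l - 1)" by simp
    also have "exp (- ((l + D + 1) * R)) * exp (l * R) = exp (- R) * exp (- D * R)"
      unfolding mult_exp_exp by (simp add: algebra_simps)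
    also have "2 * (exp (- R) * exp (- D * R)) / (exp l - 1) = 4 * exp (- R) * lo"
    proof -
      have "2 * (r * s) / w = 4 * r * (s / (2 * w))" for r s w :: real by simp
      then show ?thesis unfolding lo_def .
    qed
    finally show ?thesis .
  qed
  have small: "exp (- V / 4) * W \<le> e / 2 * lo"
  proof -
    have "exp (- V / 4) * W \<le> exp (- ((l + D + 1) * R)) * W"
      using V(2) exp_l by (intro mult_right_mono) (auto simp: W_def)
    also have "\<dots> \<le> 4 * exp (- R) * lo" by (rule combine)
    \<comment> \<open>\<open>8 / n \<le> e\<close> enters here:
      \<open>4 * exp (- R) \<le> 4 / n \<le> e / 2\<close>.\<close>
    also have "\<dots> \<le> e / 2 * lo" using exp_R e lo0 by (intro mult_right_mono) auto
    finally show ?thesis .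
  qed
  have "emeasure (data_law n x f0) {y \<in> space (data_law n x f0). e < measure (posterior n x tree_law y) ?F}
    \<le> ennreal (2 * exp (- R) + 2 / (e * lo) * (exp (- d * B) * W))"
    by (rule posterior_tail[OF _ F gap V(1) _ d(2) lo0 ev e(1) W_def small]) (use tree(1) d in auto)
  also have "\<dots> \<le> ennreal ((2 + 8 / e) / real n)"
  proof (rule ennreal_leI)
    have "- d * B = - ((l + D + 1) * R)" using d by (simp add: B_def)
    then have "2 / (e * lo) * (exp (- d * B) * W) \<le> 2 / (e * lo) * (4 * exp (- R) * lo)"
      using combine e lo0 by (intro mult_left_mono) auto
    also have "\<dots> = 8 / e * exp (- R)" using lo0 by simp
    finally have "2 * exp (- R) + 2 / (e * lo) * (exp (- d * B) * W) \<le> (2 + 8 / e) * exp (- R)"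
      by (simp add: distrib_right)
    also have "\<dots> \<le> (2 + 8 / e) * (1 / real n)" using exp_R e by (intro mult_left_mono) auto
    finally show "2 * exp (- R) + 2 / (e * lo) * (exp (- d * B) * W) \<le> (2 + 8 / e) / real n" by simp
  qed
  finally show ?thesis unfolding measure_def[of "data_law n x f0"] using e by (intro enn2real_leI) auto
qed

end

theorem theorem4p1:
  fixes n p :: "nat \<Rightarrow> nat"
    and x :: "nat \<Rightarrow> nat \<Rightarrow> point"
    and f0 :: "nat \<Rightarrow> point \<Rightarrow> real"
    and S0 :: "nat \<Rightarrow> nat set"
    and \<pi> :: "nat \<Rightarrow> nat set \<Rightarrow> nat \<Rightarrow> partition \<Rightarrow> real"
    and C :: nat
    and \<alpha> M a c l :: real
    and Mn :: "nat \<Rightarrow> real"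
  assumes n_lim: "filterlim n at_top sequentially"
    and p_lim: "filterlim p at_top sequentially"
    and design: "\<And>k i. i \<in> {1..n k} \<Longrightarrow> x k i \<in> cube (p k)"
    and alpha: "0 < \<alpha>" "\<alpha> \<le> 1"
    and S0: "\<And>k. S0 k \<subseteq> {1..p k}" "\<And>k. 0 < card (S0 k)"
    and f0: "\<And>k. f0 k \<in> holder_class (p k) \<alpha> \<inter> constant_outside (p k) (S0 k)"
    and holder_bound:
      "(\<lambda>k. real (card (S0 k)) * holder_norm (p k) \<alpha> (f0 k)) \<in> O(\<lambda>k. sqrt (ln (real (n k))))"
    and sup_bound: "(\<lambda>k. sup_norm (p k) (f0 k)) \<in> O(\<lambda>k. sqrt (ln (real (n k))))"
    and dim_bound:
      "(\<lambda>k. ln (real (p k)))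
         \<in> O(\<lambda>k. real (n k) powr (real (card (S0 k)) / (2 * \<alpha> + real (card (S0 k)))))"
    and C: "0 < C"
    and M: "0 < M"
    and regular: "\<And>k. regular_design (p k) (n k) (x k) C M (S0 k)"
    and hyperparameters: "0 < a" "0 < c" "0 < l"
    and tree_prior: "\<And>k. tree_prior (p k) (n k) (x k) C (\<pi> k)"
    and Mn_lim: "filterlim Mn at_top sequentially"
  shows "\<forall>e>0.
    (\<lambda>k. measure (data_law (n k) (x k) (f0 k))
       {y \<in> space (data_law (n k) (x k) (f0 k)).
          measure (posterior (n k) (x k) (prior (p k) (n k) (x k) C a c l (\<pi> k)) y)
            {f \<in> tree_funs (p k) (n k) (x k) C.
               emp_norm (n k) (x k) (\<lambda>z. f0 k z - f z)
                 > Mn k * contraction_rate \<alpha> (card (S0 k)) (n k)} > e})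
    \<longlonglongrightarrow> 0"
proof (intro allI impI)
  fix e :: real assume e: "0 < e"
  let ?bad = "\<lambda>k. measure (data_law (n k) (x k) (f0 k))
       {y \<in> space (data_law (n k) (x k) (f0 k)).
          measure (posterior (n k) (x k) (prior (p k) (n k) (x k) C a c l (\<pi> k)) y)
            {f \<in> tree_funs (p k) (n k) (x k) C.
               emp_norm (n k) (x k) (\<lambda>z. f0 k z - f z)
                 > Mn k * contraction_rate \<alpha> (card (S0 k)) (n k)} > e}"
  obtain c1 where c1: "\<forall>\<^sub>F k in sequentially. norm (real (card (S0 k)) * holder_norm (p k) \<alpha> (f0 k)) \<le> c1 * norm (sqrt (ln (real (n k))))"
    using holder_bound by (rule landau_o.bigE)
  obtain c2 where c2: "\<forall>\<^sub>F k in sequentially. norm (sup_norm (p k) (f0 k)) \<le> c2 * norm (sqrt (ln (real (n k))))"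
    using sup_bound by (rule landau_o.bigE)
  obtain c3 where c3: "0 < c3" "\<forall>\<^sub>F k in sequentially. norm (ln (real (p k)))
      \<le> c3 * norm (real (n k) powr (real (card (S0 k)) / (2 * \<alpha> + real (card (S0 k)))))"
    using dim_bound by (rule landau_o.bigE)
  \<comment> \<open>The constants of the asymptotic bounds are fixed before \<open>k\<close>, so one
    threshold \<open>v\<close> serves the whole sequence.\<close>
  define D where "D = evidence_exponent a c l c2 (1 + 2 * c3) (max (real C) 4 * c2\<^sup>2 + ((1 + 4 * M) * c1)\<^sup>2)"
  define v where "v = noise_exponent a l D"
  have real_n: "filterlim (\<lambda>k. real (n k)) at_top sequentially"
    using n_lim by (rule filterlim_compose[OF filterlim_real_sequentially])
  have real_p: "filterlim (\<lambda>k. real (p k)) at_top sequentially"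
    using p_lim by (rule filterlim_compose[OF filterlim_real_sequentially])
  have "((\<lambda>t. t powr (- (a / 2))) \<longlongrightarrow> 0) at_top"
    using hyperparameters by (intro tendsto_neg_powr filterlim_ident) auto
  then have "(\<lambda>k. real (p k) powr (- (a / 2))) \<longlonglongrightarrow> 0" by (rule filterlim_compose[OF _ real_p])
  then have p_large: "\<forall>\<^sub>F k in sequentially. real (p k) powr (- (a / 2)) < c / 2"
    using hyperparameters by (intro order_tendstoD) auto
  have inv_n: "(\<lambda>k. w / real (n k)) \<longlonglongrightarrow> 0" for w
    by (rule real_tendsto_divide_at_top[OF tendsto_const real_n])
  then have "\<forall>\<^sub>F k in sequentially. 8 / real (n k) < e" using e by (intro order_tendstoD) auto
  moreover have "\<forall>\<^sub>F k in sequentially. max 3 C \<le> n k" "\<forall>\<^sub>F k in sequentially. 3 \<le> p k"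
    using n_lim p_lim unfolding filterlim_at_top by blast+
  \<comment> \<open>The 1 matters: \<open>1 \<le> Mn k\<close> and \<open>v \<le> Mn k\<close>
    together give \<open>v \<le> (Mn k)\<^sup>2\<close>, the form in which the radius condition is
    needed.\<close>
  moreover have "\<forall>\<^sub>F k in sequentially. max 1 v \<le> Mn k"
    using Mn_lim unfolding filterlim_at_top by blast
  ultimately have "\<forall>\<^sub>F k in sequentially. ?bad k \<le> (2 + 8 / e) / real (n k)"
    using c1 c2 c3(2) p_large
  proof eventually_elim
    case (elim k)
    interpret tree_regression "p k" "n k" C "x k" a c l "\<pi> k"
      using elim C design hyperparameters tree_prior by unfold_locales auto
    have L: "0 \<le> ln (real (n k))" using ln_n by simp
    have "v \<le> Mn k" "1 \<le> Mn k" using elim by auto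
    moreover have "Mn k * 1 \<le> Mn k * Mn k" using \<open>1 \<le> Mn k\<close> by (intro mult_left_mono) auto
    ultimately have v: "v \<le> (Mn k)\<^sup>2" "0 \<le> Mn k" unfolding power2_eq_square by linarith+
    show ?case
    proof (rule contraction_bound[OF _ alpha S0 f0 _ _ _ c3(1) M regular e])
      show "noise_exponent a l (evidence_exponent a c l c2 (1 + 2 * c3) (max (real C) 4 * c2\<^sup>2 + ((1 + 4 * M) * c1)\<^sup>2)) \<le> (Mn k)\<^sup>2"
        using v(1) unfolding v_def D_def .
    qed (use elim L v in auto)
  qed
  note upper = this
  show "?bad \<longlonglongrightarrow> 0"
    by (rule tendsto_sandwich[OF _ upper tendsto_const inv_n]) simp
qed

end
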